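(* Let $\widetilde\Omega$ be a bounded domain in $\mathbb{C}^n$, $n\geq 2$, and let $K\subset\widetilde\Omega$ be a non-empty compact set such that $\Omega=\widetilde\Omega\setminus K$ is connected. Suppose that: (1) $H^{0,1}_{L^2}(\widetilde\Omega)$ is Hausdorff. (2) $K=\bigcap_{j=1}^N K_j$, where for $1\leq j\leq N$, $K_j\subset\widetilde\Omega$ is a compact set such that $\widetilde\Omega\setminus K_j$ is connected and $H^{0,1}_{L^2}(\widetilde\Omega\setminus K_j)$ is Hausdorff. (3) For each pair of indices $1\leq i,j\leq N$, the set $\widetilde\Omega\setminus(K_i\cup K_j)$ is connected. Then $H^{0,1}_{L^2}(\Omega)$ is Hausdorff.
   Context: For an open set $U\subset\mathbb{C}^n$, $L^2_{p,q}(U)$ is the space of $(p,q)$-forms on $U$ with $L^2$ coefficients and $\overline\partial$ acts in the sense of distributions. The $L^2$-Dolbeault cohomology is $$H^{p,q}_{L^2}(U)=\frac{\{f\in L^2_{p,q}(U):\overline\partial f=0\}}{\{\overline\partial g: g\in L^2_{p,q-1}(U),\ \overline\partial g\in L^2_{p,q}(U)\}},$$ with the quotient topology; it is Hausdorff if and only if $\overline\partial$ from $L^2_{p,q-1}(U)$ to $L^2_{p,q}(U)$ (with its maximal domain) has closed range. *)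

theory Defs
  imports "HOL-Analysis.Analysis"
begin

section \<open>Distributional Cauchy-Riemann operators\<close>

text \<open>
  The space C^n is \<^typ>\<open>complex^'n\<close>, regarded as a real Euclidean space of
  dimension 2n; derivatives are Frechet derivatives over the reals. For maps between
  Euclidean spaces, being of class C^(k+1) means being differentiable with all directional
  derivatives of class C^k.
\<close>

primrec C_class :: "nat \<Rightarrow> ('a::euclidean_space \<Rightarrow> 'b::real_normed_vector) \<Rightarrow> bool" where
  "C_class 0 f \<longleftrightarrow> continuous_on UNIV f"
| "C_class (Suc k) f \<longleftrightarrow>
     (\<forall>x. f differentiable (at x)) \<and> (\<forall>v. C_class k (\<lambda>x. frechet_derivative f (at x) v))"

definition test_function :: "(complex^'n) set \<Rightarrow> (complex^'n \<Rightarrow> complex) \<Rightarrow> bool" where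
  "test_function U \<phi> \<longleftrightarrow>
     (\<forall>k. C_class k \<phi>) \<and> compact (closure {z. \<phi> z \<noteq> 0}) \<and> closure {z. \<phi> z \<noteq> 0} \<subseteq> U"

text \<open>The Wirtinger derivative (d/dx_k + i d/dy_k) / 2, where z_k = x_k + i y_k.\<close>

definition wirtinger_bar :: "'n \<Rightarrow> (complex^'n \<Rightarrow> complex) \<Rightarrow> complex^'n \<Rightarrow> complex" where
  "wirtinger_bar k \<phi> z =
     (frechet_derivative \<phi> (at z) (axis k 1)
       + \<i> * frechet_derivative \<phi> (at z) (axis k \<i>)) / 2"

definition distr :: "(complex^'n) set \<Rightarrow> (complex^'n \<Rightarrow> complex) \<Rightarrow> (complex^'n \<Rightarrow> complex) \<Rightarrow> complex"
  where "distr U u \<phi> = integral\<^sup>L (lebesgue_on U) (\<lambda>z. u z * \<phi> z)"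

text \<open>The distribution d u / d zbar_k on \<open>U\<close>, evaluated at the test function \<open>\<phi>\<close>.\<close>

definition distr_dbar ::
    "(complex^'n) set \<Rightarrow> 'n \<Rightarrow> (complex^'n \<Rightarrow> complex) \<Rightarrow> (complex^'n \<Rightarrow> complex) \<Rightarrow> complex"
  where "distr_dbar U k u \<phi> = - distr U u (wirtinger_bar k \<phi>)"


section \<open>Square-integrable forms of bidegree (0,0) and (0,1)\<close>

text \<open>
  A (0,0)-form is a function \<open>complex^'n \<Rightarrow> complex\<close>, and the (0,1)-form with coefficients
  f_1, ..., f_n (the sum of the f_k d zbar_k) is the function \<open>complex^'n \<Rightarrow> complex^'n\<close> with
  these components. Forms are functions rather than classes modulo equality almost
  everywhere, and their values outside \<open>U\<close> are irrelevant; on the (0,1)-forms this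
  ambiguity disappears in the cohomology, because every form vanishing almost everywhere
  on \<open>U\<close> belongs to \<open>dbar_exact U\<close>, being the image of 0.
\<close>

definition L2 :: "('a::euclidean_space) set \<Rightarrow> ('a \<Rightarrow> 'b::euclidean_space) set" where
  "L2 U = {f. f \<in> borel_measurable (lebesgue_on U) \<and>
              integrable (lebesgue_on U) (\<lambda>z. (norm (f z))\<^sup>2)}"

definition L2_norm :: "('a::euclidean_space) set \<Rightarrow> ('a \<Rightarrow> 'b::euclidean_space) \<Rightarrow> real" where
  "L2_norm U f = sqrt (integral\<^sup>L (lebesgue_on U) (\<lambda>z. (norm (f z))\<^sup>2))"

definition L2_topology :: "('a::euclidean_space) set \<Rightarrow> ('a \<Rightarrow> 'b::euclidean_space) topology" where
  "L2_topology U = topology (\<lambda>S. S \<subseteq> L2 U \<and>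
     (\<forall>f\<in>S. \<exists>e>0. \<forall>g\<in>L2 U. L2_norm U (\<lambda>z. g z - f z) < e \<longrightarrow> g \<in> S))"

text \<open>\<open>dbar_eq U g f\<close>: the (0,0)-form \<open>g\<close> satisfies dbar g = f on \<open>U\<close>.\<close>

definition dbar_eq ::
    "(complex^'n) set \<Rightarrow> (complex^'n \<Rightarrow> complex) \<Rightarrow> (complex^'n \<Rightarrow> complex^'n) \<Rightarrow> bool" where
  "dbar_eq U g f \<longleftrightarrow>
     (\<forall>\<phi>. test_function U \<phi> \<longrightarrow> (\<forall>k. distr_dbar U k g \<phi> = distr U (\<lambda>z. f z $ k) \<phi>))"

text \<open>
  For a (0,1)-form f, the coefficient of d zbar_j wedge d zbar_k in dbar f is
  d f_k / d zbar_j - d f_j / d zbar_k.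
\<close>

definition dbar_closed :: "(complex^'n) set \<Rightarrow> (complex^'n \<Rightarrow> complex^'n) set" where
  "dbar_closed U = {f \<in> L2 U. \<forall>\<phi>. test_function U \<phi> \<longrightarrow>
     (\<forall>j k. distr_dbar U j (\<lambda>z. f z $ k) \<phi> - distr_dbar U k (\<lambda>z. f z $ j) \<phi> = 0)}"

definition dbar_exact :: "(complex^'n) set \<Rightarrow> (complex^'n \<Rightarrow> complex^'n) set" where
  "dbar_exact U = {f \<in> L2 U. \<exists>g \<in> L2 U. dbar_eq U g f}"


section \<open>The quotient topology and the cohomology space\<close>

definition quotient_topology :: "'a topology \<Rightarrow> ('a \<Rightarrow> 'b) \<Rightarrow> 'b topology" where
  "quotient_topology X q =
     topology (\<lambda>V. V \<subseteq> q ` topspace X \<and> openin X {x \<in> topspace X. q x \<in> V})"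

definition cohomology_class ::
    "(complex^'n) set \<Rightarrow> (complex^'n \<Rightarrow> complex^'n) \<Rightarrow> (complex^'n \<Rightarrow> complex^'n) set" where
  "cohomology_class U f = {h \<in> dbar_closed U. (\<lambda>z. h z - f z) \<in> dbar_exact U}"

text \<open>
  The L2-Dolbeault cohomology of bidegree (0,1), as a topological space whose points are
  the cohomology classes.
\<close>

definition L2_cohomology_01 :: "(complex^'n) set \<Rightarrow> (complex^'n \<Rightarrow> complex^'n) set topology" where
  "L2_cohomology_01 U =
     quotient_topology (subtopology (L2_topology U) (dbar_closed U)) (cohomology_class U)"


text \<open>The two predicates passed to \<^const>\<open>topology\<close> above are indeed topologies.\<close>

lemma openin_L2_topology:
  fixes S :: "('a::euclidean_space \<Rightarrow> 'b::euclidean_space) set"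
  shows "openin (L2_topology U) S \<longleftrightarrow> S \<subseteq> L2 U \<and>
     (\<forall>f\<in>S. \<exists>e>0. \<forall>g\<in>L2 U. L2_norm U (\<lambda>z. g z - f z) < e \<longrightarrow> g \<in> S)"
proof -
  have "istopology (\<lambda>S :: ('a \<Rightarrow> 'b) set. S \<subseteq> L2 U \<and>
     (\<forall>f\<in>S. \<exists>e>0. \<forall>g\<in>L2 U. L2_norm U (\<lambda>z. g z - f z) < e \<longrightarrow> g \<in> S))" (is "istopology ?P")
    unfolding istopology_def
  proof (intro conjI allI impI ballI)
    fix S T f assume S: "?P S" and T: "?P T" and f: "f \<in> S \<inter> T"
    obtain d where d: "d > 0" "\<And>g. g \<in> L2 U \<Longrightarrow> L2_norm U (\<lambda>z. g z - f z) < d \<Longrightarrow> g \<in> S"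
      using S f by blast
    obtain e where e: "e > 0" "\<And>g. g \<in> L2 U \<Longrightarrow> L2_norm U (\<lambda>z. g z - f z) < e \<Longrightarrow> g \<in> T"
      using T f by blast
    show "\<exists>e>0. \<forall>g\<in>L2 U. L2_norm U (\<lambda>z. g z - f z) < e \<longrightarrow> g \<in> S \<inter> T"
      using d e by (intro exI[of _ "min d e"]) auto
  next
    fix \<K> f assume \<K>: "Ball \<K> ?P" and "f \<in> \<Union>\<K>"
    then obtain S where S: "S \<in> \<K>" "f \<in> S" by blast
    then obtain e where "e > 0" "\<forall>g\<in>L2 U. L2_norm U (\<lambda>z. g z - f z) < e \<longrightarrow> g \<in> S"
      using \<K> by blast
    then show "\<exists>e>0. \<forall>g\<in>L2 U. L2_norm U (\<lambda>z. g z - f z) < e \<longrightarrow> g \<in> \<Union>\<K>"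
      using S by blast
  qed blast+
  then show ?thesis
    unfolding L2_topology_def by (simp only: topology_inverse')
qed

lemma topspace_L2_topology: "topspace (L2_topology U) = L2 U"
proof -
  have "openin (L2_topology U) (L2 U)"
    by (auto simp: openin_L2_topology intro: exI[of _ 1])
  then show ?thesis
    by (meson openin_L2_topology openin_subset openin_topspace subset_antisym)
qed

lemma openin_quotient_topology:
  "openin (quotient_topology X q) V \<longleftrightarrow>
     V \<subseteq> q ` topspace X \<and> openin X {x \<in> topspace X. q x \<in> V}"
proof -
  have "istopology (\<lambda>V. V \<subseteq> q ` topspace X \<and> openin X {x \<in> topspace X. q x \<in> V})"
    unfolding istopology_def
  proof (intro conjI allI impI)
    fix S T
    assume S: "S \<subseteq> q ` topspace X \<and> openin X {x \<in> topspace X. q x \<in> S}"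
      and T: "T \<subseteq> q ` topspace X \<and> openin X {x \<in> topspace X. q x \<in> T}"
    have "openin X ({x \<in> topspace X. q x \<in> S} \<inter> {x \<in> topspace X. q x \<in> T})"
      by (intro openin_Int conjunct2[OF S] conjunct2[OF T])
    also have "{x \<in> topspace X. q x \<in> S} \<inter> {x \<in> topspace X. q x \<in> T} =
        {x \<in> topspace X. q x \<in> S \<inter> T}" by blast
    finally show "openin X {x \<in> topspace X. q x \<in> S \<inter> T}" .
  next
    fix \<K>
    assume "\<forall>V\<in>\<K>. V \<subseteq> q ` topspace X \<and> openin X {x \<in> topspace X. q x \<in> V}"
    then have "openin X (\<Union>V\<in>\<K>. {x \<in> topspace X. q x \<in> V})" by blast
    moreover have "{x \<in> topspace X. q x \<in> \<Union>\<K>} = (\<Union>V\<in>\<K>. {x \<in> topspace X. q x \<in> V})" by blast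
    ultimately show "openin X {x \<in> topspace X. q x \<in> \<Union>\<K>}" by simp
  qed blast+
  then show ?thesis
    unfolding quotient_topology_def by (simp only: topology_inverse')
qed

lemma topspace_quotient_topology: "topspace (quotient_topology X q) = q ` topspace X"
proof -
  have "{x \<in> topspace X. q x \<in> q ` topspace X} = topspace X" by blast
  then have "openin (quotient_topology X q) (q ` topspace X)"
    by (simp add: openin_quotient_topology)
  then show ?thesis
    by (meson openin_quotient_topology openin_subset openin_topspace subset_antisym)
qed

lemma quotient_map_quotient_topology: "quotient_map X (quotient_topology X q) q"
  by (auto simp: quotient_map_def topspace_quotient_topology openin_quotient_topology)

end

theory Submission
  imports Defs "HOL-Complex_Analysis.Complex_Analysis" "HOL-Real_Asymp.Real_Asymp"
begin

text \<open>
  The quotient is Hausdorff exactly when the exact forms are closed among the dbar-closed forms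
  (\<open>Hausdorff_imp_exact_forms_closed\<close> and its converse). So let \<open>f\<close> be a limit of exact forms on
  \<open>\<Omega>' - K\<close>. As \<open>K\<close> is the intersection of the \<open>K\<^sub>j\<close>, the sets \<open>\<Omega>' - K\<^sub>j\<close> cover \<open>\<Omega>' - K\<close>.
  Restriction does not increase norms, so \<open>f\<close> is a limit of exact forms on every \<open>\<Omega>' - K\<^sub>j\<close>, and the
  hypothesis there gives square-integrable solutions \<open>u\<^sub>j\<close> of dbar \<open>u\<^sub>j = f\<close>. These need not agree,
  but \<open>u\<^sub>i - u\<^sub>j\<close> is holomorphic on \<open>\<Omega>' - (K\<^sub>i \<union> K\<^sub>j)\<close>, the connected complement of a compact set.
  By Hartogs' theorem it extends to \<open>\<Omega>'\<close>, so the obstruction to gluing is trivial: if \<open>H\<^sub>j\<close> extends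
  \<open>u\<^sub>1 - u\<^sub>j\<close>, then the functions \<open>u\<^sub>j + H\<^sub>j\<close> agree on overlaps, again because the overlaps are
  connected, and together they solve dbar \<open>g = f\<close> on \<open>\<Omega>' - K\<close>
  (\<open>dbar_exact_on_union_of_complements\<close>).

  Holomorphic functions are taken in the sense of distributions throughout. The identity theorem
  \<open>weakly_holomorphic_identity\<close> holds for them because a mollified function is genuinely holomorphic
  along complex lines, and mollifiers can be chosen close to indicators of boxes. Hartogs' theorem
  \<open>hartogs_extension\<close> is proved by the method of Ehrenpreis: cut the function off near the compact
  set and correct the error, a compactly supported dbar-closed (0,1)-form, by a Cauchy transform in
  one variable. The correction vanishes wherever a second coordinate is large; this is where
  dimension at least 2 enters. That the Cauchy transform solves the equation is the Cauchy-Pompeiu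
  formula \<open>cauchy_pompeiu_at_0\<close>.
\<close>

section \<open>Smooth functions\<close>

definition smooth :: "('a::euclidean_space \<Rightarrow> 'b::real_normed_vector) \<Rightarrow> bool" where
  "smooth f \<longleftrightarrow> (\<forall>k. C_class k f)"

lemma C_class_SucI:
  assumes "\<And>x. (f has_derivative f' x) (at x)" and "\<And>v. C_class k (\<lambda>x. f' x v)"
  shows "C_class (Suc k) f"
proof -
  have "frechet_derivative f (at x) = f' x" for x
    using frechet_derivative_at[OF assms(1)] by simp
  then show ?thesis
    using assms by (auto simp: differentiable_def)
qed

lemma C_class_Suc_has_derivative:
  "C_class (Suc k) f \<Longrightarrow> (f has_derivative frechet_derivative f (at x)) (at x)"
  by (simp add: frechet_derivative_works)

lemma C_class_SucD: "C_class (Suc k) f \<Longrightarrow> C_class k f"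
proof (induction k arbitrary: f)
  case 0
  then show ?case
    by (auto intro!: differentiable_imp_continuous_on simp: differentiable_on_def
        intro: differentiable_at_withinI)
next
  case (Suc k)
  then show ?case by (metis C_class.simps(2))
qed

lemma C_class_const: "C_class k (\<lambda>x. c)"
proof (induction k arbitrary: c)
  case (Suc k)
  show ?case
    by (rule C_class_SucI[where f' = "\<lambda>_ _. 0"]) (auto intro: Suc)
qed simp

lemma C_class_affine_compose:
  assumes "bounded_linear A" and "C_class k f"
  shows "C_class k (\<lambda>x. f (a + A x))"
  using assms(2)
proof (induction k arbitrary: f)
  case 0
  have "continuous_on UNIV A" using assms(1) by (simp add: linear_continuous_on)
  then have "continuous_on UNIV (\<lambda>x. a + A x)"
    by (intro continuous_intros)
  then show ?case
    using continuous_on_compose2[OF 0[simplified], of UNIV "\<lambda>x. a + A x"] by simp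
next
  case (Suc k)
  show ?case
  proof (rule C_class_SucI)
    fix x
    have "((\<lambda>x. a + A x) has_derivative A) (at x)"
      using has_derivative_add[OF has_derivative_const bounded_linear_imp_has_derivative[OF assms(1)]] by simp
    from has_derivative_compose[OF this C_class_Suc_has_derivative[OF Suc.prems]]
    show "((\<lambda>x. f (a + A x)) has_derivative (\<lambda>v. frechet_derivative f (at (a + A x)) (A v))) (at x)" .
  next
    fix v
    show "C_class k (\<lambda>x. frechet_derivative f (at (a + A x)) (A v))"
      using Suc.prems by (intro Suc.IH[of "\<lambda>y. frechet_derivative f (at y) (A v)"]) simp
  qed
qed

lemma C_class_linear_compose:
  assumes "bounded_linear B" and "C_class k f"
  shows "C_class k (\<lambda>x. B (f x))"
  using assms(2)
proof (induction k arbitrary: f)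
  case 0
  then show ?case
    by (simp add: linear_continuous_on_compose assms(1) bounded_linear.continuous_on)
next
  case (Suc k)
  show ?case
  proof (rule C_class_SucI)
    fix x show "((\<lambda>x. B (f x)) has_derivative (\<lambda>v. B (frechet_derivative f (at x) v))) (at x)"
      by (rule bounded_linear.has_derivative[OF assms(1) C_class_Suc_has_derivative[OF Suc.prems]])
  next
    fix v show "C_class k (\<lambda>x. B (frechet_derivative f (at x) v))"
      using Suc.prems by (intro Suc.IH) simp
  qed
qed

lemma C_class_add:
  assumes "C_class k f" and "C_class k g"
  shows "C_class k (\<lambda>x. f x + g x)"
  using assms
proof (induction k arbitrary: f g)
  case 0
  then show ?case by (simp add: continuous_on_add)
next
  case (Suc k)
  show ?case
    by (rule C_class_SucI[OF has_derivative_add[OF Suc.prems[THEN C_class_Suc_has_derivative]]])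
      (use Suc in auto)
qed

lemma C_class_mult:
  fixes f g :: "'a::euclidean_space \<Rightarrow> 'b::real_normed_algebra"
  assumes "C_class k f" and "C_class k g"
  shows "C_class k (\<lambda>x. f x * g x)"
  using assms
proof (induction k arbitrary: f g)
  case 0
  then show ?case by (simp add: continuous_on_mult)
next
  case (Suc k)
  show ?case
    by (rule C_class_SucI[OF has_derivative_mult[OF Suc.prems[THEN C_class_Suc_has_derivative]]],
        rule C_class_add)
      (use Suc.prems Suc.prems[THEN C_class_SucD] in \<open>auto intro: Suc.IH\<close>)
qed

lemma C_class_inverse:
  fixes f :: "'a::euclidean_space \<Rightarrow> 'b::real_normed_field"
  assumes "\<And>x. f x \<noteq> 0" and "C_class k f"
  shows "C_class k (\<lambda>x. inverse (f x))"
  using assms(2)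
proof (induction k)
  case 0
  then show ?case by (simp add: continuous_on_inverse assms(1))
next
  case (Suc k)
  have IH: "C_class k (\<lambda>x. inverse (f x))"
    by (rule Suc.IH[OF C_class_SucD[OF Suc.prems]])
  show ?case
  proof (rule C_class_SucI)
    fix x
    show "((\<lambda>x. inverse (f x)) has_derivative
        (\<lambda>v. -1 * (inverse (f x) * frechet_derivative f (at x) v * inverse (f x)))) (at x)"
      using Deriv.has_derivative_inverse[OF assms(1) C_class_Suc_has_derivative[OF Suc.prems]] by simp
  next
    fix v
    show "C_class k (\<lambda>x. -1 * (inverse (f x) * frechet_derivative f (at x) v * inverse (f x)))"
      using Suc.prems by (intro C_class_mult C_class_const IH) simp
  qed
qed

lemma smooth_has_derivative:
  "smooth f \<Longrightarrow> (f has_derivative frechet_derivative f (at x)) (at x)"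
  unfolding smooth_def using C_class_Suc_has_derivative[of 0] by blast

lemma smooth_derivative: "smooth f \<Longrightarrow> smooth (\<lambda>x. frechet_derivative f (at x) v)"
  unfolding smooth_def by (metis C_class.simps(2))

lemma smooth_continuous: "smooth f \<Longrightarrow> continuous_on S f"
  unfolding smooth_def using C_class.simps(1) continuous_on_subset by blast

lemma smooth_const: "smooth (\<lambda>x. c)"
  and smooth_add: "smooth f \<Longrightarrow> smooth g \<Longrightarrow> smooth (\<lambda>x. f x + g x)"
  by (simp_all add: smooth_def C_class_const C_class_add)

lemma smooth_mult:
  fixes f g :: "'a::euclidean_space \<Rightarrow> 'b::real_normed_algebra"
  shows "smooth f \<Longrightarrow> smooth g \<Longrightarrow> smooth (\<lambda>x. f x * g x)"
  by (simp add: smooth_def C_class_mult)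

lemma smooth_cmult:
  fixes f :: "'a::euclidean_space \<Rightarrow> 'b::real_normed_algebra"
  shows "smooth f \<Longrightarrow> smooth (\<lambda>x. c * f x)"
  by (intro smooth_mult smooth_const)

lemma smooth_prod:
  fixes f :: "'i \<Rightarrow> 'a::euclidean_space \<Rightarrow> 'b::real_normed_field"
  assumes "\<And>i. i \<in> I \<Longrightarrow> smooth (f i)"
  shows "smooth (\<lambda>x. \<Prod>i\<in>I. f i x)"
  using assms by (induction I rule: infinite_finite_induct) (auto intro: smooth_const smooth_mult)

lemma smooth_of_real: "smooth f \<Longrightarrow> smooth (\<lambda>x. complex_of_real (f x))"
  unfolding smooth_def using C_class_linear_compose[OF bounded_linear_of_real] by blast

lemma smooth_affine_compose: "smooth f \<Longrightarrow> bounded_linear A \<Longrightarrow> smooth (\<lambda>x. f (a + A x))"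
  by (simp add: smooth_def C_class_affine_compose)

lemma smooth_reflect: "smooth f \<Longrightarrow> smooth (\<lambda>x. f (a - x))"
  using smooth_affine_compose[of f "\<lambda>x. - x" a] by (simp add: bounded_linear_minus)

text \<open>
  Smoothness is the largest property stable under differentiation in all directions, so it suffices
  to exhibit a set of functions with this stability.
\<close>

lemma smooth_coinduct:
  assumes "f \<in> S"
    and "\<And>f. f \<in> S \<Longrightarrow> \<exists>f'. (\<forall>x. (f has_derivative f' x) (at x)) \<and> (\<forall>v. (\<lambda>x. f' x v) \<in> S)"
  shows "smooth f"
proof -
  have "\<forall>f\<in>S. C_class k f" for k
  proof (induction k)
    case 0
    show ?case
    proof
      fix f assume "f \<in> S"
      then obtain f' where "\<And>x. (f has_derivative f' x) (at x)"
        using assms(2) by blast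
      then show "C_class 0 f"
        by (auto intro!: continuous_at_imp_continuous_on has_derivative_continuous)
    qed
  next
    case (Suc k)
    show ?case
    proof
      fix f assume "f \<in> S"
      then obtain f' where f': "\<And>x. (f has_derivative f' x) (at x)" "\<And>v. (\<lambda>x. f' x v) \<in> S"
        using assms(2) by blast
      show "C_class (Suc k) f"
        by (rule C_class_SucI[OF f'(1)]) (use f'(2) Suc in blast)
    qed
  qed
  then show ?thesis using assms(1) by (simp add: smooth_def)
qed

section \<open>Smooth cutoff functions\<close>

text \<open>
  The functions \<open>P (1 / t) exp (- 1 / t)\<close>, continued by 0 to \<open>t \<le> 0\<close>. This family is closed under
  differentiation, which turns \<open>P\<close> into \<open>X\<^sup>2 (P - P')\<close>.
\<close>

definition flat_at_0 :: "real poly \<Rightarrow> real \<Rightarrow> real" where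
  "flat_at_0 P t = (if t > 0 then poly P (1 / t) * exp (- (1 / t)) else 0)"

lemma poly_exp_decay: "((\<lambda>s::real. poly P s * exp (- s)) \<longlongrightarrow> 0) at_top"
proof (induction P)
  case 0
  then show ?case by simp
next
  case (pCons a P)
  have "((\<lambda>s::real. poly P s * s * exp (- s)) \<longlongrightarrow> 0) at_top"
  proof -
    have lim: "((\<lambda>s::real. s ^ k / exp s) \<longlongrightarrow> 0) at_top" for k
      by (rule tendsto_power_div_exp_0)
    have "((\<lambda>s::real. \<Sum>i\<le>degree P. coeff P i * (s ^ Suc i / exp s)) \<longlongrightarrow> (\<Sum>i\<le>degree P. coeff P i * 0)) at_top"
      by (intro tendsto_sum tendsto_mult lim tendsto_const)
    moreover have "(\<Sum>i\<le>degree P. coeff P i * (s ^ Suc i / exp s)) = poly P s * s * exp (- s)" for s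
      by (simp add: poly_altdef sum_distrib_right sum_distrib_left exp_minus field_simps)
    ultimately show ?thesis by simp
  qed
  moreover have "((\<lambda>s::real. a * exp (- s)) \<longlongrightarrow> a * 0) at_top"
    by (intro tendsto_mult tendsto_const filterlim_compose[OF exp_at_bot]
        filterlim_uminus_at_bot_at_top)
  ultimately have "((\<lambda>s::real. a * exp (- s) + poly P s * s * exp (- s)) \<longlongrightarrow> a * 0 + 0) at_top"
    by (intro tendsto_add) auto
  then show ?case by (simp add: algebra_simps)
qed

text \<open>
  At 0 the difference quotient is a polynomial in \<open>s = 1 / t\<close> times \<open>exp (- s)\<close>, and \<open>s\<close> tends to infinity.
\<close>

lemma flat_at_0_deriv:
  "(flat_at_0 P has_real_derivative flat_at_0 (pCons 0 (pCons 0 (P - pderiv P))) t) (at t)"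
proof -
  let ?Q = "pCons 0 (pCons 0 (P - pderiv P))"
  consider "t > 0" | "t < 0" | "t = 0" by linarith
  then show ?thesis
  proof cases
    case 1
    have "((\<lambda>t. poly P (1 / t) * exp (- (1 / t))) has_real_derivative flat_at_0 ?Q t) (at t)"
      using 1 by (auto intro!: derivative_eq_intros DERIV_chain'[OF _ poly_DERIV] simp: flat_at_0_def field_simps power2_eq_square)
    then show ?thesis
      by (rule has_field_derivative_transform_within_open[of _ _ _ "{0<..}"])
        (use 1 in \<open>auto simp: flat_at_0_def\<close>)
  next
    case 2
    have "((\<lambda>t. 0) has_real_derivative flat_at_0 ?Q t) (at t)"
      using 2 by (simp add: flat_at_0_def)
    then show ?thesis
      by (rule has_field_derivative_transform_within_open[of _ _ _ "{..<0}"])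
        (use 2 in \<open>auto simp: flat_at_0_def\<close>)
  next
    case 3
    have "((\<lambda>y. flat_at_0 P y / y) \<longlongrightarrow> 0) (at_right 0)"
    proof -
      have "((\<lambda>s::real. poly (pCons 0 P) s * exp (- s)) \<longlongrightarrow> 0) at_top"
        by (rule poly_exp_decay)
      then have "((\<lambda>y::real. poly (pCons 0 P) (inverse y) * exp (- inverse y)) \<longlongrightarrow> 0) (at_right 0)"
        by (rule filterlim_compose[OF _ filterlim_inverse_at_top_right])
      moreover have "\<forall>\<^sub>F y in at_right 0. poly (pCons 0 P) (inverse y) * exp (- inverse y) = flat_at_0 P y / y"
        using eventually_at_right_less[of 0]
        by eventually_elim (simp add: flat_at_0_def field_simps)
      ultimately show ?thesis by (rule Lim_transform_eventually)
    qed
    moreover have "((\<lambda>y. flat_at_0 P y / y) \<longlongrightarrow> 0) (at_left 0)"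
    proof (rule Lim_transform_eventually[OF tendsto_const])
      show "\<forall>\<^sub>F y in at_left 0. 0 = flat_at_0 P y / y"
        by (rule eventually_at_leftI[of "-1"]) (auto simp: flat_at_0_def)
    qed
    ultimately have "((\<lambda>y. flat_at_0 P y / y) \<longlongrightarrow> 0) (at 0)"
      by (simp add: filterlim_at_split)
    then show ?thesis
      unfolding has_field_derivative_iff by (simp add: 3 flat_at_0_def)
  qed
qed

lemma smooth_flat_at_0: "smooth (flat_at_0 P)"
proof (rule smooth_coinduct[where S = "{\<lambda>t. c * flat_at_0 P t | c P. True}"])
  show "flat_at_0 P \<in> {\<lambda>t. c * flat_at_0 P t | c P. True}"
    by (auto intro!: exI[of _ 1] exI[of _ P])
next
  fix f assume "f \<in> {\<lambda>t. c * flat_at_0 P t | c P. True}"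
  then obtain c P where f: "f = (\<lambda>t. c * flat_at_0 P t)" by auto
  let ?Q = "pCons 0 (pCons 0 (P - pderiv P))"
  have "(f has_derivative (\<lambda>v. c * v * flat_at_0 ?Q x)) (at x)" for x
    unfolding f using flat_at_0_deriv[of P x]
    by (auto simp: has_field_derivative_def mult.commute mult.left_commute intro!: derivative_eq_intros)
  then show "\<exists>f'. (\<forall>x. (f has_derivative f' x) (at x)) \<and>
      (\<forall>v. (\<lambda>x. f' x v) \<in> {\<lambda>t. c * flat_at_0 P t | c P. True})"
    by (intro exI[of _ "\<lambda>x v. c * v * flat_at_0 ?Q x"]) blast
qed

definition smooth_step :: "real \<Rightarrow> real" where
  "smooth_step t = flat_at_0 1 t * inverse (flat_at_0 1 t + flat_at_0 1 (1 - t))"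

lemma flat_at_0_one: "flat_at_0 1 t \<ge> 0" "flat_at_0 1 t > 0 \<longleftrightarrow> t > 0"
  by (auto simp: flat_at_0_def)

lemma flat_at_0_one_sum_pos: "flat_at_0 1 t + flat_at_0 1 (1 - t) > 0"
  using flat_at_0_one[of t] flat_at_0_one[of "1 - t"] by (cases "t > 0") auto

lemma smooth_smooth_step: "smooth smooth_step"
proof -
  have "smooth (\<lambda>t. flat_at_0 1 t + flat_at_0 1 (1 - t))"
    by (intro smooth_add smooth_reflect smooth_flat_at_0)
  then have "smooth (\<lambda>t. inverse (flat_at_0 1 t + flat_at_0 1 (1 - t)))"
    unfolding smooth_def using flat_at_0_one_sum_pos by (auto intro!: C_class_inverse simp: less_imp_neq[symmetric])
  then have "smooth (\<lambda>t. smooth_step t)"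
    unfolding smooth_step_def by (intro smooth_mult smooth_flat_at_0)
  then show ?thesis by simp
qed

lemma smooth_step_eq_0: "t \<le> 0 \<Longrightarrow> smooth_step t = 0"
  and smooth_step_eq_1: "t \<ge> 1 \<Longrightarrow> smooth_step t = 1"
  by (auto simp: smooth_step_def flat_at_0_def)

lemma smooth_step_bounds: "0 \<le> smooth_step t" "smooth_step t \<le> 1"
  using flat_at_0_one(1)[of t] flat_at_0_one(1)[of "1 - t"] flat_at_0_one_sum_pos[of t]
  by (auto simp: smooth_step_def field_simps)

text \<open>
  The parameter \<open>m\<close> is the steepness of the faces: the function is 1 at distance at least \<open>1 / m\<close>
  from all faces of the box, and it tends to the indicator of the open box.
\<close>

definition box_bump :: "real \<Rightarrow> 'a::euclidean_space \<Rightarrow> 'a \<Rightarrow> 'a \<Rightarrow> real" where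
  "box_bump m a b x =
     (\<Prod>i\<in>Basis. smooth_step (m * (x \<bullet> i - a \<bullet> i)) * smooth_step (m * (b \<bullet> i - x \<bullet> i)))"

lemma smooth_box_bump: "smooth (box_bump m a b)"
proof -
  have "smooth (\<lambda>x::'a. smooth_step (- (m * (a \<bullet> i)) + m * (x \<bullet> i)))" for i
    by (intro smooth_affine_compose[OF smooth_smooth_step] bounded_linear_const_mult bounded_linear_inner_left)
  moreover have "smooth (\<lambda>x::'a. smooth_step (m * (b \<bullet> i) + (- m) * (x \<bullet> i)))" for i
    by (intro smooth_affine_compose[OF smooth_smooth_step] bounded_linear_const_mult bounded_linear_inner_left)
  ultimately have "smooth (\<lambda>x::'a. \<Prod>i\<in>Basis. smooth_step (- (m * (a \<bullet> i)) + m * (x \<bullet> i))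
      * smooth_step (m * (b \<bullet> i) + (- m) * (x \<bullet> i)))"
    by (intro smooth_prod smooth_mult)
  moreover have "(\<lambda>x. \<Prod>i\<in>Basis. smooth_step (- (m * (a \<bullet> i)) + m * (x \<bullet> i))
      * smooth_step (m * (b \<bullet> i) + (- m) * (x \<bullet> i))) = box_bump m a b"
    by (simp add: box_bump_def fun_eq_iff algebra_simps)
  ultimately show ?thesis by simp
qed

lemma box_bump_bounds: "0 \<le> box_bump m a b x" "box_bump m a b x \<le> 1"
proof -
  have "0 \<le> smooth_step s * smooth_step t \<and> smooth_step s * smooth_step t \<le> 1" for s t
    using smooth_step_bounds[of s] smooth_step_bounds[of t] by (simp add: mult_le_one)
  then show "0 \<le> box_bump m a b x" "box_bump m a b x \<le> 1"
    unfolding box_bump_def by (blast intro: prod_nonneg prod_le_1)+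
qed

lemma box_bump_eq_0:
  assumes "m > 0" and "x \<notin> box a b"
  shows "box_bump m a b x = 0"
proof -
  obtain i where i: "i \<in> Basis" "x \<bullet> i \<le> a \<bullet> i \<or> b \<bullet> i \<le> x \<bullet> i"
    using assms(2) by (auto simp: mem_box not_less)
  then have "smooth_step (m * (x \<bullet> i - a \<bullet> i)) * smooth_step (m * (b \<bullet> i - x \<bullet> i)) = 0"
    using assms(1) by (auto intro!: smooth_step_eq_0 mult_nonneg_nonpos)
  then show ?thesis
    unfolding box_bump_def using i(1) by (intro prod_zero) auto
qed

lemma box_bump_eq_1:
  assumes "\<And>i. i \<in> Basis \<Longrightarrow> 1 \<le> m * (x \<bullet> i - a \<bullet> i) \<and> 1 \<le> m * (b \<bullet> i - x \<bullet> i)"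
  shows "box_bump m a b x = 1"
  unfolding box_bump_def using assms by (intro prod.neutral) (auto simp: smooth_step_eq_1)

lemma box_bump_tendsto_indicator:
  "(\<lambda>m. box_bump (real (Suc m)) a b x) \<longlonglongrightarrow> indicator (box a b) x"
proof (cases "x \<in> box a b")
  case False
  then have "(\<lambda>m. box_bump (real (Suc m)) a b x) = (\<lambda>m. 0)"
    by (auto intro!: box_bump_eq_0)
  then show ?thesis using False by simp
next
  case True
  have "\<forall>\<^sub>F m in sequentially. 1 \<le> real (Suc m) * (x \<bullet> i - a \<bullet> i) \<and> 1 \<le> real (Suc m) * (b \<bullet> i - x \<bullet> i)"
    if "i \<in> Basis" for i
  proof -
    have pos: "x \<bullet> i - a \<bullet> i > 0" "b \<bullet> i - x \<bullet> i > 0" using True that by (auto simp: mem_box)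
    have "\<forall>\<^sub>F m in sequentially. 1 \<le> real (Suc m) * c" if "c > 0" for c :: real
      using that by real_asymp
    from this[OF pos(1)] this[OF pos(2)] show ?thesis by eventually_elim auto
  qed
  then have "\<forall>\<^sub>F m in sequentially. \<forall>i\<in>Basis. 1 \<le> real (Suc m) * (x \<bullet> i - a \<bullet> i) \<and> 1 \<le> real (Suc m) * (b \<bullet> i - x \<bullet> i)"
    by (intro eventually_ball_finite) auto
  then have "\<forall>\<^sub>F m in sequentially. 1 = box_bump (real (Suc m)) a b x"
    by eventually_elim (rule box_bump_eq_1[symmetric], blast)
  then have "(\<lambda>m. box_bump (real (Suc m)) a b x) \<longlonglongrightarrow> 1"
    by (rule Lim_transform_eventually[OF tendsto_const])
  then show ?thesis using True by simp
qed

text \<open>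
  Finitely many boxes inside \<open>U\<close> suffice, and one minus the product of the complementary bumps is 1
  as soon as one of the bumps is.
\<close>

lemma smooth_cutoff:
  fixes C U :: "'a::euclidean_space set"
  assumes "compact C" and "open U" and "C \<subseteq> U"
  obtains \<psi> :: "'a \<Rightarrow> real" and N where "smooth \<psi>" "open N" "C \<subseteq> N" "\<And>x. x \<in> N \<Longrightarrow> \<psi> x = 1"
    "compact (closure {x. \<psi> x \<noteq> 0})" "closure {x. \<psi> x \<noteq> 0} \<subseteq> U"
proof -
  have "\<exists>a b N m. x \<in> N \<and> open N \<and> cbox a b \<subseteq> U \<and> (\<forall>y\<in>N. box_bump m a b y = 1) \<and> m > 0"
    if "x \<in> C" for x
  proof -
    have "x \<in> U" using assms(3) that by blast
    then obtain a b where ab: "x \<in> box a b" "cbox a b \<subseteq> U"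
      by (rule open_contains_cbox[OF assms(2)])
    have "\<forall>\<^sub>F m in sequentially. 1 < real (Suc m) * c" if "c > 0" for c :: real
      using that by real_asymp
    then have "\<forall>\<^sub>F m in sequentially. 1 < real (Suc m) * (x \<bullet> i - a \<bullet> i) \<and> 1 < real (Suc m) * (b \<bullet> i - x \<bullet> i)"
      if "i \<in> Basis" for i
      using ab(1) that by (intro eventually_conj) (auto simp: mem_box)
    then have "\<forall>\<^sub>F m in sequentially. \<forall>i\<in>Basis. 1 < real (Suc m) * (x \<bullet> i - a \<bullet> i) \<and> 1 < real (Suc m) * (b \<bullet> i - x \<bullet> i)"
      by (intro eventually_ball_finite) auto
    then obtain k where k: "\<forall>i\<in>Basis. 1 < real (Suc k) * (x \<bullet> i - a \<bullet> i) \<and> 1 < real (Suc k) * (b \<bullet> i - x \<bullet> i)"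
      unfolding eventually_sequentially by blast
    define N where "N = {y. \<forall>i\<in>Basis. 1 < real (Suc k) * (y \<bullet> i - a \<bullet> i) \<and> 1 < real (Suc k) * (b \<bullet> i - y \<bullet> i)}"
    have "N = (\<Inter>i\<in>Basis. {y. 1 < real (Suc k) * (y \<bullet> i - a \<bullet> i)} \<inter> {y. 1 < real (Suc k) * (b \<bullet> i - y \<bullet> i)})"
      by (auto simp: N_def)
    also have "open \<dots>"
      by (intro open_INT open_Int open_Collect_less continuous_intros ballI) auto
    finally have "open N" .
    moreover have "\<forall>y\<in>N. box_bump (real (Suc k)) a b y = 1"
      unfolding N_def by (blast intro: box_bump_eq_1 less_imp_le)
    moreover have "x \<in> N" using k by (simp add: N_def)
    ultimately show ?thesis using ab(2) by (intro exI[of _ a] exI[of _ b] exI[of _ N] exI[of _ "real (Suc k)"]) auto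
  qed
  then obtain a b N m where loc: "\<And>x. x \<in> C \<Longrightarrow> x \<in> N x" "\<And>x. x \<in> C \<Longrightarrow> open (N x)"
    "\<And>x. x \<in> C \<Longrightarrow> cbox (a x) (b x) \<subseteq> U" "\<And>x y. x \<in> C \<Longrightarrow> y \<in> N x \<Longrightarrow> box_bump (m x) (a x) (b x) y = 1"
    "\<And>x. x \<in> C \<Longrightarrow> m x > 0"
    by metis
  obtain X where X: "X \<subseteq> C" "finite X" "C \<subseteq> (\<Union>x\<in>X. N x)"
    using compactE_image[OF assms(1), of C N] loc(1,2) by blast
  define \<psi> where "\<psi> y = 1 + (-1) * (\<Prod>x\<in>X. 1 + (-1) * box_bump (m x) (a x) (b x) y)" for y
  have "smooth \<psi>"
    unfolding \<psi>_def by (intro smooth_add smooth_const smooth_cmult smooth_prod smooth_box_bump)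
  moreover have "\<psi> y = 1" if "y \<in> (\<Union>x\<in>X. N x)" for y
  proof -
    from that obtain x where "x \<in> X" "y \<in> N x" by blast
    then have "(\<Prod>x\<in>X. 1 + (-1) * box_bump (m x) (a x) (b x) y) = 0"
      using X loc(4)[of x y] by (intro prod_zero) auto
    then show ?thesis by (simp add: \<psi>_def)
  qed
  moreover have supp: "closure {y. \<psi> y \<noteq> 0} \<subseteq> (\<Union>x\<in>X. cbox (a x) (b x))"
  proof (rule closure_minimal)
    show "closed (\<Union>x\<in>X. cbox (a x) (b x))" using X(2) by auto
    show "{y. \<psi> y \<noteq> 0} \<subseteq> (\<Union>x\<in>X. cbox (a x) (b x))"
    proof (clarify, rule ccontr)
      fix y assume y: "\<psi> y \<noteq> 0" "y \<notin> (\<Union>x\<in>X. cbox (a x) (b x))"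
      then have "box_bump (m x) (a x) (b x) y = 0" if "x \<in> X" for x
        using that X(1) loc(5) box_subset_cbox by (intro box_bump_eq_0) blast+
      then have "\<psi> y = 0" by (simp add: \<psi>_def)
      with y(1) show False by simp
    qed
  qed
  moreover have "compact (closure {y. \<psi> y \<noteq> 0})"
  proof -
    have "compact (\<Union>x\<in>X. cbox (a x) (b x))" using X(2) by auto
    then show ?thesis using supp by (metis closed_closure compact_Int_closed inf.absorb2)
  qed
  moreover have "(\<Union>x\<in>X. cbox (a x) (b x)) \<subseteq> U" using X(1) loc(3) by blast
  moreover have "open (\<Union>x\<in>X. N x)" using X(1) loc(2) by blast
  ultimately show ?thesis using X(3) that[of \<psi> "\<Union>x\<in>X. N x"] by (metis subset_trans)
qed

section \<open>Symmetry of second derivatives\<close>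

text \<open>
  The mean value theorem, applied in the direction \<open>v\<close> and then in the direction \<open>w\<close>. The left-hand
  side is symmetric in \<open>v\<close> and \<open>w\<close>; this forces the symmetry of the second derivative.
\<close>

lemma second_difference_mean_value:
  fixes f :: "'a::euclidean_space \<Rightarrow> real"
  assumes "smooth f" and "s > 0"
  shows "\<exists>\<sigma>\<in>{0<..<s}. \<exists>\<tau>\<in>{0<..<s}. f (x + s *\<^sub>R v + s *\<^sub>R w) - f (x + s *\<^sub>R v) - f (x + s *\<^sub>R w) + f x
    = s\<^sup>2 * frechet_derivative (\<lambda>y. frechet_derivative f (at y) v) (at (x + \<sigma> *\<^sub>R v + \<tau> *\<^sub>R w)) w"
proof -
  have line: "((\<lambda>t. g (a + t *\<^sub>R u)) has_real_derivative frechet_derivative g (at (a + t *\<^sub>R u)) u) (at t)"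
    if "smooth g" for g :: "'a \<Rightarrow> real" and a u t
  proof -
    have "((\<lambda>t. a + t *\<^sub>R u) has_derivative (\<lambda>t. t *\<^sub>R u)) (at t)"
      by (auto intro!: derivative_eq_intros)
    from has_derivative_compose[OF this smooth_has_derivative[OF that]]
    have "((\<lambda>t. g (a + t *\<^sub>R u)) has_derivative (\<lambda>s. frechet_derivative g (at (a + t *\<^sub>R u)) (s *\<^sub>R u))) (at t)" .
    moreover have "frechet_derivative g (at (a + t *\<^sub>R u)) (s *\<^sub>R u) = frechet_derivative g (at (a + t *\<^sub>R u)) u * s" for s
      using linear_cmul[OF has_derivative_linear[OF smooth_has_derivative[OF that]]] by (simp add: mult.commute)
    ultimately show ?thesis
      by (simp add: has_field_derivative_def)
  qed
  define h where "h t = f (x + s *\<^sub>R w + t *\<^sub>R v) - f (x + t *\<^sub>R v)" for t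
  define h' where "h' t = frechet_derivative f (at (x + s *\<^sub>R w + t *\<^sub>R v)) v - frechet_derivative f (at (x + t *\<^sub>R v)) v" for t
  have "(h has_real_derivative h' t) (at t)" for t
    unfolding h_def h'_def by (intro DERIV_diff line assms(1))
  then obtain \<sigma> where \<sigma>: "0 < \<sigma>" "\<sigma> < s" "h s - h 0 = (s - 0) * h' \<sigma>"
    using MVT2[OF assms(2), of h h'] by blast
  let ?g = "\<lambda>y. frechet_derivative f (at y) v"
  have "((\<lambda>t. ?g (x + \<sigma> *\<^sub>R v + t *\<^sub>R w)) has_real_derivative frechet_derivative ?g (at (x + \<sigma> *\<^sub>R v + t *\<^sub>R w)) w) (at t)" for t
    by (rule line[OF smooth_derivative[OF assms(1)]])
  then obtain \<tau> where \<tau>: "0 < \<tau>" "\<tau> < s" "?g (x + \<sigma> *\<^sub>R v + s *\<^sub>R w) - ?g (x + \<sigma> *\<^sub>R v + 0 *\<^sub>R w) = (s - 0) * frechet_derivative ?g (at (x + \<sigma> *\<^sub>R v + \<tau> *\<^sub>R w)) w"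
    using MVT2[OF assms(2), of "\<lambda>t. ?g (x + \<sigma> *\<^sub>R v + t *\<^sub>R w)" "\<lambda>t. frechet_derivative ?g (at (x + \<sigma> *\<^sub>R v + t *\<^sub>R w)) w"] by blast
  have "h' \<sigma> = ?g (x + \<sigma> *\<^sub>R v + s *\<^sub>R w) - ?g (x + \<sigma> *\<^sub>R v + 0 *\<^sub>R w)"
    by (simp add: h'_def algebra_simps)
  with \<sigma>(3) \<tau>(3) have "h s - h 0 = s\<^sup>2 * frechet_derivative ?g (at (x + \<sigma> *\<^sub>R v + \<tau> *\<^sub>R w)) w"
    by (simp add: power2_eq_square)
  moreover have "h s - h 0 = f (x + s *\<^sub>R v + s *\<^sub>R w) - f (x + s *\<^sub>R v) - f (x + s *\<^sub>R w) + f x"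
    by (simp add: h_def algebra_simps)
  ultimately show ?thesis
    using \<sigma>(1,2) \<tau>(1,2) by (intro bexI[of _ \<sigma>] bexI[of _ \<tau>]) auto
qed

text \<open>
  By \<open>second_difference_mean_value\<close> the quotient is a value of the iterated derivative at a point that
  tends to \<open>x\<close>.
\<close>

lemma second_difference_tendsto:
  fixes f :: "'a::euclidean_space \<Rightarrow> real"
  assumes "smooth f"
  shows "(\<lambda>n. (f (x + inverse (Suc n) *\<^sub>R v + inverse (Suc n) *\<^sub>R w) - f (x + inverse (Suc n) *\<^sub>R v)
      - f (x + inverse (Suc n) *\<^sub>R w) + f x) / (inverse (Suc n))\<^sup>2)
    \<longlonglongrightarrow> frechet_derivative (\<lambda>y. frechet_derivative f (at y) v) (at x) w"
proof -
  let ?vw = "\<lambda>y. frechet_derivative (\<lambda>x. frechet_derivative f (at x) v) (at y) w"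
  define s where "s n = inverse (real (Suc n))" for n
  have s: "s n > 0" for n by (simp add: s_def)
  have s0: "s \<longlonglongrightarrow> 0" unfolding s_def by (rule LIMSEQ_inverse_real_of_nat)
  have "\<exists>\<sigma> \<tau>. 0 < \<sigma> \<and> \<sigma> < s n \<and> 0 < \<tau> \<and> \<tau> < s n \<and>
    f (x + s n *\<^sub>R v + s n *\<^sub>R w) - f (x + s n *\<^sub>R v) - f (x + s n *\<^sub>R w) + f x
      = (s n)\<^sup>2 * ?vw (x + \<sigma> *\<^sub>R v + \<tau> *\<^sub>R w)" for n
    using second_difference_mean_value[OF assms s, of n x v w] by fastforce
  then obtain \<sigma> \<tau> where \<sigma>\<tau>: "\<And>n. 0 < \<sigma> n \<and> \<sigma> n < s n" "\<And>n. 0 < \<tau> n \<and> \<tau> n < s n"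
    "\<And>n. f (x + s n *\<^sub>R v + s n *\<^sub>R w) - f (x + s n *\<^sub>R v) - f (x + s n *\<^sub>R w) + f x
      = (s n)\<^sup>2 * ?vw (x + \<sigma> n *\<^sub>R v + \<tau> n *\<^sub>R w)"
    by metis
  have "\<sigma> \<longlonglongrightarrow> 0" "\<tau> \<longlonglongrightarrow> 0"
    using \<sigma>\<tau>(1,2) by (auto intro!: tendsto_sandwich[OF _ _ tendsto_const s0] always_eventually less_imp_le)
  then have "(\<lambda>n. x + \<sigma> n *\<^sub>R v + \<tau> n *\<^sub>R w) \<longlonglongrightarrow> x + 0 *\<^sub>R v + 0 *\<^sub>R w" by (intro tendsto_intros)
  moreover have "isCont ?vw (x + 0 *\<^sub>R v + 0 *\<^sub>R w)"
    using smooth_continuous[OF smooth_derivative[OF smooth_derivative[OF assms]], of UNIV]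
    by (simp add: continuous_on_eq_continuous_at)
  ultimately have "(\<lambda>n. ?vw (x + \<sigma> n *\<^sub>R v + \<tau> n *\<^sub>R w)) \<longlonglongrightarrow> ?vw (x + 0 *\<^sub>R v + 0 *\<^sub>R w)"
    by (rule isCont_tendsto_compose[rotated])
  moreover have "?vw (x + \<sigma> n *\<^sub>R v + \<tau> n *\<^sub>R w)
    = (f (x + s n *\<^sub>R v + s n *\<^sub>R w) - f (x + s n *\<^sub>R v) - f (x + s n *\<^sub>R w) + f x) / (s n)\<^sup>2" for n
    unfolding \<sigma>\<tau>(3) using s[of n] by simp
  ultimately show ?thesis by (simp add: s_def del: of_nat_Suc)
qed

lemma smooth_derivative_commute_real:
  fixes f :: "'a::euclidean_space \<Rightarrow> real"
  assumes "smooth f"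
  shows "frechet_derivative (\<lambda>x. frechet_derivative f (at x) v) (at x) w
       = frechet_derivative (\<lambda>x. frechet_derivative f (at x) w) (at x) v"
proof -
  have "x + s *\<^sub>R w + s *\<^sub>R v = x + s *\<^sub>R v + s *\<^sub>R w" for s by simp
  moreover have "p - b - a + q = p - a - b + q" for p q a b :: real by simp
  ultimately show ?thesis
    using LIMSEQ_unique[OF second_difference_tendsto[OF assms, of x v w]] second_difference_tendsto[OF assms, of x w v]
    by (simp only:)
qed

lemma smooth_derivative_commute:
  fixes f :: "'a::euclidean_space \<Rightarrow> 'b::euclidean_space"
  assumes "smooth f"
  shows "frechet_derivative (\<lambda>x. frechet_derivative f (at x) v) (at x) w
       = frechet_derivative (\<lambda>x. frechet_derivative f (at x) w) (at x) v"
proof (rule euclidean_eqI)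
  fix b :: 'b
  have comp: "frechet_derivative (\<lambda>y. g y \<bullet> b) (at x) u = frechet_derivative g (at x) u \<bullet> b"
    if "smooth g" for g :: "'a \<Rightarrow> 'b" and u x
    by (rule fun_cong[OF frechet_derivative_at, OF bounded_linear.has_derivative[OF bounded_linear_inner_left smooth_has_derivative[OF that]], symmetric])
  have "smooth (\<lambda>y. f y \<bullet> b)"
    using assms unfolding smooth_def using C_class_linear_compose[OF bounded_linear_inner_left] by blast
  from smooth_derivative_commute_real[OF this, of v x w]
  show "frechet_derivative (\<lambda>x. frechet_derivative f (at x) v) (at x) w \<bullet> b =
    frechet_derivative (\<lambda>x. frechet_derivative f (at x) w) (at x) v \<bullet> b"
    by (simp add: comp assms smooth_derivative)
qed

section \<open>Differentiation under the integral sign\<close>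

lemma integrable_mult_bounded:
  fixes \<kappa> g :: "'m \<Rightarrow> complex"
  assumes "integrable M \<kappa>" and "g \<in> borel_measurable M" and "\<And>z. norm (g z) \<le> B"
  shows "integrable M (\<lambda>z. \<kappa> z * g z)"
proof (rule Bochner_Integration.integrable_bound)
  show "integrable M (\<lambda>z. B * norm (\<kappa> z))" using assms(1) by simp
  show "(\<lambda>z. \<kappa> z * g z) \<in> borel_measurable M" using assms(1,2) by simp
  have "B \<ge> 0" using assms(3) norm_ge_zero order_trans by blast
  then show "AE z in M. norm (\<kappa> z * g z) \<le> norm (B * norm (\<kappa> z))"
    using assms(3) by (intro AE_I2) (simp add: norm_mult mult.commute[of "norm (\<kappa> _)"] mult_right_mono)
qed

lemma supp_subset_ball:
  fixes f :: "'a::euclidean_space \<Rightarrow> 'b::real_normed_vector"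
  assumes "compact (closure {x. f x \<noteq> 0})"
  obtains R where "R > 0" "\<And>x. norm x \<ge> R \<Longrightarrow> f x = 0"
proof -
  obtain B where B: "\<And>x. x \<in> closure {x. f x \<noteq> 0} \<Longrightarrow> norm x \<le> B"
    using compact_imp_bounded[OF assms] bounded_iff by blast
  have "f x = 0" if "norm x \<ge> \<bar>B\<bar> + 1" for x
    using B[of x] that closure_subset[of "{x. f x \<noteq> 0}"] by fastforce
  then show ?thesis by (intro that[of "\<bar>B\<bar> + 1"]) auto
qed

lemma continuous_vanishing_bounded:
  fixes f :: "'a::euclidean_space \<Rightarrow> 'b::real_normed_vector"
  assumes "continuous_on UNIV f" and "\<And>x. norm x \<ge> R \<Longrightarrow> f x = 0"
  obtains B where "B > 0" "\<And>x. norm (f x) \<le> B"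
proof -
  have "bounded (f ` cball 0 R)"
    using assms(1) by (intro compact_imp_bounded compact_continuous_image) (auto intro: continuous_on_subset)
  then obtain B where B: "B > 0" "\<And>x. norm x \<le> R \<Longrightarrow> norm (f x) \<le> B"
    unfolding bounded_pos by auto
  then have "norm (f x) \<le> B" for x
    using assms(2)[of x] by (cases "norm x \<le> R") auto
  then show ?thesis using B(1) that by blast
qed

lemma continuous_vanishing_uniform:
  fixes f :: "'a::euclidean_space \<Rightarrow> 'b::real_normed_vector"
  assumes "continuous_on UNIV f" and "\<And>x. norm x \<ge> R \<Longrightarrow> f x = 0" and "e > 0"
  shows "\<exists>d>0. \<forall>x y. norm (y - x) < d \<longrightarrow> norm (f y - f x) < e"
proof -
  have "uniformly_continuous_on (cball 0 (R + 1)) f"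
    using assms(1) by (intro compact_uniformly_continuous) (auto intro: continuous_on_subset)
  then obtain d where d: "d > 0" "\<And>x y. x \<in> cball 0 (R + 1) \<Longrightarrow> y \<in> cball 0 (R + 1) \<Longrightarrow> dist y x < d \<Longrightarrow> dist (f y) (f x) < e"
    using assms(3) unfolding uniformly_continuous_on_def by blast
  have "norm (f y - f x) < e" if "norm (y - x) < min d 1" for x y
  proof (cases "norm x \<le> R + 1 \<and> norm y \<le> R + 1")
    case True
    then show ?thesis using d(2)[of x y] that by (simp add: dist_norm)
  next
    case False
    have "norm x \<le> norm y + norm (y - x)" "norm y \<le> norm x + norm (y - x)"
      by norm+
    then have "f x = 0" "f y = 0"
      using that False by (auto intro!: assms(2))
    then show ?thesis using assms(3) by simp
  qed
  then show ?thesis using d(1) by (intro exI[of _ "min d 1"]) auto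
qed

lemma derivative_eq_0_of_vanishing:
  assumes "(f has_derivative f') (at x)" and "open U" and "x \<in> U" and "\<And>y. y \<in> U \<Longrightarrow> f y = c"
  shows "f' v = 0"
proof -
  have "((\<lambda>_. c) has_derivative f') (at x)"
    by (rule has_derivative_transform_within_open[OF assms(1-3)]) (simp add: assms(4))
  then have "f' = (\<lambda>_. 0)"
    using has_derivative_unique has_derivative_const by blast
  then show ?thesis by simp
qed

lemma derivative_vanishing:
  fixes f :: "'a::euclidean_space \<Rightarrow> 'b::real_normed_vector"
  assumes "\<And>x. (f has_derivative f' x) (at x)" and "\<And>x. norm x \<ge> R \<Longrightarrow> f x = 0" and "norm x > R"
  shows "f' x v = 0"
proof (rule derivative_eq_0_of_vanishing[OF assms(1)])
  show "open {x::'a. norm x > R}" by (intro open_Collect_less continuous_intros)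
qed (use assms in auto)

text \<open>
  The error is bounded by the oscillation of the derivative, and the partial derivatives, being
  continuous and zero outside a ball, are uniformly continuous.
\<close>

lemma C1_uniformly_linearized:
  fixes f :: "'a::euclidean_space \<Rightarrow> 'b::real_normed_vector"
  assumes der: "\<And>x. (f has_derivative f' x) (at x)" and cont: "\<And>v. continuous_on UNIV (\<lambda>x. f' x v)"
    and van: "\<And>x. norm x \<ge> R \<Longrightarrow> f x = 0" and "e > 0"
  shows "\<exists>d>0. \<forall>x y. norm (y - x) < d \<longrightarrow> norm (f y - f x - f' x (y - x)) \<le> e * norm (y - x)"
proof -
  define e' where "e' = e / DIM('a)"
  have e': "e' > 0" using \<open>e > 0\<close> by (simp add: e'_def)
  have van': "norm x \<ge> R + 1 \<Longrightarrow> f' x v = 0" for x v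
    by (rule derivative_vanishing[OF der van]) auto
  have "\<exists>d>0. \<forall>x y. norm (y - x) < d \<longrightarrow> norm (f' y b - f' x b) < e'" for b
    by (rule continuous_vanishing_uniform[OF cont van' e'])
  then obtain d where d: "\<And>b. d b > 0" "\<And>b x y. norm (y - x) < d b \<Longrightarrow> norm (f' y b - f' x b) < e'"
    by metis
  define \<delta> where "\<delta> = Min (d ` (Basis :: 'a set))"
  have \<delta>: "\<delta> > 0" unfolding \<delta>_def using d(1) by simp
  have \<delta>_le: "\<delta> \<le> d b" if "b \<in> Basis" for b :: 'a unfolding \<delta>_def using that by simp
  have "norm (f y - f x - f' x (y - x)) \<le> norm (y - x) * e" if xy: "norm (y - x) < \<delta>" for x y
  proof (rule differentiable_bound_linearization[where S = "ball x \<delta>" and f' = f'])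
    show "x + t *\<^sub>R (y - x) \<in> ball x \<delta>" if "t \<in> {0..1}" for t
    proof -
      have "norm (t *\<^sub>R (y - x)) \<le> norm (y - x)" using that by (simp add: mult_left_le_one_le)
      then show ?thesis using xy by (simp add: dist_norm)
    qed
    show "(f has_derivative f' z) (at z within ball x \<delta>)" for z
      by (rule has_derivative_at_withinI[OF der])
    show "onorm (f' z - f' x) \<le> e" if "z \<in> ball x \<delta>" for z
    proof (rule onorm_bound)
      show "0 \<le> e" using \<open>e > 0\<close> by simp
      fix v
      have lin: "linear (f' z - f' x)"
        using linear_compose_sub[OF has_derivative_linear[OF der] has_derivative_linear[OF der]]
        by (simp add: fun_diff_def)
      have "(f' z - f' x) v = (f' z - f' x) (\<Sum>b\<in>Basis. (v \<bullet> b) *\<^sub>R b)"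
        by (simp only: euclidean_representation)
      also have "\<dots> = (\<Sum>b\<in>Basis. (v \<bullet> b) *\<^sub>R (f' z - f' x) b)"
        by (simp only: linear_sum[OF lin] linear_cmul[OF lin])
      also have "norm \<dots> \<le> (\<Sum>b\<in>(Basis::'a set). norm v * e')"
      proof (rule sum_norm_le)
        fix b :: 'a assume b: "b \<in> Basis"
        have "norm (z - x) < d b" using that \<delta>_le[OF b] by (simp add: dist_norm norm_minus_commute)
        then have "norm ((f' z - f' x) b) \<le> e'" using d(2)[of z x b] by (simp add: less_imp_le)
        then show "norm ((v \<bullet> b) *\<^sub>R (f' z - f' x) b) \<le> norm v * e'"
          using Basis_le_norm[OF b, of v] by (simp only: norm_scaleR) (auto intro!: mult_mono)
      qed
      also have "\<dots> = e * norm v" by (simp add: e'_def)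
      finally show "norm ((f' z - f' x) v) \<le> e * norm v" .
    qed
    show "x \<in> ball x \<delta>" using \<delta> by simp
  qed
  then show ?thesis using \<delta> by (auto simp: mult.commute)
qed

lemma integrable_mult_translate:
  fixes \<kappa> :: "'m \<Rightarrow> complex" and T :: "'m \<Rightarrow> 'a::euclidean_space" and f :: "'a \<Rightarrow> complex"
  assumes \<kappa>: "integrable M \<kappa>" and T: "T \<in> borel_measurable M"
    and f: "continuous_on UNIV f" "\<And>x. norm x \<ge> R \<Longrightarrow> f x = 0"
  shows "integrable M (\<lambda>z. \<kappa> z * f (x + T z))"
proof -
  obtain B where B: "\<And>x. norm (f x) \<le> B" using continuous_vanishing_bounded[OF f] by blast
  have "(\<lambda>z. f (x + T z)) \<in> borel_measurable M"
    using T borel_measurable_continuous_onI[OF f(1)] by measurable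
  then show ?thesis by (rule integrable_mult_bounded[OF \<kappa>]) (rule B)
qed

lemma smooth_derivative_vanishing:
  assumes "smooth f" and "\<And>x. norm x \<ge> R \<Longrightarrow> f x = 0" and "norm x \<ge> R + 1"
  shows "frechet_derivative f (at x) v = 0"
  by (rule derivative_vanishing[OF smooth_has_derivative[OF assms(1)] assms(2)]) (use assms(3) in auto)

text \<open>
  The linearization of \<open>f\<close> is uniform in the base point, hence survives integration. Three instances
  matter: \<open>T x = - x\<close> with a function \<open>\<kappa>\<close> to be mollified, the embedding \<open>T\<close> of a coordinate line with
  the Cauchy kernel \<open>\<kappa>\<close>, and the identity \<open>T\<close> with the indicator \<open>\<kappa>\<close> of a ball.
\<close>

lemma has_derivative_integral_translate:
  fixes \<kappa> :: "'m \<Rightarrow> complex" and T :: "'m \<Rightarrow> 'a::euclidean_space" and f :: "'a \<Rightarrow> complex"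
  assumes \<kappa>: "integrable M \<kappa>" and T: "T \<in> borel_measurable M"
    and der: "\<And>x. (f has_derivative f' x) (at x)" and cont: "\<And>v. continuous_on UNIV (\<lambda>x. f' x v)"
    and van: "\<And>x. norm x \<ge> R \<Longrightarrow> f x = 0"
  shows "((\<lambda>x. \<integral>z. \<kappa> z * f (x + T z) \<partial>M) has_derivative (\<lambda>v. \<integral>z. \<kappa> z * f' (x + T z) v \<partial>M)) (at x)"
proof -
  have cf: "continuous_on UNIV f"
    using der by (auto intro!: continuous_at_imp_continuous_on has_derivative_continuous)
  have van': "norm x \<ge> R + 1 \<Longrightarrow> f' x v = 0" for x v
    by (rule derivative_vanishing[OF der van]) auto
  have intf: "integrable M (\<lambda>z. \<kappa> z * f (x + T z))" for x
    by (rule integrable_mult_translate[OF \<kappa> T cf van])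
  have intf': "integrable M (\<lambda>z. \<kappa> z * f' (x + T z) v)" for x v
    by (rule integrable_mult_translate[OF \<kappa> T cont van'])
  show ?thesis
    unfolding has_derivative_at_alt
  proof (intro conjI allI impI)
    have lin: "linear (f' x)" for x by (rule has_derivative_linear[OF der])
    have "linear (\<lambda>v. \<integral>z. \<kappa> z * f' (x + T z) v \<partial>M)"
    proof (rule linearI)
      show "(\<integral>z. \<kappa> z * f' (x + T z) (u + v) \<partial>M) = (\<integral>z. \<kappa> z * f' (x + T z) u \<partial>M) + (\<integral>z. \<kappa> z * f' (x + T z) v \<partial>M)" for u v
        using intf'[of x u] intf'[of x v] by (simp add: linear_add[OF lin] distrib_left)
      show "(\<integral>z. \<kappa> z * f' (x + T z) (r *\<^sub>R v) \<partial>M) = r *\<^sub>R (\<integral>z. \<kappa> z * f' (x + T z) v \<partial>M)" for r v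
        by (simp add: linear_cmul[OF lin])
    qed
    then show "bounded_linear (\<lambda>v. \<integral>z. \<kappa> z * f' (x + T z) v \<partial>M)"
      by (simp add: linear_conv_bounded_linear)
  next
    fix e :: real assume "e > 0"
    define I where "I = (\<integral>z. norm (\<kappa> z) \<partial>M)"
    have I: "I \<ge> 0" by (simp add: I_def)
    define e' where "e' = e / (I + 1)"
    have e': "e' > 0" "I * e' \<le> e" using \<open>e > 0\<close> I by (auto simp: e'_def field_simps)
    obtain d where d: "d > 0" "\<And>x y. norm (y - x) < d \<Longrightarrow> norm (f y - f x - f' x (y - x)) \<le> e' * norm (y - x)"
      using C1_uniformly_linearized[OF der cont van e'(1)] by blast
    show "\<exists>d>0. \<forall>y. norm (y - x) < d \<longrightarrow>
        norm ((\<integral>z. \<kappa> z * f (y + T z) \<partial>M) - (\<integral>z. \<kappa> z * f (x + T z) \<partial>M) - (\<integral>z. \<kappa> z * f' (x + T z) (y - x) \<partial>M))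
        \<le> e * norm (y - x)"
    proof (intro exI[of _ d] conjI allI impI d(1))
      fix y assume y: "norm (y - x) < d"
      have "(\<integral>z. \<kappa> z * f (y + T z) \<partial>M) - (\<integral>z. \<kappa> z * f (x + T z) \<partial>M) - (\<integral>z. \<kappa> z * f' (x + T z) (y - x) \<partial>M)
        = (\<integral>z. \<kappa> z * (f (y + T z) - f (x + T z) - f' (x + T z) (y - x)) \<partial>M)"
        using intf[of x] intf[of y] intf'[of x "y - x"] by (simp add: right_diff_distrib)
      also have "norm \<dots> \<le> (\<integral>z. norm (\<kappa> z * (f (y + T z) - f (x + T z) - f' (x + T z) (y - x))) \<partial>M)"
        by (rule integral_norm_bound)
      also have "\<dots> \<le> (\<integral>z. norm (\<kappa> z) * (e' * norm (y - x)) \<partial>M)"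
      proof (rule integral_mono)
        show "integrable M (\<lambda>z. norm (\<kappa> z * (f (y + T z) - f (x + T z) - f' (x + T z) (y - x))))"
          unfolding right_diff_distrib
          using intf[of x] intf[of y] intf'[of x "y - x"] by (intro integrable_norm Bochner_Integration.integrable_diff)
        show "integrable M (\<lambda>z. norm (\<kappa> z) * (e' * norm (y - x)))"
          using \<kappa> by simp
        show "norm (\<kappa> z * (f (y + T z) - f (x + T z) - f' (x + T z) (y - x))) \<le> norm (\<kappa> z) * (e' * norm (y - x))" for z
          using d(2)[of "y + T z" "x + T z"] y by (simp add: norm_mult mult_left_mono)
      qed
      also have "\<dots> = (I * e') * norm (y - x)" by (simp add: I_def)
      also have "\<dots> \<le> e * norm (y - x)" using e'(2) by (intro mult_right_mono) auto
      finally show "norm ((\<integral>z. \<kappa> z * f (y + T z) \<partial>M) - (\<integral>z. \<kappa> z * f (x + T z) \<partial>M) - (\<integral>z. \<kappa> z * f' (x + T z) (y - x) \<partial>M))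
        \<le> e * norm (y - x)" .
    qed
  qed
qed

lemma smooth_integral_translate:
  fixes \<kappa> :: "'m \<Rightarrow> complex" and T :: "'m \<Rightarrow> 'a::euclidean_space" and f :: "'a \<Rightarrow> complex"
  assumes \<kappa>: "integrable M \<kappa>" and T: "T \<in> borel_measurable M"
    and "smooth f" and "\<And>x. norm x \<ge> R \<Longrightarrow> f x = 0"
  shows "smooth (\<lambda>x. \<integral>z. \<kappa> z * f (x + T z) \<partial>M)"
    and "frechet_derivative (\<lambda>x. \<integral>z. \<kappa> z * f (x + T z) \<partial>M) (at x) v
      = (\<integral>z. \<kappa> z * frechet_derivative f (at (x + T z)) v \<partial>M)"
proof -
  have der: "((\<lambda>x. \<integral>z. \<kappa> z * g (x + T z) \<partial>M) has_derivative
     (\<lambda>v. \<integral>z. \<kappa> z * frechet_derivative g (at (x + T z)) v \<partial>M)) (at x)"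
    if "smooth g" and "\<And>x. norm x \<ge> R' \<Longrightarrow> g x = 0" for g :: "'a \<Rightarrow> complex" and R' x
    by (rule has_derivative_integral_translate[OF \<kappa> T smooth_has_derivative[OF that(1)]
          smooth_continuous[OF smooth_derivative[OF that(1)]] that(2)])
  let ?S = "{\<lambda>x. \<integral>z. \<kappa> z * g (x + T z) \<partial>M | g. smooth g \<and> (\<exists>R. \<forall>x. norm x \<ge> R \<longrightarrow> g x = 0)}"
  show "smooth (\<lambda>x. \<integral>z. \<kappa> z * f (x + T z) \<partial>M)"
  proof (rule smooth_coinduct[where S = ?S])
    show "(\<lambda>x. \<integral>z. \<kappa> z * f (x + T z) \<partial>M) \<in> ?S" using assms(3,4) by blast
    fix h assume "h \<in> ?S"
    then obtain g R' where g: "h = (\<lambda>x. \<integral>z. \<kappa> z * g (x + T z) \<partial>M)" "smooth g" "\<And>x. norm x \<ge> R' \<Longrightarrow> g x = 0"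
      by blast
    have "frechet_derivative g (at x) v = 0" if "norm x \<ge> R' + 1" for x v
      by (rule smooth_derivative_vanishing[OF g(2,3) that])
    then have "(\<lambda>x. \<integral>z. \<kappa> z * frechet_derivative g (at (x + T z)) v \<partial>M) \<in> ?S" for v
      using smooth_derivative[OF g(2)] by (intro CollectI exI[of _ "\<lambda>x. frechet_derivative g (at x) v"]) auto
    then show "\<exists>h'. (\<forall>x. (h has_derivative h' x) (at x)) \<and> (\<forall>v. (\<lambda>x. h' x v) \<in> ?S)"
      unfolding g(1) using der[OF g(2,3)]
      by (intro exI[of _ "\<lambda>x v. \<integral>z. \<kappa> z * frechet_derivative g (at (x + T z)) v \<partial>M"]) auto
  qed
  show "frechet_derivative (\<lambda>x. \<integral>z. \<kappa> z * f (x + T z) \<partial>M) (at x) v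
      = (\<integral>z. \<kappa> z * frechet_derivative f (at (x + T z)) v \<partial>M)"
    by (rule fun_cong[OF frechet_derivative_at, OF der[OF assms(3,4)], symmetric])
qed

lemma integrable_continuous_vanishing:
  fixes f :: "'a::euclidean_space \<Rightarrow> complex"
  assumes "continuous_on UNIV f" and "\<And>x. norm x \<ge> R \<Longrightarrow> f x = 0"
  shows "integrable lborel f"
proof -
  have "integrable lborel (\<lambda>x. indicator (cball 0 R) x *\<^sub>R f x)"
    by (rule borel_integrable_compact) (use assms(1) in \<open>auto intro: continuous_on_subset\<close>)
  moreover have "(\<lambda>x. indicator (cball 0 R) x *\<^sub>R f x) = f"
    using assms(2) by (auto simp: fun_eq_iff indicator_def not_le intro: less_imp_le)
  ultimately show ?thesis by simp
qed

text \<open>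
  The integral of a translate of \<open>f\<close> does not depend on the translation.
\<close>

lemma integral_derivative_eq_0:
  fixes f :: "'a::euclidean_space \<Rightarrow> complex"
  assumes der: "\<And>x. (f has_derivative f' x) (at x)" and cont: "\<And>v. continuous_on UNIV (\<lambda>x. f' x v)"
    and van: "\<And>x. norm x \<ge> R \<Longrightarrow> f x = 0"
  shows "(LBINT x. f' x v) = 0"
proof -
  let ?\<kappa> = "\<lambda>z::'a. complex_of_real (indicator (ball 0 (R + 1)) z)"
  have \<kappa>: "integrable lborel ?\<kappa>"
    by (intro integrable_of_real integrable_real_indicator) (use emeasure_bounded_finite[OF bounded_ball, of "0::'a" "R + 1"] in auto)
  let ?\<Phi> = "\<lambda>x. \<integral>z. ?\<kappa> z * f (x + z) \<partial>lborel"
  have D: "(?\<Phi> has_derivative (\<lambda>v. \<integral>z. ?\<kappa> z * f' (0 + z) v \<partial>lborel)) (at 0)"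
    by (rule has_derivative_integral_translate[OF \<kappa> _ der cont van]) auto
  have "?\<Phi> x = integral\<^sup>L lborel f" if "x \<in> ball 0 1" for x
  proof -
    have "?\<kappa> z * f (x + z) = f (x + z)" for z
    proof (cases "z \<in> ball 0 (R + 1)")
      case False
      have "norm z \<le> norm (x + z) + norm x" by norm
      then have "f (x + z) = 0" using that False by (intro van) simp
      then show ?thesis by simp
    qed simp
    then have "?\<Phi> x = (LBINT z. f (x + z))" by (simp only:)
    also have "\<dots> = integral\<^sup>L (Measure_Space.distr lborel borel ((+) x)) f"
    proof (rule integral_distr[symmetric])
      have "continuous_on UNIV f"
        using der by (auto intro!: continuous_at_imp_continuous_on has_derivative_continuous)
      then show "f \<in> borel_measurable borel" by (rule borel_measurable_continuous_onI)
    qed simp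
    finally show ?thesis by (simp add: lborel_distr_plus)
  qed
  then have "(LBINT z. ?\<kappa> z * f' (0 + z) v) = 0"
    by (intro derivative_eq_0_of_vanishing[OF D, of "ball 0 1"]) auto
  moreover have "norm z > R \<Longrightarrow> f' z v = 0" for z
    by (rule derivative_vanishing[OF der van])
  then have "?\<kappa> z * f' (0 + z) v = f' z v" for z
    by (cases "z \<in> ball 0 (R + 1)") auto
  ultimately show ?thesis by (simp only:)
qed

section \<open>The Cauchy-Pompeiu formula\<close>

text \<open>
  The function is dominated by the sum of the \<open>a k\<close> times the indicators of discs of radius \<open>r k\<close>, whose
  integral is a multiple of the sum of the \<open>a k (r k)\<^sup>2\<close>.
\<close>

lemma integrable_of_dyadic_bound:
  fixes f :: "complex \<Rightarrow> real"
  assumes [measurable]: "f \<in> borel_measurable borel"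
    and a: "\<And>k. a k \<ge> 0" "\<And>k. r k \<ge> (0::real)" "summable (\<lambda>k. a k * (r k)\<^sup>2)"
    and le: "\<And>z. f z \<noteq> 0 \<Longrightarrow> \<exists>k. norm z \<le> r k \<and> \<bar>f z\<bar> \<le> a (k::nat)"
  shows "integrable lborel f"
proof (rule integrableI_bounded)
  show "f \<in> borel_measurable lborel" by simp
  have "(\<integral>\<^sup>+z. ennreal (norm (f z)) \<partial>lborel) \<le> (\<integral>\<^sup>+z. (\<Sum>k. ennreal (a k) * indicator (cball (0::complex) (r k)) z) \<partial>lborel)"
  proof (rule nn_integral_mono)
    fix z
    show "ennreal (norm (f z)) \<le> (\<Sum>k. ennreal (a k) * indicator (cball 0 (r k)) z)"
    proof (cases "f z = 0")
      case False
      then obtain k where k: "norm z \<le> r k" "\<bar>f z\<bar> \<le> a k" using le by blast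
      then have "ennreal (norm (f z)) \<le> ennreal (a k) * indicator (cball 0 (r k)) z"
        by (simp add: ennreal_leI)
      also have "\<dots> \<le> (\<Sum>k. ennreal (a k) * indicator (cball 0 (r k)) z)"
        using sum_le_suminf[OF summableI, of "{k}" "\<lambda>k. ennreal (a k) * indicator (cball 0 (r k)) z"]
        by (simp only: sum.insert sum.empty finite.intros empty_iff not_False_eq_True add_0_right) auto
      finally show ?thesis .
    qed simp
  qed
  also have "\<dots> = (\<Sum>k. ennreal (a k) * emeasure lborel (cball (0::complex) (r k)))"
    by (subst nn_integral_suminf) (auto simp: nn_integral_cmult_indicator intro!: borel_measurable_times_ennreal borel_measurable_indicator)
  also have "\<dots> = (\<Sum>k. ennreal (a k * (unit_ball_vol 2 * (r k)\<^sup>2)))"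
    using a(1,2) by (intro suminf_cong) (simp add: emeasure_cball ennreal_mult)
  also have "\<dots> = ennreal (\<Sum>k. a k * (unit_ball_vol 2 * (r k)\<^sup>2))"
    using a summable_mult[OF a(3), of "unit_ball_vol 2"]
    by (intro suminf_ennreal2) (auto simp: mult_ac)
  also have "\<dots> < \<infinity>" by simp
  finally show "(\<integral>\<^sup>+z. ennreal (norm (f z)) \<partial>lborel) < \<infinity>" .
qed

lemma integrable_inverse_norm:
  fixes R :: real
  assumes "R > 0"
  shows "integrable lborel (\<lambda>z::complex. indicator (cball 0 R) z / norm z)"
proof (rule integrable_of_dyadic_bound)
  show "(\<lambda>z::complex. indicat_real (cball 0 R) z / norm z) \<in> borel_measurable borel"
    by (intro borel_measurable_divide borel_measurable_indicator) auto
  let ?a = "\<lambda>k. 2 ^ Suc k / R" and ?r = "\<lambda>k. R / 2 ^ k"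
  show "0 \<le> ?a k" "0 \<le> ?r k" for k using assms by auto
  have "(\<lambda>k. ?a k * (?r k)\<^sup>2) = (\<lambda>k. (2 * R) * (1 / 2) ^ k)"
    using assms by (auto simp: fun_eq_iff field_simps power2_eq_square)
  then show "summable (\<lambda>k. ?a k * (?r k)\<^sup>2)" by simp
  fix z :: complex assume "indicat_real (cball 0 R) z / norm z \<noteq> 0"
  then have z: "z \<noteq> 0" "norm z \<le> R" by (auto simp: indicator_def split: if_splits)
  obtain n where n: "(1 / 2) ^ n < norm z / R"
    using real_arch_pow_inv[of "norm z / R" "1 / 2"] z assms by auto
  define k where "k = (LEAST k. ?r (Suc k) < norm z)"
  have "?r (Suc n) < ?r n" using assms by (simp add: field_simps)
  also have "?r n < norm z" using n assms by (simp add: field_simps power_one_over)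
  finally have 1: "?r (Suc k) < norm z" unfolding k_def by (rule LeastI)
  have 2: "norm z \<le> ?r k"
  proof (cases k)
    case 0
    then show ?thesis using z by simp
  next
    case (Suc j)
    then have "\<not> ?r (Suc j) < norm z" unfolding k_def by (metis lessI not_less_Least)
    then show ?thesis using Suc by simp
  qed
  have "\<bar>indicat_real (cball 0 R) z / norm z\<bar> \<le> ?a k"
    using 1 z assms by (simp add: field_simps)
  with 2 show "\<exists>k. norm z \<le> ?r k \<and> \<bar>indicat_real (cball 0 R) z / norm z\<bar> \<le> ?a k" by blast
qed

lemma integrable_cauchy_density: "integrable lborel (\<lambda>z::complex. 1 / (1 + (norm z)\<^sup>2)\<^sup>2 :: real)"
proof (rule integrable_of_dyadic_bound)
  show "(\<lambda>z::complex. 1 / (1 + (norm z)\<^sup>2)\<^sup>2 :: real) \<in> borel_measurable borel" by measurable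
  let ?a = "\<lambda>k. 16 / 16 ^ k :: real" and ?r = "\<lambda>k. 2 ^ k :: real"
  show "0 \<le> ?a k" "0 \<le> ?r k" for k by auto
  have "?a k * (?r k)\<^sup>2 = 16 * (1 / 4) ^ k" for k
  proof -
    have "((2::real) ^ k)\<^sup>2 = 4 ^ k" "(16::real) ^ k = 4 ^ k * 4 ^ k"
      by (simp_all add: power2_eq_square power_mult_distrib[symmetric])
    then show ?thesis by (simp add: power_one_over)
  qed
  then show "summable (\<lambda>k. ?a k * (?r k)\<^sup>2)" by (simp only:) simp
  fix z :: complex
  obtain n where n: "norm z < 2 ^ n" using real_arch_pow[of 2 "norm z"] by auto
  define k where "k = (LEAST k. norm z \<le> ?r k)"
  have "norm z \<le> ?r n" using n by simp
  then have 1: "norm z \<le> ?r k" unfolding k_def by (rule LeastI)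
  have pos: "0 < 1 + (norm z)\<^sup>2" by (intro add_pos_nonneg) auto
  have "1 / (1 + (norm z)\<^sup>2)\<^sup>2 \<le> ?a k"
  proof (cases k)
    case 0
    have "1 / (1 + (norm z)\<^sup>2)\<^sup>2 \<le> 1 / 1"
      using pos by (intro divide_left_mono) auto
    then show ?thesis using 0 by simp
  next
    case (Suc j)
    then have "\<not> norm z \<le> ?r j" unfolding k_def by (metis lessI not_less_Least)
    then have "(2 ^ j)\<^sup>2 \<le> (norm z)\<^sup>2" by (intro power_mono) auto
    then have "(2 ^ j)\<^sup>2 \<le> 1 + (norm z)\<^sup>2" by linarith
    then have "((2 ^ j)\<^sup>2)\<^sup>2 \<le> (1 + (norm z)\<^sup>2)\<^sup>2" by (rule power_mono) simp
    moreover have "((2 ^ j)\<^sup>2)\<^sup>2 = (16::real) ^ j"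
      by (simp add: power2_eq_square power_mult_distrib[symmetric])
    ultimately have "16 ^ j \<le> (1 + (norm z)\<^sup>2)\<^sup>2" by simp
    then have "1 / (1 + (norm z)\<^sup>2)\<^sup>2 \<le> 1 / 16 ^ j"
      using pos by (intro divide_left_mono) auto
    then show ?thesis using Suc by simp
  qed
  with 1 show "\<exists>k. norm z \<le> ?r k \<and> \<bar>1 / (1 + (norm z)\<^sup>2)\<^sup>2\<bar> \<le> ?a k"
    by (intro exI[of _ k]) simp
qed

text \<open>
  The number \<open>\<pi>\<close>, in the form in which it arises as the total mass of an approximate identity.
\<close>

definition cauchy_mass :: real where
  "cauchy_mass = (LBINT z. 1 / (1 + (norm (z::complex))\<^sup>2)\<^sup>2)"

lemma cauchy_mass_pos: "cauchy_mass > 0"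
proof -
  have "cauchy_mass \<noteq> 0"
  proof
    assume "cauchy_mass = 0"
    then have "AE z::complex in lborel. 1 / (1 + (norm z)\<^sup>2)\<^sup>2 = (0::real)"
      unfolding cauchy_mass_def
      by (subst (asm) integral_nonneg_eq_0_iff_AE[OF integrable_cauchy_density]) auto
    moreover have "1 / (1 + (norm z)\<^sup>2)\<^sup>2 \<noteq> (0::real)" for z :: complex
      by (metis add_pos_nonneg divide_eq_0_iff less_irrefl power_eq_0_iff zero_le_power2 zero_less_one)
    ultimately have "AE z::complex in lborel. False" by simp
    then show False using AE_iff_measurable[of UNIV lborel "\<lambda>_::complex. False"] by simp
  qed
  moreover have "cauchy_mass \<ge> 0" unfolding cauchy_mass_def by simp
  ultimately show ?thesis by simp
qed

lemma integral_lborel_scale: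
  fixes f :: "complex \<Rightarrow> complex"
  assumes "e > 0" and [measurable]: "f \<in> borel_measurable borel"
  shows "integral\<^sup>L lborel f = (LBINT z. e\<^sup>2 *\<^sub>R f (e *\<^sub>R z))"
proof -
  have "lborel = density (Measure_Space.distr lborel borel (\<lambda>x::complex. 0 + e *\<^sub>R x)) (\<lambda>_. ennreal (\<bar>e\<bar> ^ DIM(complex)))"
    using lborel_affine[of e "0::complex"] assms(1) by (simp add: ennreal_power)
  then have "integral\<^sup>L lborel f = integral\<^sup>L (density (Measure_Space.distr lborel borel (\<lambda>x::complex. 0 + e *\<^sub>R x)) (\<lambda>_. ennreal (\<bar>e\<bar> ^ DIM(complex)))) f"
    by simp
  also have "\<dots> = (\<integral>z. \<bar>e\<bar> ^ DIM(complex) *\<^sub>R f z \<partial>Measure_Space.distr lborel borel (\<lambda>x::complex. 0 + e *\<^sub>R x))"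
    by (subst integral_density) auto
  also have "\<dots> = (LBINT z. e\<^sup>2 *\<^sub>R f (e *\<^sub>R z))"
    by (subst integral_distr) (use assms in auto)
  finally show ?thesis .
qed

text \<open>
  The kernel \<open>1 / z\<close> is the limit of the smooth kernels \<open>cnj z / (\<bar>z\<bar>\<^sup>2 + e\<^sup>2)\<close>, whose derivative with
  respect to \<open>cnj z\<close> is \<open>e\<^sup>2 / (\<bar>z\<bar>\<^sup>2 + e\<^sup>2)\<^sup>2\<close>. This is an approximate identity of mass
  \<^const>\<open>cauchy_mass\<close>, by the substitution \<open>z \<mapsto> e z\<close>, so integration by parts and \<open>e \<rightarrow> 0\<close> give the formula.
\<close>

lemma cauchy_pompeiu_at_0:
  fixes f :: "complex \<Rightarrow> complex"
  assumes der: "\<And>x. (f has_derivative f' x) (at x)" and cont: "\<And>v. continuous_on UNIV (\<lambda>x. f' x v)"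
    and van: "\<And>x. norm x \<ge> R \<Longrightarrow> f x = 0"
  shows "(LBINT z. (1 / z) * ((f' z 1 + \<i> * f' z \<i>) / 2)) = - of_real cauchy_mass * f 0"
proof -
  define g where "g z = (f' z 1 + \<i> * f' z \<i>) / 2" for z
  define q where "q e z = (norm z)\<^sup>2 + e\<^sup>2" for e :: real and z :: complex
  define k where "k e z = cnj z / of_real (q e z)" for e :: real and z
  define k' where "k' e z v = (cnj v * of_real (q e z) - cnj z * of_real (2 * (z \<bullet> v))) / (of_real (q e z))\<^sup>2" for e :: real and z v
  define \<rho> where "\<rho> e z = complex_of_real (e\<^sup>2 / (q e z)\<^sup>2)" for e :: real and z
  have q_pos: "q e z > 0" if "e > 0" for e z unfolding q_def using that by (simp add: add_nonneg_pos)
  have cont_f: "continuous_on UNIV f"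
    using der by (auto intro!: continuous_at_imp_continuous_on has_derivative_continuous)
  have cont_g: "continuous_on UNIV g" unfolding g_def by (intro continuous_intros cont) auto
  have van': "f' z v = 0" if "norm z \<ge> R + 1" for z v
    by (rule derivative_vanishing[OF der van]) (use that in auto)
  have van_g: "g z = 0" if "norm z \<ge> R + 1" for z using van'[OF that] by (simp add: g_def)
  have cont_q: "continuous_on UNIV (q e)" for e unfolding q_def by (intro continuous_intros)
  have q_nz: "complex_of_real (q e z) \<noteq> 0" if "e > 0" for e z using q_pos[OF that, of z] by simp
  have cont_k: "continuous_on UNIV (k e)" if "e > 0" for e
    unfolding k_def using q_nz[OF that] by (intro continuous_intros cont_q) auto
  have cont_\<rho>: "continuous_on UNIV (\<rho> e)" if "e > 0" for e
    unfolding \<rho>_def using q_pos[OF that] by (intro continuous_intros cont_q) (auto simp: less_imp_neq[symmetric])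
  have der_k: "(k e has_derivative k' e z) (at z)" if "e > 0" for e z
  proof -
    have "((\<lambda>z. complex_of_real (q e z)) has_derivative (\<lambda>v. of_real (2 * (z \<bullet> v)))) (at z)"
      unfolding q_def power2_norm_eq_inner
      by (auto intro!: derivative_eq_intros simp: inner_commute)
    moreover have "(cnj has_derivative cnj) (at z)"
      by (rule bounded_linear_imp_has_derivative[OF bounded_linear_cnj])
    ultimately show ?thesis
      unfolding k_def k'_def power2_eq_square
      by (intro has_derivative_divide' q_nz[OF that]) simp_all
  qed
  have dbar_k: "(k' e z 1 + \<i> * k' e z \<i>) / 2 = \<rho> e z" if "e > 0" for e z
  proof -
    have "k' e z 1 + \<i> * k' e z \<i> = (2 * of_real (q e z) - 2 * (cnj z * z)) / (of_real (q e z))\<^sup>2"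
    proof -
      have "z = of_real (z \<bullet> 1) + \<i> * of_real (z \<bullet> \<i>)"
        by (simp add: complex_eq_iff inner_complex_def)
      then have "cnj z * z = cnj z * of_real (z \<bullet> 1) + \<i> * (cnj z * of_real (z \<bullet> \<i>))"
        by (metis distrib_left mult.left_commute)
      then show ?thesis
        unfolding k'_def by (simp add: add_divide_distrib diff_divide_distrib algebra_simps)
    qed
    also have "cnj z * z = of_real ((norm z)\<^sup>2)" by (metis complex_norm_square mult.commute)
    also have "2 * of_real (q e z) - 2 * of_real ((norm z)\<^sup>2) = 2 * complex_of_real (e\<^sup>2)"
      by (simp add: q_def)
    finally show ?thesis by (simp add: \<rho>_def)
  qed
  \<comment> \<open>Integration by parts, applied to the product of \<open>k e\<close> and \<open>f\<close>.\<close>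
  have parts: "(LBINT z. k e z * g z) = - (LBINT z. \<rho> e z * f z)" if e: "e > 0" for e
  proof -
    let ?h' = "\<lambda>z v. k e z * f' z v + k' e z v * f z"
    have der_h: "((\<lambda>z. k e z * f z) has_derivative ?h' z) (at z)" for z
      by (rule has_derivative_mult[OF der_k[OF e] der])
    have cont_k': "continuous_on UNIV (\<lambda>z. k' e z v)" for v
      unfolding k'_def using q_nz[OF e] by (intro continuous_intros cont_q) auto
    have cont_h: "continuous_on UNIV (\<lambda>z. ?h' z v)" for v
      by (intro continuous_intros cont cont_f cont_k[OF e] cont_k')
    have van_h: "?h' z v = 0" if "norm z \<ge> R + 1" for z v
      using van[of z] van'[of z v] that by simp
    have zero: "(LBINT z. ?h' z v) = 0" for v
      by (rule integral_derivative_eq_0[OF der_h cont_h, of R]) (simp add: van)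
    have int: "integrable lborel (\<lambda>z. ?h' z v)" for v
      by (rule integrable_continuous_vanishing[OF cont_h van_h])
    have "k e z * g z + \<rho> e z * f z = (?h' z 1 + \<i> * ?h' z \<i>) / 2" for z
      unfolding g_def dbar_k[OF e, symmetric] by (simp add: field_simps)
    then have "(LBINT z. k e z * g z + \<rho> e z * f z) = (LBINT z. (?h' z 1 + \<i> * ?h' z \<i>) / 2)"
      by (simp only:)
    also have "\<dots> = (LBINT z. ?h' z 1 + \<i> * ?h' z \<i>) / 2"
      by (rule integral_divide_zero)
    also have "(LBINT z. ?h' z 1 + \<i> * ?h' z \<i>) = (LBINT z. ?h' z 1) + (LBINT z. \<i> * ?h' z \<i>)"
      by (rule Bochner_Integration.integral_add[OF int integrable_mult_right[OF int]])
    also have "(LBINT z. \<i> * ?h' z \<i>) = \<i> * (LBINT z. ?h' z \<i>)"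
      by (rule integral_mult_right_zero)
    also have "((LBINT z. ?h' z 1) + \<i> * (LBINT z. ?h' z \<i>)) / 2 = 0" by (simp only: zero) simp

    finally have "(LBINT z. k e z * g z + \<rho> e z * f z) = 0" .
    moreover have "integrable lborel (\<lambda>z. k e z * g z)"
      by (rule integrable_continuous_vanishing[where R = "R + 1"]) (auto intro!: continuous_intros cont_k[OF e] cont_g simp: van_g)
    moreover have "integrable lborel (\<lambda>z. \<rho> e z * f z)"
      by (rule integrable_continuous_vanishing[where R = R]) (auto intro!: continuous_intros cont_\<rho>[OF e] cont_f simp: van)
    ultimately show ?thesis by (simp add: eq_neg_iff_add_eq_0)
  qed
  define \<epsilon> where "\<epsilon> n = inverse (real (Suc n))" for n
  have \<epsilon>: "\<epsilon> n > 0" for n by (simp add: \<epsilon>_def)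
  have \<epsilon>0: "\<epsilon> \<longlonglongrightarrow> 0" unfolding \<epsilon>_def by (rule LIMSEQ_inverse_real_of_nat)
  have bor: "f \<in> borel_measurable borel" "g \<in> borel_measurable borel"
    using cont_f cont_g by (auto intro: borel_measurable_continuous_onI)
  \<comment> \<open>The kernels \<open>k e\<close> are dominated by the integrable function \<open>1 / \<bar>z\<bar>\<close>.\<close>
  have lim1: "(\<lambda>n. \<integral>z. k (\<epsilon> n) z * g z \<partial>lborel) \<longlonglongrightarrow> (LBINT z. (1 / z) * g z)"
  proof -
    obtain B where B: "B > 0" "\<And>z. norm (g z) \<le> B" using continuous_vanishing_bounded[OF cont_g van_g] by blast
    let ?R = "\<bar>R\<bar> + 1"
    show ?thesis
    proof (rule integral_dominated_convergence[where w = "\<lambda>z. B * (indicator (cball 0 ?R) z / norm z)"])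
      show "integrable lborel (\<lambda>z::complex. B * (indicator (cball 0 ?R) z / norm z))"
        by (intro integrable_mult_right integrable_inverse_norm) auto
      show "(\<lambda>z. (1 / z) * g z) \<in> borel_measurable lborel" using bor(2) by measurable
      show "(\<lambda>z. k (\<epsilon> n) z * g z) \<in> borel_measurable lborel" for n
        using bor(2) borel_measurable_continuous_onI[OF cont_k[OF \<epsilon>]] by measurable
      show "AE z in lborel. (\<lambda>n. k (\<epsilon> n) z * g z) \<longlonglongrightarrow> (1 / z) * g z"
      proof (intro AE_I2 tendsto_mult tendsto_const)
        fix z :: complex
        show "(\<lambda>n. k (\<epsilon> n) z) \<longlonglongrightarrow> 1 / z"
        proof (cases "z = 0")
          case False
          have "(\<lambda>n. k (\<epsilon> n) z) \<longlonglongrightarrow> cnj z / of_real ((norm z)\<^sup>2 + 0\<^sup>2)"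
            unfolding k_def q_def using False by (intro tendsto_intros \<epsilon>0) auto
          also have "cnj z / of_real ((norm z)\<^sup>2 + 0\<^sup>2) = 1 / z"
            using False complex_norm_square[of z] by (simp add: field_simps)
          finally show ?thesis .
        qed (simp add: k_def)
      qed
      show "AE z in lborel. norm (k (\<epsilon> n) z * g z) \<le> B * (indicator (cball 0 ?R) z / norm z)" for n
      proof (intro AE_I2)
        fix z :: complex
        show "norm (k (\<epsilon> n) z * g z) \<le> B * (indicator (cball 0 ?R) z / norm z)"
        proof (cases "norm z \<le> ?R \<and> z \<noteq> 0")
          case True
          have "(norm z)\<^sup>2 \<le> q (\<epsilon> n) z" by (simp add: q_def)
          moreover have "norm (k (\<epsilon> n) z) = norm z / q (\<epsilon> n) z"
            unfolding k_def using q_pos[OF \<epsilon>, of n z] by (simp add: norm_divide)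
          ultimately have "norm (k (\<epsilon> n) z) \<le> norm z / (norm z)\<^sup>2"
            using True by (auto intro!: divide_left_mono mult_pos_pos q_pos[OF \<epsilon>])
          also have "\<dots> = 1 / norm z" using True by (simp add: power2_eq_square)
          finally have "norm (k (\<epsilon> n) z) * norm (g z) \<le> (1 / norm z) * B"
            by (intro mult_mono B(2)) auto
          then show ?thesis using True by (simp add: norm_mult)
        next
          case False
          then have "z = 0 \<or> g z = 0" using van_g[of z] by fastforce
          then show ?thesis using B(1) by (auto simp: k_def)
        qed
      qed
    qed
  qed
  \<comment> \<open>After rescaling by \<open>e\<close>, the weight no longer depends on \<open>e\<close>.\<close>
  have lim2: "(\<lambda>n. \<integral>z. \<rho> (\<epsilon> n) z * f z \<partial>lborel) \<longlonglongrightarrow> of_real cauchy_mass * f 0"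
  proof -
    obtain B where B: "B > 0" "\<And>z. norm (f z) \<le> B" using continuous_vanishing_bounded[OF cont_f van] by blast
    let ?w = "\<lambda>z::complex. 1 / (1 + (norm z)\<^sup>2)\<^sup>2 :: real"
    have "(LBINT z. \<rho> e z * f z) = (LBINT z. of_real (?w z) * f (e *\<^sub>R z))" if e: "e > 0" for e
    proof -
      have "e\<^sup>2 *\<^sub>R (\<rho> e (e *\<^sub>R z) * f (e *\<^sub>R z)) = of_real (?w z) * f (e *\<^sub>R z)" for z
      proof -
        have "q e (e *\<^sub>R z) = e\<^sup>2 * (1 + (norm z)\<^sup>2)"
          by (simp add: q_def power_mult_distrib algebra_simps)
        moreover have "e\<^sup>2 * (e\<^sup>2 / (e\<^sup>2 * s)\<^sup>2) = 1 / s\<^sup>2" for s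
          using e by (cases "s = 0") (simp_all add: power2_eq_square field_simps)
        ultimately have "e\<^sup>2 * (e\<^sup>2 / (q e (e *\<^sub>R z))\<^sup>2) = ?w z" by simp
        then show ?thesis
          unfolding \<rho>_def scaleR_conv_of_real by (metis mult.assoc of_real_mult)
      qed
      moreover have "(\<lambda>z. \<rho> e z * f z) \<in> borel_measurable borel"
        using bor(1) borel_measurable_continuous_onI[OF cont_\<rho>[OF e]] by measurable
      ultimately show ?thesis
        using integral_lborel_scale[OF e, of "\<lambda>z. \<rho> e z * f z"] by simp
    qed
    moreover have "(\<lambda>n. \<integral>z. of_real (?w z) * f (\<epsilon> n *\<^sub>R z) \<partial>lborel) \<longlonglongrightarrow> (LBINT z. of_real (?w z) * f 0)"
    proof (rule integral_dominated_convergence[where w = "\<lambda>z. ?w z * B"])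
      show "integrable lborel (\<lambda>z::complex. ?w z * B)"
        by (intro integrable_mult_left integrable_cauchy_density)
      show "(\<lambda>z. of_real (?w z) * f 0) \<in> borel_measurable lborel" by measurable
      show "(\<lambda>z. of_real (?w z) * f (\<epsilon> n *\<^sub>R z)) \<in> borel_measurable lborel" for n
        using bor(1) by measurable
      show "AE z in lborel. (\<lambda>n. of_real (?w z) * f (\<epsilon> n *\<^sub>R z)) \<longlonglongrightarrow> of_real (?w z) * f 0"
      proof (intro AE_I2 tendsto_mult tendsto_const)
        fix z :: complex
        have "(\<lambda>n. \<epsilon> n *\<^sub>R z) \<longlonglongrightarrow> 0 *\<^sub>R z" by (intro tendsto_intros \<epsilon>0)
        then have "(\<lambda>n. \<epsilon> n *\<^sub>R z) \<longlonglongrightarrow> 0" by simp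
        moreover have "isCont f 0" using cont_f by (simp add: continuous_on_eq_continuous_at)
        ultimately show "(\<lambda>n. f (\<epsilon> n *\<^sub>R z)) \<longlonglongrightarrow> f 0" by (rule isCont_tendsto_compose[rotated])
      qed
      show "AE z in lborel. norm (of_real (?w z) * f (\<epsilon> n *\<^sub>R z)) \<le> ?w z * B" for n
      proof (intro AE_I2)
        fix z :: complex
        have "norm (complex_of_real (?w z)) = ?w z" by (simp only: norm_of_real) simp
        then show "norm (of_real (?w z) * f (\<epsilon> n *\<^sub>R z)) \<le> ?w z * B"
          by (simp only: norm_mult) (intro mult_left_mono B, simp)
      qed
    qed
    moreover have "(LBINT z. of_real (?w z) * f 0) = of_real cauchy_mass * f 0"
      by (simp add: cauchy_mass_def del: of_real_divide of_real_power of_real_add)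
    ultimately show ?thesis using \<epsilon> by simp
  qed
  have "(LBINT z. (1 / z) * g z) = - (of_real cauchy_mass * f 0)"
    using LIMSEQ_unique[OF lim1] tendsto_minus[OF lim2] parts[OF \<epsilon>] by simp
  then show ?thesis by (simp add: g_def)
qed

section \<open>Test functions and Wirtinger derivatives\<close>

lemma test_function_smooth: "test_function U \<phi> \<Longrightarrow> smooth \<phi>"
  by (simp add: test_function_def smooth_def)

lemma test_functionI:
  assumes "smooth \<phi>" and "compact S" and "S \<subseteq> U" and "\<And>x. \<phi> x \<noteq> 0 \<Longrightarrow> x \<in> S"
  shows "test_function U \<phi>"
proof -
  have sub: "closure {z. \<phi> z \<noteq> 0} \<subseteq> S"
    using assms(2,4) by (intro closure_minimal compact_imp_closed) auto
  then have "compact (closure {z. \<phi> z \<noteq> 0})"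
    using assms(2) by (metis closed_closure compact_Int_closed inf.absorb2)
  with sub show ?thesis using assms(1,3) by (auto simp: test_function_def smooth_def)
qed

lemma test_function_mono: "test_function U \<phi> \<Longrightarrow> U \<subseteq> V \<Longrightarrow> test_function V \<phi>"
  by (auto simp: test_function_def)

lemma test_function_UNIV: "test_function U f \<Longrightarrow> test_function UNIV f"
  by (rule test_function_mono) auto

lemma test_function_vanishing:
  assumes "test_function U f"
  obtains R where "R > 0" "\<And>x. norm x \<ge> R \<Longrightarrow> f x = 0"
  using assms supp_subset_ball[of f] unfolding test_function_def by metis

lemma test_function_eq_0: "test_function U f \<Longrightarrow> x \<notin> U \<Longrightarrow> f x = 0"
  using closure_subset[of "{x. f x \<noteq> 0}"] unfolding test_function_def by auto

lemma test_function_mult: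
  assumes "smooth f" and "test_function U g" shows "test_function U (\<lambda>x. f x * g x)"
proof (rule test_functionI[where S = "closure {x. g x \<noteq> 0}"])
  show "smooth (\<lambda>x. f x * g x)" by (intro smooth_mult assms(1) test_function_smooth[OF assms(2)])
  show "f x * g x \<noteq> 0 \<Longrightarrow> x \<in> closure {x. g x \<noteq> 0}" for x
    using closure_subset[of "{x. g x \<noteq> 0}"] by auto
qed (use assms(2) in \<open>auto simp: test_function_def\<close>)

lemma integrable_mult_test_function:
  assumes "integrable lborel g" and "test_function U f"
  shows "integrable lborel (\<lambda>x. g x * f x)"
proof -
  obtain R where R: "\<And>x. norm x \<ge> R \<Longrightarrow> f x = 0" using test_function_vanishing[OF assms(2)] by blast
  have "integrable lborel (\<lambda>x. g x * f (0 + x))"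
    by (rule integrable_mult_translate[OF assms(1) _ smooth_continuous[OF test_function_smooth[OF assms(2)]] R]) simp
  then show ?thesis by simp
qed

lemma smooth_wirtinger_bar:
  fixes f :: "complex^'n \<Rightarrow> complex"
  assumes "smooth f" shows "smooth (wirtinger_bar k f)"
proof -
  have "smooth (\<lambda>z. (1 / 2) * (frechet_derivative f (at z) (axis k 1) + \<i> * frechet_derivative f (at z) (axis k \<i>)))"
    by (intro smooth_cmult smooth_add smooth_derivative assms)
  then show ?thesis by (simp add: wirtinger_bar_def[abs_def])
qed

lemma wirtinger_bar_eq:
  assumes "(f has_derivative f') (at z)"
  shows "wirtinger_bar k f z = (f' (axis k 1) + \<i> * f' (axis k \<i>)) / 2"
  unfolding wirtinger_bar_def using frechet_derivative_at[OF assms] by simp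

lemma wirtinger_bar_eq_0:
  assumes "smooth f" and "open V" and "x \<in> V" and "\<And>y. y \<in> V \<Longrightarrow> f y = c"
  shows "wirtinger_bar k f x = 0"
  unfolding wirtinger_bar_def
  using derivative_eq_0_of_vanishing[OF smooth_has_derivative[OF assms(1)] assms(2-4)] by simp

lemma wirtinger_bar_nonzero_supp:
  assumes "smooth f" and "wirtinger_bar k f x \<noteq> 0"
  shows "x \<in> closure {x. f x \<noteq> 0}"
proof (rule ccontr)
  assume "x \<notin> closure {x. f x \<noteq> 0}"
  then have "wirtinger_bar k f x = 0"
    using closure_subset[of "{x. f x \<noteq> 0}"] by (intro wirtinger_bar_eq_0[OF assms(1), where V = "- closure {x. f x \<noteq> 0}" and c = 0]) auto
  with assms(2) show False by simp
qed

lemma test_function_wirtinger_bar: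
  assumes "test_function U f" shows "test_function U (wirtinger_bar k f)"
  using assms
  by (intro test_functionI[where S = "closure {x. f x \<noteq> 0}"] smooth_wirtinger_bar wirtinger_bar_nonzero_supp)
    (auto simp: test_function_def smooth_def)

lemma wirtinger_bar_add:
  assumes "smooth f" and "smooth g"
  shows "wirtinger_bar k (\<lambda>x. f x + g x) x = wirtinger_bar k f x + wirtinger_bar k g x"
proof -
  have der: "((\<lambda>x. f x + g x) has_derivative
      (\<lambda>v. frechet_derivative f (at x) v + frechet_derivative g (at x) v)) (at x)"
    by (rule has_derivative_add[OF smooth_has_derivative[OF assms(1)] smooth_has_derivative[OF assms(2)]])
  show ?thesis
    unfolding wirtinger_bar_eq[OF der] wirtinger_bar_def[of _ f] wirtinger_bar_def[of _ g] by (simp add: field_simps)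
qed

lemma wirtinger_bar_mult:
  assumes "smooth f" and "smooth g"
  shows "wirtinger_bar k (\<lambda>x. f x * g x) x = f x * wirtinger_bar k g x + wirtinger_bar k f x * g x"
proof -
  have der: "((\<lambda>x. f x * g x) has_derivative
      (\<lambda>v. f x * frechet_derivative g (at x) v + frechet_derivative f (at x) v * g x)) (at x)"
    by (rule has_derivative_mult[OF smooth_has_derivative[OF assms(1)] smooth_has_derivative[OF assms(2)]])
  show ?thesis
    unfolding wirtinger_bar_eq[OF der] wirtinger_bar_def[of _ f] wirtinger_bar_def[of _ g] by (simp add: field_simps)
qed

lemma wirtinger_bar_reflect:
  assumes "smooth f"
  shows "wirtinger_bar k (\<lambda>x. f (u + - x)) x = - wirtinger_bar k f (u + - x)"
proof -
  have lin: "linear (frechet_derivative f (at (u + - x)))" by (rule has_derivative_linear[OF smooth_has_derivative[OF assms]])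
  have "((\<lambda>x. u + - x) has_derivative (\<lambda>v. - v)) (at x)" by (auto intro!: derivative_eq_intros)
  from has_derivative_compose[OF this smooth_has_derivative[OF assms]]
  have der: "((\<lambda>x. f (u + - x)) has_derivative (\<lambda>v. frechet_derivative f (at (u + - x)) (- v))) (at x)" .
  show ?thesis
    unfolding wirtinger_bar_eq[OF der] linear_neg[OF lin] wirtinger_bar_def[of _ f] by (simp add: field_simps)
qed

lemma wirtinger_bar_commute:
  fixes f :: "complex^'n \<Rightarrow> complex"
  assumes "smooth f"
  shows "wirtinger_bar j (wirtinger_bar k f) x = wirtinger_bar k (wirtinger_bar j f) x"
proof -
  let ?D = "\<lambda>u x. frechet_derivative f (at x) u"
  have der: "wirtinger_bar j (wirtinger_bar k f) x =
     (frechet_derivative (?D (axis k 1)) (at x) (axis j 1) + \<i> * frechet_derivative (?D (axis k \<i>)) (at x) (axis j 1)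
      + \<i> * (frechet_derivative (?D (axis k 1)) (at x) (axis j \<i>) + \<i> * frechet_derivative (?D (axis k \<i>)) (at x) (axis j \<i>))) / 4" for j k
  proof -
    have "(wirtinger_bar k f has_derivative
       (\<lambda>v. (frechet_derivative (?D (axis k 1)) (at x) v + \<i> * frechet_derivative (?D (axis k \<i>)) (at x) v) / 2)) (at x)"
      unfolding wirtinger_bar_def[abs_def]
      by (auto intro!: derivative_eq_intros smooth_has_derivative smooth_derivative assms)
    then show ?thesis by (simp only: wirtinger_bar_eq) (simp add: field_simps)
  qed
  show ?thesis
    unfolding der
    by (simp add: smooth_derivative_commute[OF assms, of "axis j 1" x] smooth_derivative_commute[OF assms, of "axis j \<i>" x] field_simps)
qed

lemma wirtinger_bar_integral_translate:
  fixes f :: "complex^'n \<Rightarrow> complex"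
  assumes \<kappa>: "integrable M \<kappa>" and T: "T \<in> borel_measurable M"
    and f: "smooth f" "\<And>x. norm x \<ge> R \<Longrightarrow> f x = 0"
  shows "wirtinger_bar k (\<lambda>x. \<integral>z. \<kappa> z * f (x + T z) \<partial>M) x = (\<integral>z. \<kappa> z * wirtinger_bar k f (x + T z) \<partial>M)"
proof -
  let ?D = "\<lambda>v z. \<kappa> z * frechet_derivative f (at (x + T z)) v"
  have int: "integrable M (?D v)" for v
    by (rule integrable_mult_translate[OF \<kappa> T smooth_continuous[OF smooth_derivative[OF f(1)]]
          smooth_derivative_vanishing[OF f]])
  have D: "frechet_derivative (\<lambda>x. \<integral>z. \<kappa> z * f (x + T z) \<partial>M) (at x) v = (\<integral>z. ?D v z \<partial>M)" for v
    by (rule smooth_integral_translate(2)[OF \<kappa> T f])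
  have "(\<lambda>z. \<kappa> z * wirtinger_bar k f (x + T z)) = (\<lambda>z. (?D (axis k 1) z + \<i> * ?D (axis k \<i>) z) / 2)"
    by (simp add: wirtinger_bar_def fun_eq_iff field_simps)
  then have "(\<integral>z. \<kappa> z * wirtinger_bar k f (x + T z) \<partial>M) = (\<integral>z. (?D (axis k 1) z + \<i> * ?D (axis k \<i>) z) / 2 \<partial>M)"
    by (simp only:)
  also have "\<dots> = wirtinger_bar k (\<lambda>x. \<integral>z. \<kappa> z * f (x + T z) \<partial>M) x"
    unfolding wirtinger_bar_def D integral_divide_zero
    by (subst Bochner_Integration.integral_add[OF int integrable_mult_right[OF int]]) (simp only: integral_mult_right_zero)
  finally show ?thesis by simp
qed

lemma wirtinger_bar_measurable: "smooth f \<Longrightarrow> wirtinger_bar k f \<in> borel_measurable borel"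
  by (rule borel_measurable_continuous_onI[OF smooth_continuous[OF smooth_wirtinger_bar]])

section \<open>The identity theorem for weakly holomorphic functions\<close>

text \<open>
  Open boxes are an intersection-stable generator of the Borel sets, so the integral of \<open>f\<close> over every
  Borel set vanishes.
\<close>

lemma AE_eq_0_if_box_integrals_0:
  fixes f :: "'a::euclidean_space \<Rightarrow> complex"
  assumes f: "integrable lborel f" and van: "\<And>x. x \<notin> box c d \<Longrightarrow> f x = 0"
    and box: "\<And>a b. (LBINT x. indicator (box a b) x *\<^sub>R f x) = 0"
  shows "AE x in lborel. f x = 0"
proof (rule sigma_finite_measure.density_zero[OF sigma_finite_lborel f])
  have [measurable]: "f \<in> borel_measurable borel" using borel_measurable_integrable[OF f] by simp
  have int: "integrable lborel (\<lambda>x. indicator A x *\<^sub>R f x)" if "A \<in> sets borel" for A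
    using integrable_mult_indicator[OF _ f, of A] that by simp
  have "indicator (box c d) x *\<^sub>R f x = f x" for x
    using van by (cases "x \<in> box c d") auto
  then have whole: "integral\<^sup>L lborel f = 0" using box[of c d] by (simp only:)
  have Int_box: "Int_stable (range (\<lambda>(a, b). box a b :: 'a set))"
    by (auto simp: Int_stable_def box_Int_box)
  have closed_box: "range (\<lambda>(a, b). box a b :: 'a set) \<subseteq> Pow UNIV" by simp
  have "(LBINT x. indicator A x *\<^sub>R f x) = 0" if "A \<in> sigma_sets UNIV (range (\<lambda>(a, b). box a b))" for A
    using that
  proof (induction A rule: sigma_sets_induct_disjoint[OF Int_box closed_box, consumes 1, case_names basic empty compl union])
    case (basic A)
    then show ?case using box by auto
  next
    case empty
    show ?case by simp
  next
    case (compl A)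
    then have "A \<in> sets borel" by (simp add: borel_eq_box)
    then have "(LBINT x. f x - indicator A x *\<^sub>R f x) = 0"
      using int compl whole f by simp
    moreover have "indicator (UNIV - A) x *\<^sub>R f x = f x - indicator A x *\<^sub>R f x" for x
      by (simp add: indicator_def)
    ultimately show ?case by (simp only:)
  next
    case (union A)
    then have A: "A i \<in> sets borel" for i by (auto simp: borel_eq_box)
    have "(LBINT x. indicator (\<Union>i. A i) x *\<^sub>R f x) = (\<Sum>i. \<integral>x. indicator (A i) x *\<^sub>R f x \<partial>lborel)"
      unfolding set_lebesgue_integral_def[symmetric]
    proof (rule lebesgue_integral_countable_add)
      show "set_integrable lborel (\<Union>i. A i) f"
        unfolding set_integrable_def using A by (intro int) auto
    qed (use A union(1) in \<open>auto simp: disjoint_family_on_def\<close>)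
    then show ?case using union by simp
  qed
  then show "set_lebesgue_integral lborel A f = 0" if "A \<in> sets lborel" for A
    using that by (simp add: set_lebesgue_integral_def borel_eq_box)
qed

lemma AE_lborel_locally:
  fixes S :: "'a::euclidean_space set"
  assumes "\<And>x. x \<in> S \<Longrightarrow> \<exists>N. open N \<and> x \<in> N \<and> (AE y in lborel. y \<in> N \<longrightarrow> P y)"
  shows "AE y in lborel. y \<in> S \<longrightarrow> P y"
proof -
  let ?F = "{N. open N \<and> (AE y in lborel. y \<in> N \<longrightarrow> P y)}"
  obtain F' where F': "F' \<subseteq> ?F" "countable F'" "\<Union>F' = \<Union>?F"
    using Lindelof[of ?F] by (auto simp del: Union_iff)
  have "AE y in lborel. \<forall>N\<in>F'. y \<in> N \<longrightarrow> P y"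
    using F'(1) by (subst AE_ball_countable[OF F'(2)]) auto
  then show ?thesis
  proof eventually_elim
    case (elim y)
    show ?case
    proof
      assume "y \<in> S"
      then have "y \<in> \<Union>?F" using assms by blast
      then show "P y" using elim F'(3) by blast
    qed
  qed
qed

text \<open>
  Solutions of the homogeneous dbar-equation on \<open>U\<close> in the sense of distributions. As test functions
  vanish outside \<open>U\<close>, the integral may be taken over the whole space.
\<close>

definition weakly_holomorphic_on :: "(complex^'n \<Rightarrow> complex) \<Rightarrow> (complex^'n) set \<Rightarrow> bool" where
  "weakly_holomorphic_on g U \<longleftrightarrow>
     (\<forall>\<phi> k. test_function U \<phi> \<longrightarrow> (LBINT x. g x * wirtinger_bar k \<phi> x) = 0)"

lemma weakly_holomorphic_on_subset: "weakly_holomorphic_on g U \<Longrightarrow> V \<subseteq> U \<Longrightarrow> weakly_holomorphic_on g V"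
  unfolding weakly_holomorphic_on_def using test_function_mono by blast

lemma vec_eq_sum_axis:
  fixes v :: "complex^'n"
  shows "v = (\<Sum>k\<in>UNIV. Re (v $ k) *\<^sub>R axis k 1 + Im (v $ k) *\<^sub>R axis k \<i>)"
proof -
  have "(Re (v $ k) *\<^sub>R axis k 1 + Im (v $ k) *\<^sub>R axis k \<i>) $ j = (if j = k then v $ j else 0)" for j k
    by (auto simp: axis_def complex_eq_iff)
  then show ?thesis by (auto simp: vec_eq_iff)
qed

text \<open>
  The Cauchy-Riemann equation in the \<open>k\<close>-th variable says \<open>D (\<i> e\<^sub>k) = \<i> D e\<^sub>k\<close>.
\<close>

lemma complex_linear_if_Cauchy_Riemann:
  fixes D :: "complex^'n \<Rightarrow> complex"
  assumes lin: "linear D" and CR: "\<And>k. (D (axis k 1) + \<i> * D (axis k \<i>)) / 2 = 0"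
  shows "D (c *s v) = c * D v"
proof -
  have *: "D (axis k \<i>) = \<i> * D (axis k 1)" for k
  proof -
    have "D (axis k 1) = - (\<i> * D (axis k \<i>))" using CR[of k] by (simp add: eq_neg_iff_add_eq_0)
    then show ?thesis by simp
  qed
  have expand: "D w = (\<Sum>k\<in>UNIV. w $ k * D (axis k 1))" for w
  proof -
    have "D w = (\<Sum>k\<in>UNIV. Re (w $ k) *\<^sub>R D (axis k 1) + Im (w $ k) *\<^sub>R D (axis k \<i>))"
      by (subst vec_eq_sum_axis) (simp only: linear_sum[OF lin] linear_add[OF lin] linear_cmul[OF lin])
    also have "\<dots> = (\<Sum>k\<in>UNIV. w $ k * D (axis k 1))"
      by (intro sum.cong refl) (metis (no_types, lifting) * complex_eq distrib_right mult.assoc mult.commute scaleR_conv_of_real)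
    finally show ?thesis .
  qed
  show ?thesis
    unfolding expand[of "c *s v"] expand[of v] by (simp add: sum_distrib_left mult.assoc)
qed

lemma bounded_linear_complex_line: "bounded_linear (\<lambda>c. c *s (v :: complex^'n))"
proof -
  have "linear (\<lambda>c. c *s v)"
    by (rule linearI) (auto simp: vec_eq_iff algebra_simps)
  then show ?thesis by (simp add: linear_conv_bounded_linear)
qed

lemma norm_vector_smult_complex: "norm (c *s (v :: complex^'n)) = norm c * norm v"
  by (simp add: norm_vec_def L2_set_def norm_mult power_mult_distrib sum_distrib_left[symmetric] real_sqrt_mult)

text \<open>
  Let \<open>G u\<close> be the integral of \<open>g x * \<beta> (x - u)\<close>. As long as the translate of \<open>\<beta>\<close> by \<open>u\<close> is supported in
  \<open>ball p r\<close>, it is a legitimate test function, so \<open>G\<close> satisfies the Cauchy-Riemann equations at \<open>u\<close>.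
  Hence \<open>G\<close> is holomorphic on the complex line through \<open>p\<close> and \<open>z\<close>. It is zero near \<open>p\<close>, where \<open>\<beta>\<close> only sees
  zeros of \<open>g\<close>, and the identity theorem in one variable carries this to \<open>z\<close>.
\<close>

lemma weakly_holomorphic_mollification_eq_0:
  fixes g :: "complex^'n \<Rightarrow> complex" and \<beta> :: "complex^'n \<Rightarrow> complex"
  assumes g: "integrable lborel g" and weak: "weakly_holomorphic_on g (ball p r)"
    and zero: "AE x in lborel. x \<in> ball p s \<longrightarrow> g x = 0"
    and \<beta>: "smooth \<beta>" "\<And>x. norm x \<ge> t \<Longrightarrow> \<beta> x = 0" and t: "0 < t" "t < s"
    and z: "z \<in> ball p (r - t)"
  shows "(LBINT x. g x * \<beta> (x - z)) = 0"
proof -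
  define \<phi> where "\<phi> y = \<beta> (0 - y)" for y
  have \<phi>: "smooth \<phi>" unfolding \<phi>_def by (rule smooth_reflect[OF \<beta>(1)])
  have \<phi>_van: "norm y \<ge> t \<Longrightarrow> \<phi> y = 0" for y unfolding \<phi>_def by (rule \<beta>(2)) simp
  define G where "G u = (LBINT x. g x * \<phi> (u + - x))" for u
  have G_z: "(LBINT x. g x * \<beta> (x - z)) = G z" by (simp add: G_def \<phi>_def)
  have near: "G u = 0" if "u \<in> ball p (s - t)" for u
  proof -
    have "G u = integral\<^sup>L lborel (\<lambda>x::complex^'n. 0)"
      unfolding G_def
    proof (rule integral_cong_AE)
      show "AE x in lborel. g x * \<phi> (u + - x) = 0"
        using zero
      proof eventually_elim
        case (elim x)
        show ?case
        proof (cases "x \<in> ball p s")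
          case False
          then have "dist u x \<ge> t" using that dist_triangle[of p x u] by simp
          then have "\<phi> (u + - x) = 0" by (intro \<phi>_van) (simp add: dist_norm)
          then show ?thesis by simp
        qed (use elim in simp)
      qed
      show "(\<lambda>x. g x * \<phi> (u + - x)) \<in> borel_measurable lborel"
        using g borel_measurable_continuous_onI[OF smooth_continuous[OF \<phi>]] by measurable
    qed simp
    then show ?thesis by simp
  qed
  have um: "(uminus :: complex^'n \<Rightarrow> _) \<in> borel_measurable lborel" by simp
  have der: "(G has_derivative frechet_derivative G (at u)) (at u)" for u
    unfolding G_def by (rule smooth_has_derivative[OF smooth_integral_translate(1)[OF g um \<phi> \<phi>_van]])
  have CR: "wirtinger_bar k G u = 0" if u: "u \<in> ball p (r - t)" for u k
  proof -
    let ?\<psi> = "\<lambda>x. \<phi> (u + - x)"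
    have "test_function (ball p r) ?\<psi>"
    proof (rule test_functionI[where S = "cball u t"])
      show "cball u t \<subseteq> ball p r"
      proof
        fix x assume "x \<in> cball u t"
        then show "x \<in> ball p r" using u dist_triangle[of p x u] by simp
      qed
      show "?\<psi> x \<noteq> 0 \<Longrightarrow> x \<in> cball u t" for x
        using \<phi>_van[of "u + - x"] by (cases "t \<le> norm (u - x)") (auto simp: dist_norm)
    qed (use smooth_reflect[OF \<phi>, of u] in auto)
    then have "(LBINT x. g x * wirtinger_bar k ?\<psi> x) = 0"
      using weak by (simp add: weakly_holomorphic_on_def)
    then have "(LBINT x. g x * wirtinger_bar k \<phi> (u + - x)) = 0"
      unfolding wirtinger_bar_reflect[OF \<phi>] by simp
    moreover have "wirtinger_bar k G u = (LBINT x. g x * wirtinger_bar k \<phi> (u + - x))"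
      unfolding G_def by (rule wirtinger_bar_integral_translate[OF g um \<phi> \<phi>_van])
    ultimately show ?thesis by simp
  qed
  have clin: "frechet_derivative G (at u) (c *s v) = c * frechet_derivative G (at u) v" if "u \<in> ball p (r - t)" for u c v
    by (rule complex_linear_if_Cauchy_Riemann[OF has_derivative_linear[OF der] CR[OF that, unfolded wirtinger_bar_def]])
  show ?thesis
  proof (cases "z = p")
    case True
    then show ?thesis using near[of p] t G_z by simp
  next
    case False
    define w where "w = z - p"
    have w: "norm w > 0" "norm w < r - t" using False z by (auto simp: w_def dist_norm norm_minus_commute)
    \<comment> \<open>The restriction of \<open>G\<close> to the complex line through \<open>p\<close> and \<open>z\<close>.\<close>
    define F where "F c = G (p + c *s w)" for c
    have F_der: "(F has_field_derivative frechet_derivative G (at (p + c *s w)) w) (at c)" if "p + c *s w \<in> ball p (r - t)" for c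
    proof -
      have "((\<lambda>c. p + c *s w) has_derivative (\<lambda>c. 0 + c *s w)) (at c)"
        by (rule has_derivative_add[OF has_derivative_const bounded_linear_imp_has_derivative[OF bounded_linear_complex_line]])
      from has_derivative_compose[OF this der]
      have "(F has_derivative (\<lambda>b. frechet_derivative G (at (p + c *s w)) (0 + b *s w))) (at c)" unfolding F_def .
      moreover have "(\<lambda>b. frechet_derivative G (at (p + c *s w)) (0 + b *s w)) = (*) (frechet_derivative G (at (p + c *s w)) w)"
        using clin[OF that, of _ w] by (simp add: fun_eq_iff)
      ultimately show ?thesis unfolding has_field_derivative_def by simp
    qed
    have in_ball: "p + c *s w \<in> ball p \<rho> \<longleftrightarrow> c \<in> ball 0 (\<rho> / norm w)" for c \<rho>
      using w(1) by (simp add: dist_norm norm_vector_smult_complex field_simps)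
    have pos: "0 < (s - t) / norm w" "0 < (r - t) / norm w"
    proof -
      have "0 < s - t" "0 < r - t" using w t by linarith+
      then show "0 < (s - t) / norm w" "0 < (r - t) / norm w"
        using w(1) divide_pos_pos by blast+
    qed
    have "F 1 = 0"
    proof (rule analytic_continuation[of F "ball 0 ((r - t) / norm w)" "ball 0 (min ((s - t) / norm w) ((r - t) / norm w))" 0])
      show "F holomorphic_on ball 0 ((r - t) / norm w)"
        unfolding holomorphic_on_open[OF open_ball] using F_der in_ball[of _ "r - t"] by blast
      show "(0::complex) islimpt ball 0 (min ((s - t) / norm w) ((r - t) / norm w))"
        using pos by (simp add: islimpt_ball)
      show "\<And>c. c \<in> ball 0 (min ((s - t) / norm w) ((r - t) / norm w)) \<Longrightarrow> F c = 0"
        unfolding F_def by (rule near) (use in_ball[of _ "s - t"] in auto)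
      show "1 \<in> ball (0::complex) ((r - t) / norm w)" using w by (simp add: field_simps)
      show "0 \<in> ball (0::complex) ((r - t) / norm w)" using pos by simp
    qed auto
    then show ?thesis using G_z by (simp add: F_def w_def)
  qed
qed

text \<open>
  Mollifiers approximating the indicator of a small box show that the integrals of \<open>g\<close> over small boxes
  vanish.
\<close>

lemma weakly_holomorphic_vanishing_ball:
  fixes g :: "complex^'n \<Rightarrow> complex"
  assumes g: "integrable lborel g" and weak: "weakly_holomorphic_on g (ball p r)"
    and zero: "AE x in lborel. x \<in> ball p s \<longrightarrow> g x = 0" and "s > 0"
  shows "AE x in lborel. x \<in> ball p r \<longrightarrow> g x = 0"
proof (rule AE_lborel_locally)
  fix z assume z: "z \<in> ball p r"
  define t where "t = min (s / 2) ((r - dist p z) / 2)"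
  have t: "0 < t" "t < s" "z \<in> ball p (r - t)" using z \<open>s > 0\<close> by (auto simp: t_def min_def field_simps)
  have g_meas: "g \<in> borel_measurable borel" using borel_measurable_integrable[OF g] by simp
  have box_int: "(LBINT x. indicator (box a b) x *\<^sub>R g x) = 0" if ab: "box a b \<subseteq> ball z t" for a b
  proof -
    let ?\<beta> = "\<lambda>m x. complex_of_real (box_bump (real (Suc m)) (a - z) (b - z) x)"
    have shift: "?\<beta> m (x - z) = complex_of_real (box_bump (real (Suc m)) a b x)" for m x
      by (simp add: box_bump_def inner_diff_left)
    have 0: "(LBINT x. g x * ?\<beta> m (x - z)) = 0" for m
    proof (rule weakly_holomorphic_mollification_eq_0[OF g weak zero _ _ t])
      show "smooth (?\<beta> m)" by (intro smooth_of_real smooth_box_bump)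
      fix x :: "complex^'n" assume "t \<le> norm x"
      then have "x + z \<notin> ball z t" by (simp add: dist_norm)
      then have "x + z \<notin> box a b" using ab by blast
      then have "box_bump (real (Suc m)) a b (x + z) = 0" by (intro box_bump_eq_0) auto
      then show "?\<beta> m x = 0" using shift[of m "x + z"] by (simp del: of_nat_Suc)
    qed
    have "(\<lambda>m. \<integral>x. g x * ?\<beta> m (x - z) \<partial>lborel) \<longlonglongrightarrow> (LBINT x. indicator (box a b) x *\<^sub>R g x)"
    proof (rule integral_dominated_convergence[where w = "\<lambda>x. norm (g x)"])
      show "(\<lambda>x. g x * ?\<beta> m (x - z)) \<in> borel_measurable lborel" for m
        unfolding shift
        using borel_measurable_times[OF g_meas
            borel_measurable_continuous_onI[OF smooth_continuous[OF smooth_of_real[OF smooth_box_bump]]],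
            of "real (Suc m)" a b]
        by (simp del: of_nat_Suc)
      show "AE x in lborel. (\<lambda>m. g x * ?\<beta> m (x - z)) \<longlonglongrightarrow> indicator (box a b) x *\<^sub>R g x"
      proof (intro AE_I2)
        fix x
        have "(\<lambda>m. g x * ?\<beta> m (x - z)) \<longlonglongrightarrow> g x * complex_of_real (indicator (box a b) x)"
          unfolding shift by (intro tendsto_mult tendsto_const tendsto_of_real box_bump_tendsto_indicator)
        then show "(\<lambda>m. g x * ?\<beta> m (x - z)) \<longlonglongrightarrow> indicator (box a b) x *\<^sub>R g x"
          by (simp only: scaleR_conv_of_real mult.commute)
      qed
      show "AE x in lborel. norm (g x * ?\<beta> m (x - z)) \<le> norm (g x)" for m
      proof (intro AE_I2)
        fix x
        have "norm (g x * ?\<beta> m (x - z)) = norm (g x) * box_bump (real (Suc m)) a b x"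
          unfolding shift using box_bump_bounds(1)[of "real (Suc m)" a b x] by (simp add: norm_mult)
        also have "\<dots> \<le> norm (g x)"
          using box_bump_bounds[of "real (Suc m)" a b x] by (intro mult_left_le) auto
        finally show "norm (g x * ?\<beta> m (x - z)) \<le> norm (g x)" .
      qed
    qed (use g g_meas in auto)
    then show ?thesis unfolding 0 by (simp add: LIMSEQ_const_iff)
  qed
  have "z \<in> ball z t" using t(1) by simp
  then obtain a b where ab: "box a b \<subseteq> ball z t" "z \<in> box a b" "\<forall>i\<in>Basis. a \<bullet> i < b \<bullet> i"
    by (rule open_contains_box[OF open_ball])
  have "AE x in lborel. indicator (box a b) x *\<^sub>R g x = 0"
  proof (rule AE_eq_0_if_box_integrals_0[where c = a and d = b])
    show "integrable lborel (\<lambda>x. indicator (box a b) x *\<^sub>R g x)"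
      using integrable_mult_indicator[OF _ g, of "box a b"] by simp
    show "indicator (box a b) x *\<^sub>R g x = 0" if "x \<notin> box a b" for x using that by simp
    fix c d :: "complex^'n"
    obtain e f where ef: "box c d \<inter> box a b = box e f" using box_Int_box by blast
    have "indicator (box c d) x *\<^sub>R indicator (box a b) x *\<^sub>R g x = indicator (box e f) x *\<^sub>R g x" for x
      unfolding ef[symmetric] by (simp add: indicator_def)
    then have "(LBINT x. indicator (box c d) x *\<^sub>R indicator (box a b) x *\<^sub>R g x)
        = (LBINT x. indicator (box e f) x *\<^sub>R g x)"
      by (simp only:)
    also have "\<dots> = 0" using ef ab(1) by (intro box_int) blast
    finally show "(LBINT x. indicator (box c d) x *\<^sub>R indicator (box a b) x *\<^sub>R g x) = 0" .
  qed
  then have "AE x in lborel. x \<in> box a b \<longrightarrow> g x = 0"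
    by eventually_elim (auto simp: indicator_def)
  then show "\<exists>N. open N \<and> z \<in> N \<and> (AE y in lborel. y \<in> N \<longrightarrow> g y = 0)"
    using ab(2) open_box by blast
qed

text \<open>
  The points of \<open>W\<close> near which \<open>g\<close> vanishes form an open set, and by
  \<open>weakly_holomorphic_vanishing_ball\<close> so does their complement in \<open>W\<close>.
\<close>

theorem weakly_holomorphic_identity:
  fixes g :: "complex^'n \<Rightarrow> complex"
  assumes g: "integrable lborel g" and weak: "weakly_holomorphic_on g W"
    and W: "open W" "connected W" and A: "open A" "A \<noteq> {}" "A \<subseteq> W"
    and zero: "AE x in lborel. x \<in> A \<longrightarrow> g x = 0"
  shows "AE x in lborel. x \<in> W \<longrightarrow> g x = 0"
proof -
  define Z where "Z = {q \<in> W. \<exists>e>0. AE x in lborel. x \<in> ball q e \<longrightarrow> g x = 0}"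
  have step: "q \<in> Z" if "ball p r \<subseteq> W" "p \<in> Z" "q \<in> ball p r" for p q r
  proof -
    obtain e where e: "e > 0" "AE x in lborel. x \<in> ball p e \<longrightarrow> g x = 0" using \<open>p \<in> Z\<close> by (auto simp: Z_def)
    have pr: "AE x in lborel. x \<in> ball p r \<longrightarrow> g x = 0"
      by (rule weakly_holomorphic_vanishing_ball[OF g weakly_holomorphic_on_subset[OF weak \<open>ball p r \<subseteq> W\<close>] e(2,1)])
    from \<open>q \<in> ball p r\<close> obtain d where d: "0 < d" "ball q d \<subseteq> ball p r"
      by (rule openE[OF open_ball])
    have "AE x in lborel. x \<in> ball q d \<longrightarrow> g x = 0"
      using pr by eventually_elim (use d(2) in blast)
    then show ?thesis using d(1) that by (auto simp: Z_def)
  qed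
  have openZ: "open Z"
  proof (rule openI)
    fix p assume p: "p \<in> Z"
    then have "p \<in> W" by (simp add: Z_def)
    then obtain r where r: "0 < r" "ball p r \<subseteq> W" by (rule openE[OF W(1)])
    show "\<exists>e>0. ball p e \<subseteq> Z"
      using r(1) step[OF r(2) p] by blast
  qed
  have openC: "open (W - Z)"
  proof (rule openI)
    fix q assume q: "q \<in> W - Z"
    then have "q \<in> W" by simp
    then obtain r where r: "0 < r" "ball q r \<subseteq> W" by (rule openE[OF W(1)])
    have "p \<in> W - Z" if p: "p \<in> ball q (r / 2)" for p
    proof -
      have "ball p (r / 2) \<subseteq> ball q r"
      proof
        fix x assume "x \<in> ball p (r / 2)"
        then show "x \<in> ball q r" using p dist_triangle[of q x p] by simp
      qed
      then have "ball p (r / 2) \<subseteq> W" using r(2) by blast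
      moreover have "q \<in> ball p (r / 2)" using p by (simp add: dist_commute)
      ultimately have "p \<notin> Z" using step[of p "r / 2" q] q by blast
      moreover have "p \<in> ball q r" using p r(1) by auto
      ultimately show ?thesis using r(2) by blast
    qed
    then show "\<exists>e>0. ball q e \<subseteq> W - Z"
      using r(1) by (intro exI[of _ "r / 2"]) auto
  qed
  obtain a where a: "a \<in> A" using A(2) by blast
  then obtain e where e: "0 < e" "ball a e \<subseteq> A" by (rule openE[OF A(1)])
  have "AE x in lborel. x \<in> ball a e \<longrightarrow> g x = 0"
    using zero by eventually_elim (use e(2) in blast)
  then have "a \<in> Z" using e(1) a A(3) by (auto simp: Z_def)
  moreover have "Z \<inter> W = {} \<or> (W - Z) \<inter> W = {}"
    by (rule connectedD[OF W(2) openZ openC]) auto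
  ultimately have "Z = W" by (auto simp: Z_def)
  show ?thesis
  proof (rule AE_lborel_locally)
    fix q assume "q \<in> W"
    then obtain e where "e > 0" "AE x in lborel. x \<in> ball q e \<longrightarrow> g x = 0"
      using \<open>Z = W\<close> by (auto simp: Z_def)
    then show "\<exists>N. open N \<and> q \<in> N \<and> (AE y in lborel. y \<in> N \<longrightarrow> g y = 0)"
      by (intro exI[of _ "ball q e"]) auto
  qed
qed

section \<open>Square-integrable convolutions\<close>

lemma abs_mult_le_power2_sum: "\<bar>s * t\<bar> \<le> s\<^sup>2 + t\<^sup>2" for s t :: real
proof -
  have "2 * (\<bar>s\<bar> * \<bar>t\<bar>) \<le> s\<^sup>2 + t\<^sup>2"
    using zero_le_power2[of "\<bar>s\<bar> - \<bar>t\<bar>"] unfolding power2_diff by simp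
  moreover have "0 \<le> \<bar>s\<bar> * \<bar>t\<bar>" by simp
  ultimately have "\<bar>s\<bar> * \<bar>t\<bar> \<le> s\<^sup>2 + t\<^sup>2" by linarith
  then show ?thesis by (simp add: abs_mult)
qed

lemma square_integrable_add:
  fixes f g :: "'m \<Rightarrow> 'b::euclidean_space"
  assumes [measurable]: "f \<in> borel_measurable M" "g \<in> borel_measurable M"
    and int: "integrable M (\<lambda>x. (norm (f x))\<^sup>2)" "integrable M (\<lambda>x. (norm (g x))\<^sup>2)"
  shows "integrable M (\<lambda>x. (norm (f x + g x))\<^sup>2)"
proof (rule Bochner_Integration.integrable_bound)
  show "integrable M (\<lambda>x. 2 * (norm (f x))\<^sup>2 + 2 * (norm (g x))\<^sup>2)" using int by simp
  show "(\<lambda>x. (norm (f x + g x))\<^sup>2) \<in> borel_measurable M" by measurable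
  show "AE x in M. norm ((norm (f x + g x))\<^sup>2) \<le> norm (2 * (norm (f x))\<^sup>2 + 2 * (norm (g x))\<^sup>2)"
  proof (intro AE_I2)
    fix x
    have "(norm (f x + g x))\<^sup>2 \<le> (norm (f x) + norm (g x))\<^sup>2"
      by (intro power_mono norm_triangle_ineq) simp
    also have "\<dots> \<le> 2 * (norm (f x))\<^sup>2 + 2 * (norm (g x))\<^sup>2"
      using zero_le_power2[of "norm (f x) - norm (g x)"] unfolding power2_diff power2_sum by linarith
    finally show "norm ((norm (f x + g x))\<^sup>2) \<le> norm (2 * (norm (f x))\<^sup>2 + 2 * (norm (g x))\<^sup>2)" by simp
  qed
qed

text \<open>
  The integral of \<open>(g - c f)\<^sup>2\<close> is a nonnegative quadratic polynomial in \<open>c\<close>.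
\<close>

lemma Cauchy_Schwarz_integral:
  fixes f g :: "'m \<Rightarrow> real"
  assumes [measurable]: "f \<in> borel_measurable M" "g \<in> borel_measurable M"
    and f2: "integrable M (\<lambda>x. (f x)\<^sup>2)" and g2: "integrable M (\<lambda>x. (g x)\<^sup>2)"
  shows "integrable M (\<lambda>x. f x * g x)"
    and "(\<integral>x. f x * g x \<partial>M)\<^sup>2 \<le> (\<integral>x. (f x)\<^sup>2 \<partial>M) * (\<integral>x. (g x)\<^sup>2 \<partial>M)"
proof -
  show fg: "integrable M (\<lambda>x. f x * g x)"
  proof (rule Bochner_Integration.integrable_bound)
    show "integrable M (\<lambda>x. (f x)\<^sup>2 + (g x)\<^sup>2)" using f2 g2 by simp
    show "(\<lambda>x. f x * g x) \<in> borel_measurable M" by measurable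
    show "AE x in M. norm (f x * g x) \<le> norm ((f x)\<^sup>2 + (g x)\<^sup>2)"
      using abs_mult_le_power2_sum by (intro AE_I2) simp
  qed
  define P where "P = (\<integral>x. (f x)\<^sup>2 \<partial>M)"
  define I where "I = (\<integral>x. f x * g x \<partial>M)"
  define Q where "Q = (\<integral>x. (g x)\<^sup>2 \<partial>M)"
  have quad: "0 \<le> Q - 2 * c * I + c\<^sup>2 * P" for c
  proof -
    have "0 \<le> (\<integral>x. (g x - c * f x)\<^sup>2 \<partial>M)" by simp
    also have "(\<lambda>x. (g x - c * f x)\<^sup>2) = (\<lambda>x. (g x)\<^sup>2 - 2 * c * (f x * g x) + c\<^sup>2 * (f x)\<^sup>2)"
      by (simp add: fun_eq_iff power2_diff power_mult_distrib algebra_simps)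
    also have "(\<integral>x. (g x)\<^sup>2 - 2 * c * (f x * g x) + c\<^sup>2 * (f x)\<^sup>2 \<partial>M) = Q - 2 * c * I + c\<^sup>2 * P"
      using fg f2 g2 by (simp add: P_def I_def Q_def)
    finally show ?thesis .
  qed
  have P: "P \<ge> 0" unfolding P_def by simp
  have "I\<^sup>2 \<le> P * Q"
  proof (cases "P = 0")
    case True
    have "I = 0"
    proof (rule ccontr)
      assume "I \<noteq> 0"
      then show False using quad[of "(Q + 1) / (2 * I)"] True by (simp add: field_simps)
    qed
    then show ?thesis using True by simp
  next
    case False
    have "0 \<le> P * (Q - 2 * (I / P) * I + (I / P)\<^sup>2 * P)" using P quad[of "I / P"] by simp
    also have "\<dots> = P * Q - I\<^sup>2" using False by (simp add: field_simps power2_eq_square)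
    finally show ?thesis by simp
  qed
  then show "(\<integral>x. f x * g x \<partial>M)\<^sup>2 \<le> (\<integral>x. (f x)\<^sup>2 \<partial>M) * (\<integral>x. (g x)\<^sup>2 \<partial>M)"
    by (simp add: P_def I_def Q_def)
qed

lemma weighted_Cauchy_Schwarz:
  fixes f u :: "'m \<Rightarrow> real"
  assumes f: "integrable M f" "\<And>x. f x \<ge> 0" and u: "u \<in> borel_measurable M" and fu2: "integrable M (\<lambda>x. f x * (u x)\<^sup>2)"
  shows "(\<integral>x. f x * u x \<partial>M)\<^sup>2 \<le> (\<integral>x. f x \<partial>M) * (\<integral>x. f x * (u x)\<^sup>2 \<partial>M)"
proof -
  have "f \<in> borel_measurable M" using f(1) by simp
  then have "(\<integral>x. sqrt (f x) * (sqrt (f x) * u x) \<partial>M)\<^sup>2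
      \<le> (\<integral>x. (sqrt (f x))\<^sup>2 \<partial>M) * (\<integral>x. (sqrt (f x) * u x)\<^sup>2 \<partial>M)"
    using f fu2 u by (intro Cauchy_Schwarz_integral(2)) (simp_all add: power_mult_distrib)
  then show ?thesis
    using f(2) by (simp add: power_mult_distrib mult.assoc[symmetric])
qed

lemma lborel_integral_translate:
  fixes f :: "'a::euclidean_space \<Rightarrow> 'b::{banach, second_countable_topology}"
  assumes "f \<in> borel_measurable borel"
  shows "(LBINT x. f (c + x)) = integral\<^sup>L lborel f"
    and "integrable lborel (\<lambda>x. f (c + x)) \<longleftrightarrow> integrable lborel f"
proof -
  have m: "(+) c \<in> measurable lborel borel" by simp
  show "(LBINT x. f (c + x)) = integral\<^sup>L lborel f"
    using integral_distr[OF m, of f] assms by (simp add: lborel_distr_plus)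
  show "integrable lborel (\<lambda>x. f (c + x)) \<longleftrightarrow> integrable lborel f"
    using integrable_distr_eq[OF m, of f] assms by (simp add: lborel_distr_plus)
qed

lemma integrable_convolution_kernel:
  fixes \<kappa> :: "'c::euclidean_space \<Rightarrow> 'b::{real_normed_field, banach, second_countable_topology}"
    and \<omega> :: "'a::euclidean_space \<Rightarrow> 'b"
  assumes \<kappa>: "integrable lborel \<kappa>" and \<omega>: "integrable lborel \<omega>" and T: "T \<in> borel_measurable borel"
  shows "integrable (lborel \<Otimes>\<^sub>M lborel) (\<lambda>(\<zeta>, z). \<kappa> \<zeta> * \<omega> (z - T \<zeta>))"
proof (rule lborel_pair.Fubini_integrable)
  have [measurable]: "\<kappa> \<in> borel_measurable borel" "\<omega> \<in> borel_measurable borel"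
    using borel_measurable_integrable[OF \<kappa>] borel_measurable_integrable[OF \<omega>] by simp_all
  note T[measurable]
  show "(\<lambda>(\<zeta>, z). \<kappa> \<zeta> * \<omega> (z - T \<zeta>)) \<in> borel_measurable (lborel \<Otimes>\<^sub>M lborel)" by measurable
  have tr: "integrable lborel (\<lambda>z. \<omega> (z - t))" for t
    using lborel_integral_translate(2)[of \<omega> "- t"] \<omega> by simp
  have "(LBINT z. norm (\<kappa> \<zeta> * \<omega> (z - T \<zeta>))) = norm (\<kappa> \<zeta>) * (LBINT z. norm (\<omega> z))" for \<zeta>
    using lborel_integral_translate(1)[of "\<lambda>z. norm (\<omega> z)" "- T \<zeta>"] by (simp add: norm_mult)
  then show "integrable lborel (\<lambda>\<zeta>. \<integral>z. norm (case (\<zeta>, z) of (\<zeta>, z) \<Rightarrow> \<kappa> \<zeta> * \<omega> (z - T \<zeta>)) \<partial>lborel)"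
    using \<kappa> by simp
  show "AE \<zeta> in lborel. integrable lborel (\<lambda>z. case (\<zeta>, z) of (\<zeta>, z) \<Rightarrow> \<kappa> \<zeta> * \<omega> (z - T \<zeta>))"
    using tr by simp
qed

text \<open>
  Up to the change of variables \<open>z = x + T \<zeta>\<close> this is Fubini's theorem. It moves the convolution from
  a rough function \<open>\<omega>\<close> to a test function \<open>\<psi>\<close>.
\<close>

lemma convolution_pairing:
  fixes \<kappa> :: "'c::euclidean_space \<Rightarrow> complex" and \<omega> \<psi> :: "'a::euclidean_space \<Rightarrow> complex"
  assumes \<kappa>: "integrable lborel \<kappa>" and \<omega>: "integrable lborel \<omega>" and T: "T \<in> borel_measurable borel"
    and \<psi>: "\<psi> \<in> borel_measurable borel" "\<And>x. norm (\<psi> x) \<le> B"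
  shows "(LBINT z. (LBINT \<zeta>. \<kappa> \<zeta> * \<omega> (z - T \<zeta>)) * \<psi> z)
       = (LBINT x. \<omega> x * (LBINT \<zeta>. \<kappa> \<zeta> * \<psi> (x + T \<zeta>)))"
proof -
  have [measurable]: "\<kappa> \<in> borel_measurable borel" "\<omega> \<in> borel_measurable borel"
    using borel_measurable_integrable[OF \<kappa>] borel_measurable_integrable[OF \<omega>] by simp_all
  note T[measurable] \<psi>(1)[measurable]
  have int1: "integrable (lborel \<Otimes>\<^sub>M lborel) (\<lambda>(\<zeta>, z). \<kappa> \<zeta> * \<omega> (z - T \<zeta>) * \<psi> z)"
  proof -
    have "integrable (lborel \<Otimes>\<^sub>M lborel) (\<lambda>p. (case p of (\<zeta>, z) \<Rightarrow> \<kappa> \<zeta> * \<omega> (z - T \<zeta>)) * \<psi> (snd p))"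
      by (rule integrable_mult_bounded[OF integrable_convolution_kernel[OF \<kappa> \<omega> T] _ \<psi>(2)]) measurable
    then show ?thesis by (simp add: case_prod_unfold)
  qed
  have int2: "integrable (lborel \<Otimes>\<^sub>M lborel) (\<lambda>(\<zeta>, x). \<kappa> \<zeta> * \<omega> x * \<psi> (x + T \<zeta>))"
  proof -
    have "integrable (lborel \<Otimes>\<^sub>M lborel) (\<lambda>(\<zeta>, x). \<kappa> \<zeta> * \<omega> (x - 0))"
      by (rule integrable_convolution_kernel[OF \<kappa> \<omega>, of "\<lambda>_. 0"]) simp
    then have "integrable (lborel \<Otimes>\<^sub>M lborel) (\<lambda>p. (case p of (\<zeta>, x) \<Rightarrow> \<kappa> \<zeta> * \<omega> (x - 0)) * \<psi> (snd p + T (fst p)))"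
      by (rule integrable_mult_bounded[OF _ _ \<psi>(2)]) measurable
    then show ?thesis by (simp add: case_prod_unfold)
  qed
  have "(LBINT z. (LBINT \<zeta>. \<kappa> \<zeta> * \<omega> (z - T \<zeta>)) * \<psi> z)
      = (LBINT z. (LBINT \<zeta>. \<kappa> \<zeta> * \<omega> (z - T \<zeta>) * \<psi> z))" by simp
  also have "\<dots> = (LBINT \<zeta>. (LBINT z. \<kappa> \<zeta> * \<omega> (z - T \<zeta>) * \<psi> z))"
    by (rule lborel_pair.Fubini_integral[OF int1])
  also have "\<dots> = (LBINT \<zeta>. (LBINT x. \<kappa> \<zeta> * \<omega> x * \<psi> (x + T \<zeta>)))"
  proof (rule Bochner_Integration.integral_cong[OF refl])
    fix \<zeta>
    show "(LBINT z. \<kappa> \<zeta> * \<omega> (z - T \<zeta>) * \<psi> z) = (LBINT x. \<kappa> \<zeta> * \<omega> x * \<psi> (x + T \<zeta>))"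
      using lborel_integral_translate(1)[of "\<lambda>z. \<kappa> \<zeta> * \<omega> (z - T \<zeta>) * \<psi> z" "T \<zeta>"] by (simp add: add.commute)
  qed
  also have "\<dots> = (LBINT x. (LBINT \<zeta>. \<kappa> \<zeta> * \<omega> x * \<psi> (x + T \<zeta>)))"
    by (rule lborel_pair.Fubini_integral[OF int2, symmetric])
  also have "\<dots> = (LBINT x. \<omega> x * (LBINT \<zeta>. \<kappa> \<zeta> * \<psi> (x + T \<zeta>)))"
    by (intro Bochner_Integration.integral_cong refl) (simp add: mult.left_commute mult.assoc flip: integral_mult_right_zero)
  finally show ?thesis .
qed

text \<open>
  Young's inequality for the exponents 1 and 2: the Cauchy-Schwarz inequality with the weight \<open>\<bar>\<kappa>\<bar>\<close>.
\<close>

lemma convolution_square_integrable: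
  fixes \<kappa> :: "'c::euclidean_space \<Rightarrow> complex" and \<omega> :: "'a::euclidean_space \<Rightarrow> complex"
  assumes \<kappa>: "integrable lborel \<kappa>" and \<omega>: "\<omega> \<in> borel_measurable borel" "integrable lborel (\<lambda>x. (norm (\<omega> x))\<^sup>2)"
    and T: "T \<in> borel_measurable borel"
  shows "(\<lambda>z. \<integral>\<zeta>. \<kappa> \<zeta> * \<omega> (z - T \<zeta>) \<partial>lborel) \<in> borel_measurable borel"
    and "integrable lborel (\<lambda>z. (norm (LBINT \<zeta>. \<kappa> \<zeta> * \<omega> (z - T \<zeta>)))\<^sup>2)"
proof -
  have [measurable]: "\<kappa> \<in> borel_measurable borel" using borel_measurable_integrable[OF \<kappa>] by simp
  note T[measurable] \<omega>(1)[measurable]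
  let ?w = "\<lambda>z. \<integral>\<zeta>. \<kappa> \<zeta> * \<omega> (z - T \<zeta>) \<partial>lborel"
  show w_meas: "?w \<in> borel_measurable borel" by measurable
  define V where "V z = (LBINT \<zeta>. norm (\<kappa> \<zeta>) * (norm (\<omega> (z - T \<zeta>)))\<^sup>2)" for z
  have int: "integrable (lborel \<Otimes>\<^sub>M lborel) (\<lambda>(\<zeta>, z). norm (\<kappa> \<zeta>) * (norm (\<omega> (z - T \<zeta>)))\<^sup>2)"
    by (rule integrable_convolution_kernel[OF integrable_norm[OF \<kappa>] \<omega>(2) T])
  have V: "integrable lborel V"
    unfolding V_def by (rule lborel_pair.integrable_snd[OF int])
  show "integrable lborel (\<lambda>z. (norm (?w z))\<^sup>2)"
  proof (rule Bochner_Integration.integrable_bound)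
    show "integrable lborel (\<lambda>z. (LBINT \<zeta>. norm (\<kappa> \<zeta>)) * V z)" using V by simp
    show "(\<lambda>z. (norm (?w z))\<^sup>2) \<in> borel_measurable lborel" using w_meas by simp
    have "AE z in lborel. integrable lborel (\<lambda>\<zeta>. norm (\<kappa> \<zeta>) * (norm (\<omega> (z - T \<zeta>)))\<^sup>2)"
      using lborel_pair.AE_integrable_snd[OF int] by simp
    then show "AE z in lborel. norm ((norm (?w z))\<^sup>2) \<le> norm ((LBINT \<zeta>. norm (\<kappa> \<zeta>)) * V z)"
    proof eventually_elim
      case (elim z)
      have "norm (?w z) \<le> (LBINT \<zeta>. norm (\<kappa> \<zeta>) * norm (\<omega> (z - T \<zeta>)))"
        using integral_norm_bound[of lborel "\<lambda>\<zeta>. \<kappa> \<zeta> * \<omega> (z - T \<zeta>)"] by (simp add: norm_mult)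
      then have "(norm (?w z))\<^sup>2 \<le> (LBINT \<zeta>. norm (\<kappa> \<zeta>) * norm (\<omega> (z - T \<zeta>)))\<^sup>2"
        by (rule power_mono) simp
      also have "\<dots> \<le> (LBINT \<zeta>. norm (\<kappa> \<zeta>)) * V z"
        unfolding V_def by (rule weighted_Cauchy_Schwarz) (use \<kappa> elim in auto)
      finally show ?case by simp
    qed
  qed
qed

section \<open>Hartogs extension\<close>

lemma bounded_linear_axis: "bounded_linear (axis a :: complex \<Rightarrow> complex^'n)"
proof -
  have "linear (axis a :: complex \<Rightarrow> complex^'n)"
    by (rule linearI) (auto simp: vec_eq_iff axis_def)
  then show ?thesis by (simp add: linear_conv_bounded_linear)
qed

lemma norm_axis_complex: "norm (axis a c :: complex^'n) = norm c"
  by (simp add: norm_vec_def L2_set_def axis_def if_distrib[of norm] if_distrib[of "\<lambda>x. x\<^sup>2"] sum.delta cong: if_cong)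

text \<open>
  The Cauchy-Pompeiu formula for \<open>\<phi>\<close> on the complex line through \<open>x\<close> in the direction of the coordinate
  \<open>a\<close>. The kernel is truncated so as to be integrable; on the truncated part \<open>\<zeta>\<close> is so large that
  \<open>x + axis a \<zeta>\<close> leaves \<open>D\<close>.
\<close>

lemma cauchy_transform_inverts_wirtinger_bar:
  fixes \<phi> :: "complex^'n \<Rightarrow> complex"
  assumes \<phi>: "test_function D \<phi>" and D: "D \<subseteq> ball 0 B" and x: "x \<in> D"
  shows "(LBINT \<zeta>. (indicator (cball 0 (2 * B)) \<zeta> / \<zeta>) * wirtinger_bar a \<phi> (x + axis a \<zeta>))
    = - of_real cauchy_mass * \<phi> x"
proof -
  note sm = test_function_smooth[OF \<phi>]
  obtain R where R: "\<And>x. norm x \<ge> R \<Longrightarrow> \<phi> x = 0" using test_function_vanishing[OF \<phi>] by blast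
  let ?f = "\<lambda>\<zeta>. \<phi> (x + axis a \<zeta>)"
  let ?f' = "\<lambda>\<zeta> v. frechet_derivative \<phi> (at (x + axis a \<zeta>)) (axis a v)"
  have der: "(?f has_derivative ?f' \<zeta>) (at \<zeta>)" for \<zeta>
  proof -
    have "((\<lambda>\<zeta>. x + axis a \<zeta>) has_derivative (\<lambda>v. 0 + axis a v)) (at \<zeta>)"
      by (rule has_derivative_add[OF has_derivative_const bounded_linear_imp_has_derivative[OF bounded_linear_axis]])
    from has_derivative_compose[OF this smooth_has_derivative[OF sm]] show ?thesis by simp
  qed
  have cont: "continuous_on UNIV (\<lambda>\<zeta>. ?f' \<zeta> v)" for v
  proof (rule continuous_on_compose2[of UNIV "\<lambda>y. frechet_derivative \<phi> (at y) (axis a v)"])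
    show "continuous_on UNIV (\<lambda>y. frechet_derivative \<phi> (at y) (axis a v))"
      by (rule smooth_continuous[OF smooth_derivative[OF sm]])
    show "continuous_on UNIV (\<lambda>\<zeta>. x + axis a \<zeta>)"
      by (intro continuous_intros linear_continuous_on bounded_linear_axis)
  qed simp
  have van: "?f \<zeta> = 0" if "norm \<zeta> \<ge> R + norm x" for \<zeta>
  proof (rule R)
    have "norm (axis a \<zeta> :: complex^'n) \<le> norm (x + axis a \<zeta>) + norm x"
      using norm_triangle_ineq4[of "x + axis a \<zeta>" x] by simp
    then show "R \<le> norm (x + axis a \<zeta>)" using that by (simp add: norm_axis_complex)
  qed
  have "(indicator (cball 0 (2 * B)) \<zeta> / \<zeta>) * wirtinger_bar a \<phi> (x + axis a \<zeta>)
      = (1 / \<zeta>) * ((?f' \<zeta> 1 + \<i> * ?f' \<zeta> \<i>) / 2)" for \<zeta>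
  proof (cases "\<zeta> \<in> cball 0 (2 * B)")
    case False
    have "norm (axis a \<zeta> :: complex^'n) \<le> norm (x + axis a \<zeta>) + norm x"
      using norm_triangle_ineq4[of "x + axis a \<zeta>" x] by simp
    moreover have "norm x < B" using D x by auto
    ultimately have "x + axis a \<zeta> \<notin> D" using False D by (auto simp: norm_axis_complex)
    then have "wirtinger_bar a \<phi> (x + axis a \<zeta>) = 0"
      by (rule test_function_eq_0[OF test_function_wirtinger_bar[OF \<phi>]])
    then show ?thesis using False by (simp add: wirtinger_bar_def)
  qed (simp add: wirtinger_bar_def)
  then have "(LBINT \<zeta>. (indicator (cball 0 (2 * B)) \<zeta> / \<zeta>) * wirtinger_bar a \<phi> (x + axis a \<zeta>))
      = (LBINT \<zeta>. (1 / \<zeta>) * ((?f' \<zeta> 1 + \<i> * ?f' \<zeta> \<i>) / 2))" by (simp only:)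
  also have "\<dots> = - of_real cauchy_mass * ?f 0"
    by (rule cauchy_pompeiu_at_0[OF der cont van])
  also have "axis a 0 = (0 :: complex^'n)" by (simp add: axis_def vec_eq_iff)
  finally show ?thesis by simp
qed

text \<open>
  Let \<open>X\<close> be a cutoff function that is 1 near \<open>L\<close>. Then \<open>(1 - X) g\<close> makes sense on all of \<open>D\<close>, and its image
  under dbar is \<open>- g\<close> dbar \<open>X\<close>. The Cauchy transform \<open>w\<close> of \<open>g\<close> times the \<open>a\<close>-component of dbar \<open>X\<close> compensates
  it in all components at once because the form \<open>g\<close> dbar \<open>X\<close> is dbar-closed. Some point of \<open>D\<close> has a larger
  real part in another coordinate than all points of \<open>L\<close>; for a suitable \<open>X\<close> both \<open>X\<close> and \<open>w\<close> vanish near it, so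
  that the corrected function is \<open>g\<close> there, and as \<open>D - L\<close> is connected it is \<open>g\<close> on all of \<open>D - L\<close>.
\<close>

theorem hartogs_extension:
  fixes g :: "complex^'n \<Rightarrow> complex"
  assumes card: "CARD('n) \<ge> 2" and D: "open D" "bounded D" and L: "compact L" "L \<noteq> {}" "L \<subseteq> D"
    and conn: "connected (D - L)"
    and g_meas: "g \<in> borel_measurable borel" and g: "integrable lborel g" and g2: "integrable lborel (\<lambda>x. (norm (g x))\<^sup>2)"
    and hol: "weakly_holomorphic_on g (D - L)"
  obtains H where "H \<in> borel_measurable borel" "integrable lborel H" "integrable lborel (\<lambda>x. (norm (H x))\<^sup>2)"
    "weakly_holomorphic_on H D" "AE x in lborel. x \<in> D - L \<longrightarrow> H x = g x"
proof -
  \<comment> \<open>The Cauchy transform is taken in the coordinate \<open>a\<close>; the coordinate \<open>b\<close> is left fixed by it.\<close>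
  obtain a b :: 'n where ab: "a \<noteq> b"
    using card card_le_Suc0_iff_eq[of "UNIV :: 'n set"] by fastforce
  define l where "l z = Re (z $ b)" for z :: "complex^'n"
  have l_cont: "continuous_on S l" for S unfolding l_def by (intro continuous_intros)
  obtain p where p: "p \<in> L" "\<And>x. x \<in> L \<Longrightarrow> l x \<le> l p"
    using continuous_attains_sup[OF L(1,2) l_cont] by blast
  have "p \<in> D" using p(1) L(3) by blast
  then obtain e where e: "0 < e" "ball p e \<subseteq> D" by (rule openE[OF D(1)])
  \<comment> \<open>The cutoff will live where \<open>l < R\<close>, but \<open>D\<close> reaches beyond \<open>R\<close>, since it contains a ball around \<open>p\<close>.\<close>
  define R where "R = l p + e / 4"
  define U where "U = D \<inter> {z. l z < R}"
  define A where "A = D \<inter> {z. R < l z}"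
  have open_UA: "open U" "open A"
    unfolding U_def A_def by (auto intro!: open_Int D open_Collect_less l_cont continuous_intros)
  have LU: "L \<subseteq> U" using p(2) L(3) e(1) by (fastforce simp: U_def R_def)
  have A_sub: "A \<subseteq> D - L" using LU by (auto simp: A_def U_def)
  have "p + axis b (of_real (e / 2)) \<in> A"
  proof -
    have "p + axis b (of_real (e / 2)) \<in> ball p e" using e(1) by (simp add: dist_norm norm_axis_complex)
    then show ?thesis using e by (auto simp: A_def R_def l_def axis_def)
  qed
  then have A_ne: "A \<noteq> {}" by blast
  obtain \<eta> :: "complex^'n \<Rightarrow> real" and N where \<eta>: "smooth \<eta>" "open N" "L \<subseteq> N" "\<And>x. x \<in> N \<Longrightarrow> \<eta> x = 1"
    "compact (closure {x. \<eta> x \<noteq> 0})" "closure {x. \<eta> x \<noteq> 0} \<subseteq> U"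
    by (rule smooth_cutoff[OF L(1) open_UA(1) LU]) blast
  define X where "X x = complex_of_real (\<eta> x)" for x
  have X_smooth: "smooth X" unfolding X_def by (rule smooth_of_real[OF \<eta>(1)])
  have X_U: "test_function U X"
    using \<eta>(5,6) X_smooth by (simp add: test_function_def smooth_def X_def)
  have U_D: "U \<subseteq> D" by (auto simp: U_def)
  let ?S = "closure {x. X x \<noteq> 0}"
  have S: "compact ?S" "?S \<subseteq> U" using X_U by (auto simp: test_function_def)
  have dX: "test_function (U - L) (wirtinger_bar j X)" for j
  proof (rule test_functionI[where S = "?S - N"])
    show "compact (?S - N)" by (rule compact_diff[OF S(1) \<eta>(2)])
    show "?S - N \<subseteq> U - L" using S(2) \<eta>(3) by blast
    show "smooth (wirtinger_bar j X)" by (rule smooth_wirtinger_bar[OF X_smooth])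
    fix x assume nz: "wirtinger_bar j X x \<noteq> 0"
    have "x \<notin> N"
      using nz wirtinger_bar_eq_0[OF X_smooth \<eta>(2), of x 1 j] \<eta>(4) by (auto simp: X_def)
    with wirtinger_bar_nonzero_supp[OF X_smooth nz] show "x \<in> ?S - N" by blast
  qed
  have dX_D: "test_function (D - L) (wirtinger_bar j X)" for j
    by (rule test_function_mono[OF dX]) (use U_D in blast)
  obtain B where B: "D \<subseteq> ball 0 B" "B > 0"
    using bounded_subset_ballD[OF D(2), of 0] by blast
  \<comment> \<open>Points of \<open>D\<close> differ by less than \<open>2 * B\<close>, so \<open>\<kappa>\<close> is the full Cauchy kernel as far as \<open>D\<close> is concerned.\<close>
  define \<kappa> :: "complex \<Rightarrow> complex" where "\<kappa> \<zeta> = indicator (cball 0 (2 * B)) \<zeta> / \<zeta>" for \<zeta>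
  have \<kappa>: "integrable lborel \<kappa>"
  proof (rule Bochner_Integration.integrable_bound)
    show "integrable lborel (\<lambda>\<zeta>::complex. indicator (cball 0 (2 * B)) \<zeta> / norm \<zeta> :: real)"
      using B(2) by (intro integrable_inverse_norm) simp
    have "\<kappa> \<in> borel_measurable borel"
      unfolding \<kappa>_def by (intro borel_measurable_divide borel_measurable_indicator) auto
    then show "\<kappa> \<in> borel_measurable lborel" by simp
  qed (auto simp: \<kappa>_def norm_divide indicator_def)
  have axis_meas: "(axis a :: complex \<Rightarrow> complex^'n) \<in> borel_measurable borel"
    by (intro borel_measurable_continuous_onI linear_continuous_on bounded_linear_axis)
  define \<omega> where "\<omega> x = g x * wirtinger_bar a X x" for x
  have \<omega>: "integrable lborel \<omega>" unfolding \<omega>_def by (rule integrable_mult_test_function[OF g dX])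
  have bdd: "\<exists>B. \<forall>x. norm (f x) \<le> B" if f: "test_function V f" for f :: "complex^'n \<Rightarrow> complex" and V
  proof -
    obtain R where "\<And>x. norm x \<ge> R \<Longrightarrow> f x = 0" using test_function_vanishing[OF f] by blast
    from continuous_vanishing_bounded[OF smooth_continuous[OF test_function_smooth[OF f]] this] show ?thesis by blast
  qed
  have sq_int: "integrable lborel (\<lambda>x. (norm (g x * f x))\<^sup>2)"
    if f: "f \<in> borel_measurable borel" "\<And>x. norm (f x) \<le> C" for f :: "complex^'n \<Rightarrow> complex" and C
  proof (rule Bochner_Integration.integrable_bound)
    show "integrable lborel (\<lambda>x. C\<^sup>2 * (norm (g x))\<^sup>2)" using g2 by simp
    show "(\<lambda>x. (norm (g x * f x))\<^sup>2) \<in> borel_measurable lborel" using g_meas f(1) by simp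
    show "AE x in lborel. norm ((norm (g x * f x))\<^sup>2) \<le> norm (C\<^sup>2 * (norm (g x))\<^sup>2)"
    proof (intro AE_I2)
      fix x
      have "(norm (f x))\<^sup>2 \<le> C\<^sup>2" using f(2)[of x] by (intro power_mono) auto
      then show "norm ((norm (g x * f x))\<^sup>2) \<le> norm (C\<^sup>2 * (norm (g x))\<^sup>2)"
        by (simp add: norm_mult power_mult_distrib mult.commute[of "(norm (g x))\<^sup>2"] mult_right_mono)
    qed
  qed
  have smooth_meas: "f \<in> borel_measurable borel" if "smooth f" for f :: "complex^'n \<Rightarrow> complex"
    by (rule borel_measurable_continuous_onI[OF smooth_continuous[OF that]])
  have \<omega>2: "integrable lborel (\<lambda>x. (norm (\<omega> x))\<^sup>2)"
    using bdd[OF dX[of a]] sq_int[OF smooth_meas[OF smooth_wirtinger_bar[OF X_smooth]]] unfolding \<omega>_def by blast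
  have \<omega>_meas: "\<omega> \<in> borel_measurable borel"
    unfolding \<omega>_def by (intro borel_measurable_times g_meas smooth_meas smooth_wirtinger_bar X_smooth)
  define w where "w z = (LBINT \<zeta>. \<kappa> \<zeta> * \<omega> (z - axis a \<zeta>))" for z
  have w_meas: "w \<in> borel_measurable borel" and w2: "integrable lborel (\<lambda>z. (norm (w z))\<^sup>2)"
    unfolding w_def by (rule convolution_square_integrable[OF \<kappa> \<omega>_meas \<omega>2 axis_meas])+
  have w_int: "integrable lborel w"
    unfolding w_def using lborel_pair.integrable_snd[OF integrable_convolution_kernel[OF \<kappa> \<omega> axis_meas]] by simp
  let ?c = "complex_of_real cauchy_mass"
  have c: "?c \<noteq> 0" using cauchy_mass_pos by simp
  \<comment> \<open>In the sense of distributions on \<open>D\<close>, dbar sends \<open>w / cauchy_mass\<close> to \<open>g\<close> times dbar \<open>X\<close>.\<close>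
  define h where "h z = g z * (1 + (-1) * X z) + w z / ?c" for z
  define H where "H z = indicator D z *\<^sub>R h z" for z
  have X1_meas: "(\<lambda>z. 1 + (-1) * X z) \<in> borel_measurable borel"
    by (intro smooth_meas smooth_add smooth_const smooth_cmult X_smooth)
  obtain C where C: "\<And>x. norm (X x) \<le> C" using bdd[OF X_U] by blast
  have C1: "norm (1 + (-1) * X z) \<le> 1 + C" for z
    using norm_triangle_ineq4[of 1 "X z"] C[of z] by simp
  have v_int: "integrable lborel (\<lambda>z. g z * (1 + (-1) * X z))"
    by (rule integrable_mult_bounded[OF g _ C1]) (use X1_meas in simp)
  have h_int: "integrable lborel h"
    unfolding h_def using v_int w_int by simp
  have h_meas: "h \<in> borel_measurable borel"
    unfolding h_def using g_meas X1_meas w_meas by simp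
  have h2: "integrable lborel (\<lambda>z. (norm (h z))\<^sup>2)"
    unfolding h_def
  proof (rule square_integrable_add)
    show "integrable lborel (\<lambda>z. (norm (w z / ?c))\<^sup>2)"
      unfolding norm_divide power_divide using w2 by (intro integrable_divide)
    show "integrable lborel (\<lambda>z. (norm (g z * (1 + (-1) * X z)))\<^sup>2)" by (rule sq_int[OF X1_meas C1])
  qed (use g_meas X1_meas w_meas in simp_all)
  have weak: "(LBINT x. h x * wirtinger_bar j \<phi> x) = 0" if \<phi>: "test_function D \<phi>" for \<phi> j
  proof -
    note \<phi>_smooth = test_function_smooth[OF \<phi>]
    obtain R where R: "\<And>x. norm x \<ge> R \<Longrightarrow> \<phi> x = 0" using test_function_vanishing[OF \<phi>] by blast
    define \<Phi> where "\<Phi> x = (LBINT \<zeta>. \<kappa> \<zeta> * \<phi> (x + axis a \<zeta>))" for x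
    have am: "(axis a :: complex \<Rightarrow> complex^'n) \<in> borel_measurable lborel" using axis_meas by simp
    have \<Phi>_smooth: "smooth \<Phi>"
      unfolding \<Phi>_def by (rule smooth_integral_translate(1)[OF \<kappa> am \<phi>_smooth R])
    have d\<phi>: "test_function D (wirtinger_bar i \<phi>)" for i by (rule test_function_wirtinger_bar[OF \<phi>])
    have \<Phi>_wb: "wirtinger_bar i \<Phi> x = (LBINT \<zeta>. \<kappa> \<zeta> * wirtinger_bar i \<phi> (x + axis a \<zeta>))" for i x
      unfolding \<Phi>_def by (rule wirtinger_bar_integral_translate[OF \<kappa> am \<phi>_smooth R])
    have weak0: "(LBINT x. g x * wirtinger_bar i f x) = 0" if "test_function (D - L) f" for f i
      using hol that by (simp add: weakly_holomorphic_on_def)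
    let ?dX = "\<lambda>i. wirtinger_bar i X" and ?d\<Phi> = "\<lambda>i. wirtinger_bar i \<Phi>"
    let ?J = "\<integral>x. g x * (\<phi> x * ?dX j x) \<partial>lborel"
    have gint: "integrable lborel (\<lambda>x. g x * (f x * k x))" if "smooth f" "test_function V k" for f k V
      by (rule integrable_mult_test_function[OF g test_function_mult[OF that]])
    \<comment> \<open>As \<open>(1 - X) * \<phi>\<close> is supported off \<open>L\<close>, it may be tested against \<open>g\<close>.\<close>
    have 1: "(LBINT x. g x * (1 + (-1) * X x) * wirtinger_bar j \<phi> x) = ?J"
    proof -
      have X1: "smooth (\<lambda>x. 1 + (-1) * X x)" by (intro smooth_add smooth_const smooth_cmult X_smooth)
      have d1: "wirtinger_bar j (\<lambda>x. 1 + (-1) * X x) x = - ?dX j x" for x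
      proof -
        have "((\<lambda>x. 1 + (-1) * X x) has_derivative (\<lambda>v. - frechet_derivative X (at x) v)) (at x)"
          by (auto intro!: derivative_eq_intros smooth_has_derivative[OF X_smooth])
        from wirtinger_bar_eq[OF this] show ?thesis by (simp add: wirtinger_bar_def field_simps)
      qed
      have "test_function (D - L) (\<lambda>x. (1 + (-1) * X x) * \<phi> x)"
      proof (rule test_functionI[where S = "closure {x. \<phi> x \<noteq> 0} - N"])
        show "smooth (\<lambda>x. (1 + (-1) * X x) * \<phi> x)" by (rule smooth_mult[OF X1 \<phi>_smooth])
        show "compact (closure {x. \<phi> x \<noteq> 0} - N)" using \<phi> \<eta>(2) by (auto simp: test_function_def intro: compact_diff)
        show "closure {x. \<phi> x \<noteq> 0} - N \<subseteq> D - L" using \<phi> \<eta>(3) by (auto simp: test_function_def)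
        show "(1 + (-1) * X x) * \<phi> x \<noteq> 0 \<Longrightarrow> x \<in> closure {x. \<phi> x \<noteq> 0} - N" for x
          using closure_subset[of "{x. \<phi> x \<noteq> 0}"] \<eta>(4)[of x] by (auto simp: X_def)
      qed
      from weak0[OF this, of j]
      have "(LBINT x. g x * ((1 + (-1) * X x) * wirtinger_bar j \<phi> x) - g x * (\<phi> x * ?dX j x)) = 0"
        unfolding wirtinger_bar_mult[OF X1 \<phi>_smooth] d1 by (simp add: algebra_simps)
      then show ?thesis
        using Bochner_Integration.integral_diff[OF gint[OF X1 d\<phi>] gint[OF \<phi>_smooth dX]] by (simp add: mult.assoc)
    qed
    have 2: "(LBINT x. w x * wirtinger_bar j \<phi> x) = (LBINT x. g x * (?d\<Phi> j x * ?dX a x))"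
    proof -
      obtain E where E: "\<And>x. norm (wirtinger_bar j \<phi> x) \<le> E" using bdd[OF d\<phi>] by blast
      have "(LBINT x. w x * wirtinger_bar j \<phi> x) = (LBINT x. \<omega> x * ?d\<Phi> j x)"
        unfolding w_def \<Phi>_wb
        by (rule convolution_pairing[OF \<kappa> \<omega> axis_meas smooth_meas[OF smooth_wirtinger_bar[OF \<phi>_smooth]] E])
      then show ?thesis by (simp add: \<omega>_def mult_ac)
    qed
    \<comment> \<open>The form \<open>g\<close> dbar \<open>X\<close> is dbar-closed: test \<open>g\<close> against \<open>\<Phi>\<close> times the components of dbar \<open>X\<close>, whose supports avoid \<open>L\<close>.\<close>
    have 3: "(LBINT x. g x * (?d\<Phi> j x * ?dX a x)) = (LBINT x. g x * (?d\<Phi> a x * ?dX j x))"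
    proof -
      have *: "(LBINT x. g x * (\<Phi> x * wirtinger_bar i (?dX k) x)) + (LBINT x. g x * (?d\<Phi> i x * ?dX k x)) = 0" for i k
      proof -
        have "test_function (D - L) (\<lambda>x. \<Phi> x * ?dX k x)" by (rule test_function_mult[OF \<Phi>_smooth dX_D])
        from weak0[OF this, of i]
        have "(LBINT x. g x * (\<Phi> x * wirtinger_bar i (?dX k) x) + g x * (?d\<Phi> i x * ?dX k x)) = 0"
          unfolding wirtinger_bar_mult[OF \<Phi>_smooth smooth_wirtinger_bar[OF X_smooth]] by (simp add: distrib_left)
        then show ?thesis
          using Bochner_Integration.integral_add[OF gint[OF \<Phi>_smooth test_function_wirtinger_bar[OF dX]] gint[OF smooth_wirtinger_bar[OF \<Phi>_smooth] dX]]
          by simp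
      qed
      show ?thesis
        using *[of a j] *[of j a] unfolding wirtinger_bar_commute[OF X_smooth, of a j] by (simp add: add_eq_0_iff2)
    qed
    have 4: "(LBINT x. g x * (?d\<Phi> a x * ?dX j x)) = - ?c * ?J"
    proof -
      have "g x * (?d\<Phi> a x * ?dX j x) = - ?c * (g x * (\<phi> x * ?dX j x))" for x
      proof (cases "x \<in> D")
        case True
        have "?d\<Phi> a x = - ?c * \<phi> x"
          unfolding \<Phi>_wb unfolding \<kappa>_def by (rule cauchy_transform_inverts_wirtinger_bar[OF \<phi> B(1) True])
        then show ?thesis by (simp add: mult_ac)
      next
        case False
        then show ?thesis using test_function_eq_0[OF dX_D, of x j] by simp
      qed
      then show ?thesis by (simp only: integral_mult_right_zero)
    qed
    have "integrable lborel (\<lambda>x. g x * (1 + (-1) * X x) * wirtinger_bar j \<phi> x)"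
      by (rule integrable_mult_test_function[OF v_int d\<phi>])
    moreover have "integrable lborel (\<lambda>x. w x * wirtinger_bar j \<phi> x)"
      by (rule integrable_mult_test_function[OF w_int d\<phi>])
    moreover have "(\<lambda>x. h x * wirtinger_bar j \<phi> x) = (\<lambda>x. g x * (1 + (-1) * X x) * wirtinger_bar j \<phi> x + (w x * wirtinger_bar j \<phi> x) / ?c)"
      by (simp add: h_def fun_eq_iff distrib_right)
    ultimately have "(LBINT x. h x * wirtinger_bar j \<phi> x)
        = (LBINT x. g x * (1 + (-1) * X x) * wirtinger_bar j \<phi> x) + (LBINT x. w x * wirtinger_bar j \<phi> x) / ?c"
      by (simp only:) (subst Bochner_Integration.integral_add, auto)
    also have "\<dots> = 0" unfolding 1 2 3 4 using c by simp
    finally show ?thesis .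
  qed
  have H_D: "weakly_holomorphic_on H D"
    unfolding weakly_holomorphic_on_def
  proof (intro allI impI)
    fix \<phi> j assume \<phi>: "test_function D \<phi>"
    have "H x * wirtinger_bar j \<phi> x = h x * wirtinger_bar j \<phi> x" for x
      using test_function_eq_0[OF test_function_wirtinger_bar[OF \<phi>], of x j] by (cases "x \<in> D") (auto simp: H_def)
    then show "(LBINT x. H x * wirtinger_bar j \<phi> x) = 0" using weak[OF \<phi>] by (simp only:)
  qed
  have D_sets: "D \<in> sets borel" using D(1) by simp
  have H_int: "integrable lborel H"
    unfolding H_def using integrable_mult_indicator[OF _ h_int, of D] D_sets by simp
  have H_meas: "H \<in> borel_measurable borel"
    unfolding H_def using h_meas D_sets by simp
  have H2: "integrable lborel (\<lambda>x. (norm (H x))\<^sup>2)"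
  proof -
    have "(\<lambda>x. (norm (H x))\<^sup>2) = (\<lambda>x. indicator D x *\<^sub>R (norm (h x))\<^sup>2)"
      by (auto simp: H_def indicator_def)
    then show ?thesis using integrable_mult_indicator[OF _ h2, of D] D_sets by simp
  qed
  \<comment> \<open>Moving in the coordinate \<open>a\<close> does not change \<open>l\<close>, so the Cauchy transform at \<open>x\<close> only sees points outside \<open>U\<close>.\<close>
  have H_A: "H x - g x = 0" if x: "x \<in> A" for x
  proof -
    have "x \<notin> U" using x by (auto simp: A_def U_def)
    then have "X x = 0" by (rule test_function_eq_0[OF X_U])
    have "\<omega> (x - axis a \<zeta>) = 0" for \<zeta>
    proof -
      have "(x - axis a \<zeta>) $ b = x $ b" using ab by (simp add: axis_def)
      then have "l (x - axis a \<zeta>) = l x" by (simp add: l_def)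
      then have "x - axis a \<zeta> \<notin> U - L" using x by (simp add: A_def U_def)
      then show ?thesis unfolding \<omega>_def using test_function_eq_0[OF dX] by simp
    qed
    then have "w x = 0" by (simp add: w_def)
    with \<open>X x = 0\<close> show ?thesis using x by (simp add: H_def h_def A_def)
  qed
  have "AE x in lborel. x \<in> D - L \<longrightarrow> H x - g x = 0"
  proof (rule weakly_holomorphic_identity[OF _ _ _ conn open_UA(2) A_ne A_sub])
    show "integrable lborel (\<lambda>x. H x - g x)" using H_int g by simp
    show "open (D - L)" using D(1) L(1) by (simp add: open_Diff compact_imp_closed)
    show "AE x in lborel. x \<in> A \<longrightarrow> H x - g x = 0" using H_A by simp
    show "weakly_holomorphic_on (\<lambda>x. H x - g x) (D - L)"
      unfolding weakly_holomorphic_on_def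
    proof (intro allI impI)
      fix \<phi> j assume \<phi>: "test_function (D - L) \<phi>"
      have "test_function D \<phi>" by (rule test_function_mono[OF \<phi>]) blast
      then have "(LBINT x. H x * wirtinger_bar j \<phi> x) = 0" "(LBINT x. g x * wirtinger_bar j \<phi> x) = 0"
        using H_D hol \<phi> by (auto simp: weakly_holomorphic_on_def)
      moreover have "integrable lborel (\<lambda>x. H x * wirtinger_bar j \<phi> x)" "integrable lborel (\<lambda>x. g x * wirtinger_bar j \<phi> x)"
        using integrable_mult_test_function[OF H_int test_function_wirtinger_bar[OF \<phi>]]
          integrable_mult_test_function[OF g test_function_wirtinger_bar[OF \<phi>]] by auto
      ultimately show "(LBINT x. (H x - g x) * wirtinger_bar j \<phi> x) = 0"
        by (simp add: left_diff_distrib)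
    qed
  qed
  then have "AE x in lborel. x \<in> D - L \<longrightarrow> H x = g x" by simp
  then show ?thesis using that H_meas H_int H2 H_D by blast
qed

section \<open>Square-integrable forms\<close>

lemma sets_lebesgue_open: "open U \<Longrightarrow> U \<in> sets lebesgue"
  by simp

lemma L2_measurable: "f \<in> L2 U \<Longrightarrow> f \<in> borel_measurable (lebesgue_on U)"
  and L2_integrable: "f \<in> L2 U \<Longrightarrow> integrable (lebesgue_on U) (\<lambda>z. (norm (f z))\<^sup>2)"
  by (auto simp: L2_def)

lemma L2I:
  assumes "f \<in> borel_measurable (lebesgue_on U)" and "integrable (lebesgue_on U) b"
    and "\<And>z. (norm (f z))\<^sup>2 \<le> b z"
  shows "f \<in> L2 U"
proof -
  have "integrable (lebesgue_on U) (\<lambda>z. (norm (f z))\<^sup>2)"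
  proof (rule Bochner_Integration.integrable_bound[OF assms(2)])
    show "(\<lambda>z. (norm (f z))\<^sup>2) \<in> borel_measurable (lebesgue_on U)" using assms(1) by simp
    show "AE z in lebesgue_on U. norm ((norm (f z))\<^sup>2) \<le> norm (b z)"
      using assms(3) by (intro AE_I2) (simp add: order_trans[OF _ abs_ge_self])
  qed
  then show ?thesis using assms(1) by (simp add: L2_def)
qed

lemma L2_zero: "(\<lambda>z. 0) \<in> L2 U"
  by (simp add: L2_def)

lemma L2_add: "f \<in> L2 U \<Longrightarrow> g \<in> L2 U \<Longrightarrow> (\<lambda>z. f z + g z) \<in> L2 U"
  by (auto simp: L2_def intro!: square_integrable_add borel_measurable_add)

lemma L2_minus:
  assumes "f \<in> L2 U" shows "(\<lambda>z. - f z) \<in> L2 U"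
  using assms by (simp add: L2_def)

lemma L2_diff: "f \<in> L2 U \<Longrightarrow> g \<in> L2 U \<Longrightarrow> (\<lambda>z. f z - g z) \<in> L2 U"
  using L2_add[of f U "\<lambda>z. - g z"] L2_minus[of g U] by simp

lemma L2_norm_minus: "L2_norm U (\<lambda>z. f z - g z) = L2_norm U (\<lambda>z. g z - f z)"
  by (simp add: L2_norm_def norm_minus_commute)

lemma L2_norm_triangle:
  assumes "f \<in> L2 U" and "g \<in> L2 U"
  shows "L2_norm U (\<lambda>z. f z + g z) \<le> L2_norm U f + L2_norm U g"
proof -
  let ?M = "lebesgue_on U"
  let ?P = "\<integral>z. (norm (f z))\<^sup>2 \<partial>?M" and ?Q = "\<integral>z. (norm (g z))\<^sup>2 \<partial>?M" and ?I = "\<integral>z. norm (f z) * norm (g z) \<partial>?M"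
  have meas: "(\<lambda>z. norm (f z)) \<in> borel_measurable ?M" "(\<lambda>z. norm (g z)) \<in> borel_measurable ?M"
    using assms[THEN L2_measurable] by simp_all
  note int = assms[THEN L2_integrable]
  note CS = Cauchy_Schwarz_integral[OF meas int]
  have "(\<integral>z. (norm (f z + g z))\<^sup>2 \<partial>?M) \<le> (\<integral>z. (norm (f z))\<^sup>2 + 2 * (norm (f z) * norm (g z)) + (norm (g z))\<^sup>2 \<partial>?M)"
  proof (rule integral_mono)
    show "integrable ?M (\<lambda>z. (norm (f z + g z))\<^sup>2)" by (rule L2_integrable[OF L2_add[OF assms]])
    show "integrable ?M (\<lambda>z. (norm (f z))\<^sup>2 + 2 * (norm (f z) * norm (g z)) + (norm (g z))\<^sup>2)"
      using int CS(1) by simp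
    fix z
    have "(norm (f z + g z))\<^sup>2 \<le> (norm (f z) + norm (g z))\<^sup>2"
      by (intro power_mono norm_triangle_ineq) simp
    then show "(norm (f z + g z))\<^sup>2 \<le> (norm (f z))\<^sup>2 + 2 * (norm (f z) * norm (g z)) + (norm (g z))\<^sup>2"
      by (simp add: power2_sum)
  qed
  also have "\<dots> = ?P + 2 * ?I + ?Q" using int CS(1) by simp
  also have "\<dots> \<le> ?P + 2 * (sqrt ?P * sqrt ?Q) + ?Q"
  proof -
    have "?I \<le> sqrt (?P * ?Q)" by (rule real_le_rsqrt[OF CS(2)])
    then show ?thesis by (simp add: real_sqrt_mult)
  qed
  also have "\<dots> = (sqrt ?P + sqrt ?Q)\<^sup>2" by (simp add: power2_sum)
  finally have le: "(\<integral>z. (norm (f z + g z))\<^sup>2 \<partial>?M) \<le> (sqrt ?P + sqrt ?Q)\<^sup>2" .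
  show ?thesis
    unfolding L2_norm_def using le by (intro real_le_lsqrt) auto
qed

lemma L2_subset:
  assumes "open U" "open V" "V \<subseteq> U" and "f \<in> L2 U"
  shows "f \<in> L2 V" and "L2_norm V f \<le> L2_norm U f"
proof -
  have restr: "lebesgue_on V = restrict_space (lebesgue_on U) V"
    using assms(3) by (simp add: restrict_restrict_space assms inf.absorb2)
  have V: "V \<inter> space (lebesgue_on U) \<in> sets (lebesgue_on U)"
    using assms by (simp add: sets_restrict_space inf.absorb1) (metis image_eqI inf.absorb_iff2 sets_lebesgue_open)
  have meas: "f \<in> borel_measurable (lebesgue_on V)"
    unfolding restr using L2_measurable[OF assms(4)] by (rule measurable_restrict_space1)
  have int: "integrable (lebesgue_on V) (\<lambda>z. (norm (f z))\<^sup>2)"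
    unfolding restr integrable_restrict_space[OF V]
    using integrable_mult_indicator[OF _ L2_integrable[OF assms(4)], of V] V assms(3) by (simp add: inf.absorb1)
  show "f \<in> L2 V" using meas int by (simp add: L2_def)
  have "(\<integral>z. (norm (f z))\<^sup>2 \<partial>lebesgue_on V) = (\<integral>z. indicator V z *\<^sub>R (norm (f z))\<^sup>2 \<partial>lebesgue_on U)"
    unfolding restr by (rule integral_restrict_space[OF V])
  also have "\<dots> \<le> (\<integral>z. (norm (f z))\<^sup>2 \<partial>lebesgue_on U)"
  proof (rule integral_mono)
    show "integrable (lebesgue_on U) (\<lambda>z. indicator V z *\<^sub>R (norm (f z))\<^sup>2)"
      using int unfolding restr integrable_restrict_space[OF V] .
  qed (auto simp: L2_integrable[OF assms(4)] indicator_def)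
  finally show "L2_norm V f \<le> L2_norm U f" by (simp add: L2_norm_def)
qed

lemma distr_subset:
  assumes "open U" "open V" "V \<subseteq> U" and "\<And>x. x \<notin> V \<Longrightarrow> \<phi> x = 0"
  shows "distr V u \<phi> = distr U u \<phi>"
proof -
  have eq: "distr W u \<phi> = (\<integral>z. indicator W z *\<^sub>R (u z * \<phi> z) \<partial>lebesgue)" if "open W" for W
    unfolding distr_def using that by (subst integral_restrict_space) auto
  have ind: "indicator V z *\<^sub>R (u z * \<phi> z) = indicator U z *\<^sub>R (u z * \<phi> z)" for z
    using assms(3,4) by (auto simp: indicator_def)
  show ?thesis by (simp only: eq[OF assms(1)] eq[OF assms(2)] ind)
qed

lemma distr_dbar_subset:
  assumes "open U" "open V" "V \<subseteq> U" and "test_function V \<phi>"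
  shows "distr_dbar V k u \<phi> = distr_dbar U k u \<phi>"
  unfolding distr_dbar_def
  using distr_subset[OF assms(1-3) test_function_eq_0[OF test_function_wirtinger_bar[OF assms(4)]]] by simp

lemma dbar_eq_subset:
  assumes "open U" "open V" "V \<subseteq> U" and "dbar_eq U g f"
  shows "dbar_eq V g f"
  unfolding dbar_eq_def
proof (intro allI impI)
  fix \<phi> k assume \<phi>: "test_function V \<phi>"
  have "distr V (\<lambda>z. f z $ k) \<phi> = distr U (\<lambda>z. f z $ k) \<phi>"
    by (rule distr_subset[OF assms(1-3) test_function_eq_0[OF \<phi>]])
  then show "distr_dbar V k g \<phi> = distr V (\<lambda>z. f z $ k) \<phi>"
    using assms(4) test_function_mono[OF \<phi> assms(3)] distr_dbar_subset[OF assms(1-3) \<phi>]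
    by (simp add: dbar_eq_def)
qed

lemma dbar_exact_subset:
  assumes "open U" "open V" "V \<subseteq> U" and "f \<in> dbar_exact U"
  shows "f \<in> dbar_exact V"
proof -
  obtain g where "f \<in> L2 U" "g \<in> L2 U" "dbar_eq U g f" using assms(4) by (auto simp: dbar_exact_def)
  then have "f \<in> L2 V" "g \<in> L2 V" "dbar_eq V g f"
    using L2_subset(1)[OF assms(1-3)] dbar_eq_subset[OF assms(1-3)] by simp_all
  then show ?thesis by (auto simp: dbar_exact_def)
qed

lemma dbar_closed_subset:
  assumes "open U" "open V" "V \<subseteq> U" and "f \<in> dbar_closed U"
  shows "f \<in> dbar_closed V"
  using assms(4) L2_subset(1)[OF assms(1-3)] test_function_mono[OF _ assms(3)] distr_dbar_subset[OF assms(1-3)]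
  unfolding dbar_closed_def by (auto)

lemma L2_mult_test_integrable:
  assumes "open U" and u: "u \<in> L2 U" and \<phi>: "test_function V \<phi>"
  shows "integrable (lebesgue_on U) (\<lambda>z. u z * \<phi> z)"
proof (rule Bochner_Integration.integrable_bound)
  have cont: "continuous_on UNIV \<phi>" by (rule smooth_continuous[OF test_function_smooth[OF \<phi>]])
  obtain R where R: "\<And>x. norm x \<ge> R \<Longrightarrow> \<phi> x = 0" using test_function_vanishing[OF \<phi>] by blast
  have \<phi>_meas: "\<phi> \<in> borel_measurable (lebesgue_on U)"
    using continuous_imp_measurable_on_sets_lebesgue[OF continuous_on_subset[OF cont subset_UNIV]] assms(1) by simp
  have "integrable lborel (\<lambda>z. \<phi> z * cnj (\<phi> z))"
    by (rule integrable_continuous_vanishing[where R = R]) (auto intro!: continuous_intros cont simp: R)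
  then have "integrable lborel (\<lambda>z. norm (\<phi> z * cnj (\<phi> z)))" by (rule integrable_norm)
  then have "integrable lebesgue (\<lambda>z. (norm (\<phi> z))\<^sup>2)"
    using borel_measurable_continuous_onI[OF cont] by (simp add: norm_mult power2_eq_square integrable_completion)
  then have "integrable (lebesgue_on U) (\<lambda>z. (norm (\<phi> z))\<^sup>2)"
    using integrable_mult_indicator[of U lebesgue "\<lambda>z. (norm (\<phi> z))\<^sup>2"] assms(1)
    by (subst integrable_restrict_space) auto
  then show "integrable (lebesgue_on U) (\<lambda>z. (norm (u z))\<^sup>2 + (norm (\<phi> z))\<^sup>2)"
    using L2_integrable[OF u] by simp
  show "(\<lambda>z. u z * \<phi> z) \<in> borel_measurable (lebesgue_on U)"
    using L2_measurable[OF u] \<phi>_meas by simp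
  show "AE z in lebesgue_on U. norm (u z * \<phi> z) \<le> norm ((norm (u z))\<^sup>2 + (norm (\<phi> z))\<^sup>2)"
    using abs_mult_le_power2_sum[of "norm (u _)" "norm (\<phi> _)"] by (intro AE_I2) (simp add: norm_mult)
qed

lemma L2_component:
  fixes f :: "'a::euclidean_space \<Rightarrow> complex^'n"
  assumes "f \<in> L2 U" shows "(\<lambda>z. f z $ k) \<in> L2 U"
proof (rule L2I[OF _ L2_integrable[OF assms]])
  have "(\<lambda>v :: complex^'n. v $ k) \<in> borel_measurable borel"
    by (intro borel_measurable_continuous_onI continuous_intros)
  from measurable_compose[OF L2_measurable[OF assms] this]
  show "(\<lambda>z. f z $ k) \<in> borel_measurable (lebesgue_on U)" .
  show "(norm (f z $ k))\<^sup>2 \<le> (norm (f z))\<^sup>2" for z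
    by (intro power_mono Finite_Cartesian_Product.norm_nth_le) simp
qed

lemma distr_diff:
  assumes "open U" "u \<in> L2 U" "v \<in> L2 U" "test_function V \<phi>"
  shows "distr U (\<lambda>z. u z - v z) \<phi> = distr U u \<phi> - distr U v \<phi>"
  unfolding distr_def
  using L2_mult_test_integrable[OF assms(1,2,4)] L2_mult_test_integrable[OF assms(1,3,4)] by (simp add: left_diff_distrib)

lemma dbar_closed_diff:
  assumes "open U" and "f \<in> dbar_closed U" and "g \<in> dbar_closed U"
  shows "(\<lambda>z. f z - g z) \<in> dbar_closed U"
proof -
  have L2: "f \<in> L2 U" "g \<in> L2 U" using assms by (auto simp: dbar_closed_def)
  have "distr_dbar U j (\<lambda>z. (f z - g z) $ k) \<phi> = distr_dbar U j (\<lambda>z. f z $ k) \<phi> - distr_dbar U j (\<lambda>z. g z $ k) \<phi>"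
    if "test_function U \<phi>" for \<phi> j k
    using distr_diff[OF assms(1) L2_component[OF L2(1)] L2_component[OF L2(2)] test_function_wirtinger_bar[OF that], of k k j]
    by (simp add: distr_dbar_def)
  then show ?thesis using assms(2,3) L2_diff[OF L2] by (auto simp: dbar_closed_def)
qed

lemma dbar_exact_diff:
  assumes "open U" and "f \<in> dbar_exact U" and "g \<in> dbar_exact U"
  shows "(\<lambda>z. f z - g z) \<in> dbar_exact U"
proof -
  obtain u v where u: "f \<in> L2 U" "u \<in> L2 U" "dbar_eq U u f" and v: "g \<in> L2 U" "v \<in> L2 U" "dbar_eq U v g"
    using assms(2,3) by (auto simp: dbar_exact_def)
  have "dbar_eq U (\<lambda>z. u z - v z) (\<lambda>z. f z - g z)"
    unfolding dbar_eq_def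
  proof (intro allI impI)
    fix \<phi> k assume \<phi>: "test_function U \<phi>"
    have "distr_dbar U k (\<lambda>z. u z - v z) \<phi> = distr_dbar U k u \<phi> - distr_dbar U k v \<phi>"
      using distr_diff[OF assms(1) u(2) v(2) test_function_wirtinger_bar[OF \<phi>], of k] by (simp add: distr_dbar_def)
    then show "distr_dbar U k (\<lambda>z. u z - v z) \<phi> = distr U (\<lambda>z. (f z - g z) $ k) \<phi>"
      using distr_diff[OF assms(1) L2_component[OF u(1)] L2_component[OF v(1)] \<phi>, of k k] u(3) v(3) \<phi>
      by (simp add: dbar_eq_def)
  qed
  then show ?thesis using L2_diff[OF u(1) v(1)] L2_diff[OF u(2) v(2)] by (auto simp: dbar_exact_def)
qed

lemma dbar_zero: "(\<lambda>z. 0) \<in> dbar_closed U" "(\<lambda>z. 0) \<in> dbar_exact U"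
proof -
  show "(\<lambda>z. 0) \<in> dbar_closed U" by (simp add: dbar_closed_def L2_zero distr_dbar_def distr_def)
  have "dbar_eq U (\<lambda>z. 0) (\<lambda>z. 0)" by (simp add: dbar_eq_def distr_dbar_def distr_def)
  then show "(\<lambda>z. 0) \<in> dbar_exact U"
    by (auto simp: dbar_exact_def L2_zero intro!: bexI[of _ "\<lambda>z. 0"])
qed

section \<open>Hausdorff cohomology and closed range\<close>

text \<open>
  The approximants are taken in the intersection because this is the fibre of the quotient map over
  the class of 0.
\<close>

definition exact_forms_closed :: "(complex^'n) set \<Rightarrow> bool" where
  "exact_forms_closed U \<longleftrightarrow> (\<forall>f\<in>dbar_closed U.
     (\<forall>e>0. \<exists>g\<in>dbar_closed U \<inter> dbar_exact U. L2_norm U (\<lambda>z. g z - f z) < e) \<longrightarrow> f \<in> dbar_exact U)"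

lemma cohomology_class_eq_iff:
  assumes "open U" and "f \<in> dbar_closed U" and "g \<in> dbar_closed U"
  shows "cohomology_class U f = cohomology_class U g \<longleftrightarrow> (\<lambda>z. f z - g z) \<in> dbar_exact U"
proof
  assume eq: "cohomology_class U f = cohomology_class U g"
  have "f \<in> cohomology_class U f" using assms(2) dbar_zero(2) by (simp add: cohomology_class_def)
  with eq show "(\<lambda>z. f z - g z) \<in> dbar_exact U" by (simp add: cohomology_class_def)
next
  assume ex: "(\<lambda>z. f z - g z) \<in> dbar_exact U"
  have ex': "(\<lambda>z. g z - f z) \<in> dbar_exact U"
    using dbar_exact_diff[OF assms(1) dbar_zero(2) ex] by simp
  have "(\<lambda>z. h z - f z) \<in> dbar_exact U \<longleftrightarrow> (\<lambda>z. h z - g z) \<in> dbar_exact U" for h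
    using dbar_exact_diff[OF assms(1) _ ex, of "\<lambda>z. h z - g z"] dbar_exact_diff[OF assms(1) _ ex', of "\<lambda>z. h z - f z"] by auto
  then show "cohomology_class U f = cohomology_class U g" by (auto simp: cohomology_class_def)
qed

lemma topspace_closed_forms: "topspace (subtopology (L2_topology U) (dbar_closed U)) = dbar_closed U"
  by (auto simp: topspace_L2_topology dbar_closed_def)

lemma topspace_cohomology: "topspace (L2_cohomology_01 U) = cohomology_class U ` dbar_closed U"
  by (simp only: L2_cohomology_01_def topspace_quotient_topology topspace_closed_forms)

lemma openin_cohomology:
  "openin (L2_cohomology_01 U) V \<longleftrightarrow> V \<subseteq> cohomology_class U ` dbar_closed U \<and>
     openin (subtopology (L2_topology U) (dbar_closed U)) {f \<in> dbar_closed U. cohomology_class U f \<in> V}"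
  by (simp only: L2_cohomology_01_def openin_quotient_topology topspace_closed_forms)

text \<open>
  The subspace topology asks for an open set of the whole space that cuts out \<open>S\<close>: the union of the balls
  provided by the hypothesis.
\<close>

lemma openin_closed_formsI:
  assumes "S \<subseteq> dbar_closed U"
    and "\<And>f. f \<in> S \<Longrightarrow> \<exists>e>0. \<forall>g\<in>dbar_closed U. L2_norm U (\<lambda>z. g z - f z) < e \<longrightarrow> g \<in> S"
  shows "openin (subtopology (L2_topology U) (dbar_closed U)) S"
proof -
  let ?T = "{h \<in> L2 U. \<exists>f\<in>S. \<exists>e>0. L2_norm U (\<lambda>z. h z - f z) < e \<and> (\<forall>g\<in>dbar_closed U. L2_norm U (\<lambda>z. g z - f z) < e \<longrightarrow> g \<in> S)}"
  have S_L2: "S \<subseteq> L2 U" using assms(1) by (auto simp: dbar_closed_def)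
  have "openin (L2_topology U) ?T"
    unfolding openin_L2_topology
  proof (intro conjI ballI)
    fix h assume "h \<in> ?T"
    then obtain f e where h: "h \<in> L2 U" "f \<in> S" "L2_norm U (\<lambda>z. h z - f z) < e"
      "\<forall>g\<in>dbar_closed U. L2_norm U (\<lambda>z. g z - f z) < e \<longrightarrow> g \<in> S" "e > 0" by blast
    have "g \<in> ?T" if g: "g \<in> L2 U" "L2_norm U (\<lambda>z. g z - h z) < e - L2_norm U (\<lambda>z. h z - f z)" for g
    proof -
      have "L2_norm U (\<lambda>z. g z - f z) \<le> L2_norm U (\<lambda>z. g z - h z) + L2_norm U (\<lambda>z. h z - f z)"
        using L2_norm_triangle[OF L2_diff[OF g(1) h(1)] L2_diff[OF h(1), of f]] h(2) S_L2 by auto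
      then have "L2_norm U (\<lambda>z. g z - f z) < e" using g(2) by linarith
      then show ?thesis using g(1) h(2,4,5) by blast
    qed
    then show "\<exists>e>0. \<forall>g\<in>L2 U. L2_norm U (\<lambda>z. g z - h z) < e \<longrightarrow> g \<in> ?T"
      using h(3) by (intro exI[of _ "e - L2_norm U (\<lambda>z. h z - f z)"]) auto
  qed auto
  moreover have "S = ?T \<inter> dbar_closed U"
  proof
    show "?T \<inter> dbar_closed U \<subseteq> S" by blast
    show "S \<subseteq> ?T \<inter> dbar_closed U"
    proof
      fix f assume f: "f \<in> S"
      obtain e where e: "e > 0" "\<forall>g\<in>dbar_closed U. L2_norm U (\<lambda>z. g z - f z) < e \<longrightarrow> g \<in> S"
        using assms(2)[OF f] by blast
      have "L2_norm U (\<lambda>z. f z - f z) < e" using e(1) by (simp add: L2_norm_def)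
      then show "f \<in> ?T \<inter> dbar_closed U" using f e S_L2 assms(1) by blast
    qed
  qed
  ultimately show ?thesis unfolding openin_subtopology by blast
qed

text \<open>
  If the class of \<open>f\<close> is not zero, an open set separates it from zero. Its preimage contains a ball
  around \<open>f\<close>, and this ball contains no exact closed form.
\<close>

lemma Hausdorff_imp_exact_forms_closed:
  assumes U: "open U" and H: "Hausdorff_space (L2_cohomology_01 U)"
  shows "exact_forms_closed U"
  unfolding exact_forms_closed_def
proof (intro ballI impI)
  let ?X = "subtopology (L2_topology U) (dbar_closed U)" and ?q = "cohomology_class U"
  fix f assume f: "f \<in> dbar_closed U"
    and approx: "\<forall>e>0. \<exists>g\<in>dbar_closed U \<inter> dbar_exact U. L2_norm U (\<lambda>z. g z - f z) < e"
  show "f \<in> dbar_exact U"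
  proof (rule ccontr)
    assume nf: "f \<notin> dbar_exact U"
    have top: "?q f \<in> topspace (L2_cohomology_01 U)" "?q (\<lambda>z. 0) \<in> topspace (L2_cohomology_01 U)"
      unfolding topspace_cohomology by (rule imageI[OF f], rule imageI[OF dbar_zero(1)])
    have "?q f \<noteq> ?q (\<lambda>z. 0)" using nf cohomology_class_eq_iff[OF U f dbar_zero(1)] by simp
    then obtain V W where VW: "openin (L2_cohomology_01 U) V" "?q f \<in> V" "?q (\<lambda>z. 0) \<in> W" "disjnt V W"
      using H[unfolded Hausdorff_space_def, rule_format, of "?q f" "?q (\<lambda>z. 0)"] top by blast
    have "openin ?X {x \<in> dbar_closed U. ?q x \<in> V}"
      using VW(1) unfolding openin_cohomology by blast
    then obtain T where T: "openin (L2_topology U) T" "{x \<in> dbar_closed U. ?q x \<in> V} = T \<inter> dbar_closed U"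
      unfolding openin_subtopology by blast
    have "f \<in> T" using T(2) f VW(2) by blast
    then obtain e where e: "e > 0" "\<And>g. g \<in> L2 U \<Longrightarrow> L2_norm U (\<lambda>z. g z - f z) < e \<Longrightarrow> g \<in> T"
      using T(1) unfolding openin_L2_topology by blast
    obtain g where g: "g \<in> dbar_closed U" "g \<in> dbar_exact U" "L2_norm U (\<lambda>z. g z - f z) < e"
      using approx e(1) by blast
    have "g \<in> T" using g by (intro e(2)) (auto simp: dbar_closed_def)
    then have "?q g \<in> V" using T(2) g(1) by blast
    moreover have "?q g = ?q (\<lambda>z. 0)" using cohomology_class_eq_iff[OF U g(1) dbar_zero(1)] g(2) by simp
    ultimately show False using VW(3,4) by (auto simp: disjnt_def)
  qed
qed

text \<open>
  If the classes of \<open>f\<close> and \<open>g\<close> differ, then \<open>f - g\<close> has a positive distance \<open>e\<close> from the exact closed forms,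
  and the balls of radius \<open>e / 2\<close> around \<open>f\<close> and \<open>g\<close>, saturated by the exact closed forms, have disjoint images.
\<close>

lemma exact_forms_closed_imp_Hausdorff:
  assumes U: "open U" and cl: "exact_forms_closed U"
  shows "Hausdorff_space (L2_cohomology_01 U)"
  unfolding Hausdorff_space_def
proof (intro allI impI)
  let ?X = "subtopology (L2_topology U) (dbar_closed U)" and ?q = "cohomology_class U"
  fix a b assume ab: "a \<in> topspace (L2_cohomology_01 U) \<and> b \<in> topspace (L2_cohomology_01 U) \<and> a \<noteq> b"
  then obtain f g where f: "f \<in> dbar_closed U" "a = ?q f" and g: "g \<in> dbar_closed U" "b = ?q g"
    unfolding topspace_cohomology by blast
  have fg: "(\<lambda>z. f z - g z) \<in> dbar_closed U" "(\<lambda>z. f z - g z) \<notin> dbar_exact U"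
    using dbar_closed_diff[OF U f(1) g(1)] cohomology_class_eq_iff[OF U f(1) g(1)] ab f(2) g(2) by auto
  let ?E = "dbar_closed U \<inter> dbar_exact U"
  have L2: "h \<in> L2 U" if "h \<in> dbar_closed U" for h using that by (simp add: dbar_closed_def)
  obtain e where e: "e > 0" "\<And>x. x \<in> ?E \<Longrightarrow> L2_norm U (\<lambda>z. x z - (f z - g z)) \<ge> e"
    using cl fg unfolding exact_forms_closed_def by (meson not_le)
  define B where "B p = {h \<in> dbar_closed U. \<exists>x\<in>?E. L2_norm U (\<lambda>z. h z - p z - x z) < e / 2}" for p
  have B_open: "openin ?X (B p)" if p: "p \<in> dbar_closed U" for p
  proof (rule openin_closed_formsI)
    fix h assume "h \<in> B p"
    then obtain x where h: "h \<in> dbar_closed U" "x \<in> ?E" "L2_norm U (\<lambda>z. h z - p z - x z) < e / 2"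
      by (auto simp: B_def)
    have "k \<in> B p" if k: "k \<in> dbar_closed U" "L2_norm U (\<lambda>z. k z - h z) < e / 2 - L2_norm U (\<lambda>z. h z - p z - x z)" for k
    proof -
      have "L2_norm U (\<lambda>z. (k z - h z) + (h z - p z - x z)) \<le> L2_norm U (\<lambda>z. k z - h z) + L2_norm U (\<lambda>z. h z - p z - x z)"
        using h k p by (intro L2_norm_triangle L2_diff L2) auto
      moreover have "(\<lambda>z. (k z - h z) + (h z - p z - x z)) = (\<lambda>z. k z - p z - x z)" by (simp add: fun_eq_iff)
      ultimately have "L2_norm U (\<lambda>z. k z - p z - x z) < e / 2" using k(2) by simp
      then show ?thesis using k(1) h(2) by (auto simp: B_def)
    qed
    then show "\<exists>d>0. \<forall>k\<in>dbar_closed U. L2_norm U (\<lambda>z. k z - h z) < d \<longrightarrow> k \<in> B p"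
      using h(3) by (intro exI[of _ "e / 2 - L2_norm U (\<lambda>z. h z - p z - x z)"]) auto
  qed (auto simp: B_def)
  have B_sat: "k \<in> B p" if "h \<in> B p" "k \<in> dbar_closed U" "?q k = ?q h" for h k p
  proof -
    obtain x where h: "h \<in> dbar_closed U" "x \<in> ?E" "L2_norm U (\<lambda>z. h z - p z - x z) < e / 2"
      using \<open>h \<in> B p\<close> by (auto simp: B_def)
    have hk: "(\<lambda>z. h z - k z) \<in> ?E"
      using cohomology_class_eq_iff[OF U h(1) that(2)] that(3) dbar_closed_diff[OF U h(1) that(2)] by simp
    have "(\<lambda>z. x z - (h z - k z)) \<in> ?E"
      using dbar_closed_diff[OF U, of x "\<lambda>z. h z - k z"] dbar_exact_diff[OF U, of x "\<lambda>z. h z - k z"] h(2) hk by blast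
    moreover have "(\<lambda>z. k z - p z - (x z - (h z - k z))) = (\<lambda>z. h z - p z - x z)" by auto
    ultimately show ?thesis using that(2) h(3) unfolding B_def by force
  qed
  have opn: "openin (L2_cohomology_01 U) (?q ` B p)" if p: "p \<in> dbar_closed U" for p
  proof -
    have sub: "B p \<subseteq> dbar_closed U" by (auto simp: B_def)
    have "{x \<in> dbar_closed U. ?q x \<in> ?q ` B p} = B p"
      using B_sat sub by blast
    then show ?thesis
      unfolding openin_cohomology using B_open[OF p] sub by (simp add: image_mono)
  qed
  have mem: "p \<in> B p" if "p \<in> dbar_closed U" for p
    using that e(1) dbar_zero by (auto simp: B_def L2_norm_def intro!: bexI[of _ "\<lambda>z. 0"])
  have "disjnt (?q ` B f) (?q ` B g)"
  proof (rule ccontr)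
    assume "\<not> disjnt (?q ` B f) (?q ` B g)"
    then obtain h k where hk: "h \<in> B f" "k \<in> B g" "?q h = ?q k" by (auto simp: disjnt_def)
    have "h \<in> B g" by (rule B_sat[OF hk(2) _ hk(3)]) (use hk(1) in \<open>simp add: B_def\<close>)
    obtain x where x: "h \<in> dbar_closed U" "x \<in> ?E" "L2_norm U (\<lambda>z. h z - f z - x z) < e / 2"
      using hk(1) by (auto simp: B_def)
    obtain y where y: "y \<in> ?E" "L2_norm U (\<lambda>z. h z - g z - y z) < e / 2"
      using \<open>h \<in> B g\<close> by (auto simp: B_def)
    have yx: "(\<lambda>z. y z - x z) \<in> ?E"
      using dbar_closed_diff[OF U, of y x] dbar_exact_diff[OF U, of y x] x(2) y(1) by blast
    have "L2_norm U (\<lambda>z. (h z - f z - x z) + (g z + y z - h z)) \<le> L2_norm U (\<lambda>z. h z - f z - x z) + L2_norm U (\<lambda>z. g z + y z - h z)"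
      using x y f(1) g(1) by (intro L2_norm_triangle L2_diff L2_add L2) auto
    also have "L2_norm U (\<lambda>z. g z + y z - h z) = L2_norm U (\<lambda>z. h z - (g z + y z))" by (rule L2_norm_minus)
    also have "(\<lambda>z. h z - (g z + y z)) = (\<lambda>z. h z - g z - y z)" by (simp add: diff_diff_add)
    also have "(\<lambda>z. (h z - f z - x z) + (g z + y z - h z)) = (\<lambda>z. (y z - x z) - (f z - g z))" by auto
    finally have "L2_norm U (\<lambda>z. (y z - x z) - (f z - g z)) < e" using x(3) y(2) by linarith
    then show False using e(2)[OF yx] by linarith
  qed
  then show "\<exists>V W. openin (L2_cohomology_01 U) V \<and> openin (L2_cohomology_01 U) W \<and> a \<in> V \<and> b \<in> W \<and> disjnt V W"
    using opn[OF f(1)] opn[OF g(1)] mem[OF f(1)] mem[OF g(1)] f(2) g(2) by blast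
qed

section \<open>Borel representatives\<close>

text \<open>
  Fubini's theorem and the convolutions above are about Borel functions on the whole space, whereas
  forms are only Lebesgue measurable and their values outside \<open>U\<close> are arbitrary.
\<close>

lemma L2_borel_representative:
  fixes u :: "complex^'n \<Rightarrow> complex"
  assumes U: "open U" "bounded U" and u: "u \<in> L2 U"
  obtains g where "g \<in> borel_measurable borel" "AE x in lborel. x \<in> U \<longrightarrow> g x = u x"
    "integrable lborel g" "integrable lborel (\<lambda>x. (norm (g x))\<^sup>2)"
    "\<forall>\<psi>\<in>borel_measurable borel. (LBINT x. g x * \<psi> x) = distr U u \<psi>"
proof -
  define u0 where "u0 x = (if x \<in> U then u x else 0)" for x
  have U_sets: "U \<in> sets borel" "U \<in> sets lebesgue" using U(1) by auto
  have u0_meas: "u0 \<in> borel_measurable lebesgue"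
    unfolding u0_def using borel_measurable_if[OF U_sets(2), of u] L2_measurable[OF u] by simp
  have "(\<lambda>x. Re (u0 x)) \<in> borel_measurable lebesgue" "(\<lambda>x. Im (u0 x)) \<in> borel_measurable lebesgue"
    using u0_meas by measurable
  from this[THEN completion_ex_borel_measurable_real]
  obtain r i where ri: "r \<in> borel_measurable lborel" "i \<in> borel_measurable lborel"
    "AE x in lborel. Re (u0 x) = r x" "AE x in lborel. Im (u0 x) = i x" by blast
  define g where "g x = indicator U x *\<^sub>R (complex_of_real (r x) + \<i> * complex_of_real (i x))" for x
  have g_meas: "g \<in> borel_measurable borel"
    unfolding g_def using ri(1,2) U_sets(1) by simp
  have g_leb: "g \<in> borel_measurable lebesgue" using g_meas by (intro measurable_completion) simp
  have AE_g: "AE x in lborel. g x = u0 x"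
    using ri(3,4)
  proof eventually_elim
    case (elim x)
    then show ?case by (cases "x \<in> U") (auto simp: g_def u0_def complex_eq_iff)
  qed
  have AE_leb: "AE x in lebesgue. g x = u0 x" using AE_g by (rule AE_completion)
  have "integrable lebesgue (\<lambda>x. (norm (u0 x))\<^sup>2)"
  proof -
    have "(\<lambda>x. (norm (u0 x))\<^sup>2) = (\<lambda>x. if x \<in> U then (norm (u x))\<^sup>2 else 0)" by (auto simp: u0_def)
    then show ?thesis using Lebesgue_Measure.integrable_restrict_UNIV[OF U_sets(2), of "\<lambda>x. (norm (u x))\<^sup>2"] L2_integrable[OF u] by simp
  qed
  then have "integrable lebesgue (\<lambda>x. (norm (g x))\<^sup>2)"
  proof (rule integrable_cong_AE_imp)
    show "(\<lambda>x. (norm (g x))\<^sup>2) \<in> borel_measurable lebesgue" using g_leb by simp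
    show "AE x in lebesgue. (norm (u0 x))\<^sup>2 = (norm (g x))\<^sup>2" using AE_leb by eventually_elim simp
  qed
  then have g2: "integrable lborel (\<lambda>x. (norm (g x))\<^sup>2)"
    using g_meas by (subst (asm) integrable_completion) auto
  have g_int: "integrable lborel g"
  proof (rule Bochner_Integration.integrable_bound)
    show "integrable lborel (\<lambda>x. indicator U x + (norm (g x))\<^sup>2 :: real)"
      using g2 U_sets(1) emeasure_bounded_finite[OF U(2)] by (intro Bochner_Integration.integrable_add integrable_real_indicator) auto
    show "g \<in> borel_measurable lborel" using g_meas by simp
    show "AE x in lborel. norm (g x) \<le> norm (indicator U x + (norm (g x))\<^sup>2 :: real)"
    proof (intro AE_I2)
      fix x
      have "2 * norm (g x) \<le> 1 + (norm (g x))\<^sup>2"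
        using zero_le_power2[of "norm (g x) - 1"] unfolding power2_diff by simp
      then have "norm (g x) \<le> 1 + (norm (g x))\<^sup>2"
        using norm_ge_zero[of "g x"] by linarith
      then show "norm (g x) \<le> norm (indicator U x + (norm (g x))\<^sup>2 :: real)"
        by (cases "x \<in> U") (auto simp: g_def)
    qed
  qed
  have g_distr: "(LBINT x. g x * \<psi> x) = distr U u \<psi>" if \<psi>: "\<psi> \<in> borel_measurable borel" for \<psi>
  proof -
    have m: "(\<lambda>x. g x * \<psi> x) \<in> borel_measurable lborel" using g_meas \<psi> by simp
    have \<psi>_leb: "\<psi> \<in> borel_measurable lebesgue" using \<psi> by (intro measurable_completion) simp
    have "distr U u \<psi> = (\<integral>z. indicator U z *\<^sub>R (u z * \<psi> z) \<partial>lebesgue)"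
      unfolding distr_def using U_sets(2) by (subst integral_restrict_space) auto
    also have "\<dots> = (\<integral>z. u0 z * \<psi> z \<partial>lebesgue)"
      by (intro Bochner_Integration.integral_cong refl) (simp add: u0_def indicator_def)
    also have "\<dots> = (\<integral>z. g z * \<psi> z \<partial>lebesgue)"
    proof (rule integral_cong_AE)
      show "AE x in lebesgue. u0 x * \<psi> x = g x * \<psi> x" using AE_leb by eventually_elim simp
    qed (use u0_meas g_leb \<psi>_leb in auto)
    also have "\<dots> = (LBINT z. g z * \<psi> z)" by (rule integral_completion[OF m])
    finally show ?thesis by simp
  qed
  have "AE x in lborel. x \<in> U \<longrightarrow> g x = u x" using AE_g by eventually_elim (simp add: u0_def)
  then show ?thesis using that[OF g_meas _ g_int g2] g_distr by blast
qed

lemma L2_of_borel: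
  fixes g :: "complex^'n \<Rightarrow> complex"
  assumes U: "open U" and g: "g \<in> borel_measurable borel" and g2: "integrable lborel (\<lambda>x. (norm (g x))\<^sup>2)"
  shows "g \<in> L2 U"
proof -
  have g_leb: "g \<in> borel_measurable lebesgue" using g by (intro measurable_completion) simp
  have "integrable lebesgue (\<lambda>x. (norm (g x))\<^sup>2)"
    using g g2 by (subst integrable_completion) auto
  then have "integrable (lebesgue_on U) (\<lambda>x. (norm (g x))\<^sup>2)"
    using integrable_mult_indicator[of U lebesgue "\<lambda>z. (norm (g z))\<^sup>2"] U
    by (subst integrable_restrict_space) auto
  then show ?thesis using measurable_restrict_space1[OF g_leb] by (simp add: L2_def)
qed

lemma distr_of_borel:
  fixes g :: "complex^'n \<Rightarrow> complex"
  assumes U: "open U" and "g \<in> borel_measurable borel" "\<psi> \<in> borel_measurable borel" and "\<And>x. x \<notin> U \<Longrightarrow> \<psi> x = 0"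
  shows "distr U g \<psi> = (LBINT x. g x * \<psi> x)"
proof -
  have m: "(\<lambda>x. g x * \<psi> x) \<in> borel_measurable lborel" using assms(2,3) by simp
  have "distr U g \<psi> = (\<integral>z. indicator U z *\<^sub>R (g z * \<psi> z) \<partial>lebesgue)"
    unfolding distr_def using U by (subst integral_restrict_space) auto
  also have "\<dots> = (\<integral>z. g z * \<psi> z \<partial>lebesgue)"
    by (intro Bochner_Integration.integral_cong refl) (use assms(4) in \<open>auto simp: indicator_def\<close>)
  also have "\<dots> = (LBINT z. g z * \<psi> z)" by (rule integral_completion[OF m])
  finally show ?thesis .
qed

section \<open>Gluing local solutions\<close>

text \<open>
  A cutoff function in \<open>U\<close> that is 1 near the part of the support of \<open>\<phi>\<close> outside \<open>V\<close>.
\<close>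

lemma test_function_split:
  fixes \<phi> :: "complex^'n \<Rightarrow> complex"
  assumes "open U" "open V" and \<phi>: "test_function (U \<union> V) \<phi>"
  obtains \<phi>1 \<phi>2 where "test_function U \<phi>1" "test_function V \<phi>2" "\<phi> = (\<lambda>x. \<phi>1 x + \<phi>2 x)"
proof -
  let ?S = "closure {x. \<phi> x \<noteq> 0}"
  have S: "compact ?S" "?S \<subseteq> U \<union> V" using \<phi> by (auto simp: test_function_def)
  have \<phi>_smooth: "smooth \<phi>" by (rule test_function_smooth[OF \<phi>])
  have C: "compact (?S - V)" "?S - V \<subseteq> U" using compact_diff[OF S(1) assms(2)] S(2) by auto
  obtain \<eta> :: "complex^'n \<Rightarrow> real" and N where \<eta>: "smooth \<eta>" "open N" "?S - V \<subseteq> N" "\<And>x. x \<in> N \<Longrightarrow> \<eta> x = 1"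
    "compact (closure {x. \<eta> x \<noteq> 0})" "closure {x. \<eta> x \<noteq> 0} \<subseteq> U"
    by (rule smooth_cutoff[OF C(1) assms(1) C(2)]) blast
  have \<eta>_smooth: "smooth (\<lambda>x. complex_of_real (\<eta> x))" by (rule smooth_of_real[OF \<eta>(1)])
  show ?thesis
  proof (rule that[of "\<lambda>x. \<phi> x * of_real (\<eta> x)" "\<lambda>x. \<phi> x * (1 + (-1) * of_real (\<eta> x))"])
    have "test_function U (\<lambda>x. complex_of_real (\<eta> x))"
      using \<eta>(5,6) \<eta>_smooth by (simp add: test_function_def smooth_def)
    then show "test_function U (\<lambda>x. \<phi> x * of_real (\<eta> x))" by (rule test_function_mult[OF \<phi>_smooth])
    show "test_function V (\<lambda>x. \<phi> x * (1 + (-1) * of_real (\<eta> x)))"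
    proof (rule test_functionI[where S = "?S - N"])
      show "smooth (\<lambda>x. \<phi> x * (1 + (-1) * of_real (\<eta> x)))"
        by (intro smooth_mult \<phi>_smooth smooth_add smooth_const smooth_cmult \<eta>_smooth)
      show "compact (?S - N)" by (rule compact_diff[OF S(1) \<eta>(2)])
      show "?S - N \<subseteq> V" using \<eta>(3) by blast
      show "\<phi> x * (1 + (-1) * of_real (\<eta> x)) \<noteq> 0 \<Longrightarrow> x \<in> ?S - N" for x
        using \<eta>(4)[of x] closure_subset[of "{x. \<phi> x \<noteq> 0}"] by auto
    qed
    show "\<phi> = (\<lambda>x. \<phi> x * of_real (\<eta> x) + \<phi> x * (1 + (-1) * of_real (\<eta> x)))"
      by (simp add: fun_eq_iff algebra_simps)
  qed
qed

text \<open>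
  A partition of unity argument: an additive property of test functions is local.
\<close>

lemma test_function_local_induct:
  fixes \<phi> :: "complex^'n \<Rightarrow> complex"
  assumes J: "finite J" and U: "\<And>j. j \<in> J \<Longrightarrow> open (U j)" and \<phi>: "test_function (\<Union>j\<in>J. U j) \<phi>"
    and zero: "P (\<lambda>x. 0)"
    and add: "\<And>\<phi> \<psi>. test_function UNIV \<phi> \<Longrightarrow> test_function UNIV \<psi> \<Longrightarrow> P \<phi> \<Longrightarrow> P \<psi> \<Longrightarrow> P (\<lambda>x. \<phi> x + \<psi> x)"
    and loc: "\<And>j \<phi>. j \<in> J \<Longrightarrow> test_function (U j) \<phi> \<Longrightarrow> P \<phi>"
  shows "P \<phi>"
  using J U \<phi> loc
proof (induction J arbitrary: \<phi> rule: finite_induct)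
  case empty
  then have "\<phi> x = 0" for x using test_function_eq_0[of "{}" \<phi> x] by simp
  then have "\<phi> = (\<lambda>x. 0)" by auto
  then show ?case using zero by simp
next
  case (insert j J)
  have opn: "open (U j)" "open (\<Union>j\<in>J. U j)" using insert.prems(1) by auto
  have "test_function (U j \<union> (\<Union>j\<in>J. U j)) \<phi>" using insert.prems(2) by simp
  then obtain \<phi>1 \<phi>2 where s: "test_function (U j) \<phi>1" "test_function (\<Union>j\<in>J. U j) \<phi>2" "\<phi> = (\<lambda>x. \<phi>1 x + \<phi>2 x)"
    by (rule test_function_split[OF opn])
  have "P \<phi>1" using insert.prems(3) s(1) by blast
  moreover have "P \<phi>2" by (rule insert.IH[OF _ s(2)]) (use insert.prems in auto)
  ultimately show ?case unfolding s(3) by (intro add test_function_UNIV[OF s(1)] test_function_UNIV[OF s(2)])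
qed

text \<open>
  Fix one index \<open>m\<close>. The difference of the solutions for \<open>m\<close> and \<open>j\<close> is weakly holomorphic on the common part of
  their domains, and its Hartogs extension \<open>H j\<close> is added to the solution \<open>u j\<close>. Any two of the resulting
  \<open>G i\<close> and \<open>G j\<close> agree off \<open>C m\<close>, hence on their whole common domain by the identity theorem.
\<close>

theorem dbar_exact_on_union_of_complements:
  fixes \<Omega> :: "(complex^'n) set" and C :: "nat \<Rightarrow> (complex^'n) set" and f :: "complex^'n \<Rightarrow> complex^'n"
  assumes card: "CARD('n) \<ge> 2" and \<Omega>: "open \<Omega>" "connected \<Omega>" "bounded \<Omega>" "\<Omega> \<noteq> {}"
    and J: "finite J" "J \<noteq> {}"
    and C: "\<And>j. j \<in> J \<Longrightarrow> compact (C j)" "\<And>j. j \<in> J \<Longrightarrow> C j \<noteq> {}" "\<And>j. j \<in> J \<Longrightarrow> C j \<subseteq> \<Omega>"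
    and conn: "\<And>i j. i \<in> J \<Longrightarrow> j \<in> J \<Longrightarrow> connected (\<Omega> - (C i \<union> C j))"
    and f: "f \<in> L2 (\<Union>j\<in>J. \<Omega> - C j)" and ex: "\<And>j. j \<in> J \<Longrightarrow> f \<in> dbar_exact (\<Omega> - C j)"
  shows "f \<in> dbar_exact (\<Union>j\<in>J. \<Omega> - C j)"
proof -
  let ?U = "\<lambda>j. \<Omega> - C j" and ?V = "\<Union>j\<in>J. \<Omega> - C j"
  have U_open: "open (?U j)" if "j \<in> J" for j using \<Omega>(1) C(1)[OF that] by (simp add: open_Diff compact_imp_closed)
  have V_open: "open ?V" using U_open by blast
  define Q where "Q j u \<longleftrightarrow> u \<in> borel_measurable borel \<and> integrable lborel u \<and> integrable lborel (\<lambda>x. (norm (u x))\<^sup>2) \<and>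
     (\<forall>\<phi> k. test_function (?U j) \<phi> \<longrightarrow> (LBINT x. u x * wirtinger_bar k \<phi> x) = - distr ?V (\<lambda>z. f z $ k) \<phi>)"
    for j and u :: "complex^'n \<Rightarrow> complex"
  have "\<exists>u. Q j u" if j: "j \<in> J" for j
  proof -
    obtain u where u: "u \<in> L2 (?U j)" "dbar_eq (?U j) u f" using ex[OF j] by (auto simp: dbar_exact_def)
    have "bounded (?U j)" using \<Omega>(3) by (rule bounded_subset) blast
    then obtain g where g: "g \<in> borel_measurable borel" "AE x in lborel. x \<in> ?U j \<longrightarrow> g x = u x"
      "integrable lborel g" "integrable lborel (\<lambda>x. (norm (g x))\<^sup>2)"
      "\<forall>\<psi>\<in>borel_measurable borel. (LBINT x. g x * \<psi> x) = distr (?U j) u \<psi>"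
      by (rule L2_borel_representative[OF U_open[OF j] _ u(1)])
    have "(LBINT x. g x * wirtinger_bar k \<phi> x) = - distr ?V (\<lambda>z. f z $ k) \<phi>" if \<phi>: "test_function (?U j) \<phi>" for \<phi> k
    proof -
      have "(LBINT x. g x * wirtinger_bar k \<phi> x) = - distr_dbar (?U j) k u \<phi>"
        using bspec[OF g(5) wirtinger_bar_measurable[OF test_function_smooth[OF \<phi>]]] by (simp add: distr_dbar_def)
      also have "\<dots> = - distr (?U j) (\<lambda>z. f z $ k) \<phi>" using u(2) \<phi> by (simp add: dbar_eq_def)
      also have "distr (?U j) (\<lambda>z. f z $ k) \<phi> = distr ?V (\<lambda>z. f z $ k) \<phi>"
        using j by (intro distr_subset[OF V_open U_open[OF j] _ test_function_eq_0[OF \<phi>]]) auto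
      finally show ?thesis .
    qed
    then show ?thesis unfolding Q_def using g(1,3,4) by blast
  qed
  then have "\<forall>j\<in>J. \<exists>u. Q j u" by blast
  from bchoice[OF this] obtain u where Q: "\<And>j. j \<in> J \<Longrightarrow> Q j (u j)" by blast
  have u: "\<And>j. j \<in> J \<Longrightarrow> u j \<in> borel_measurable borel" "\<And>j. j \<in> J \<Longrightarrow> integrable lborel (u j)"
    "\<And>j. j \<in> J \<Longrightarrow> integrable lborel (\<lambda>x. (norm (u j x))\<^sup>2)"
    "\<And>j \<phi> k. j \<in> J \<Longrightarrow> test_function (?U j) \<phi> \<Longrightarrow> (LBINT x. u j x * wirtinger_bar k \<phi> x) = - distr ?V (\<lambda>z. f z $ k) \<phi>"
    using Q unfolding Q_def by blast+
  have diff_hol: "weakly_holomorphic_on (\<lambda>x. v x - w x) (A \<inter> B)"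
    if "integrable lborel v" "integrable lborel w"
      and "\<And>\<phi> k. test_function A \<phi> \<Longrightarrow> (LBINT x. v x * wirtinger_bar k \<phi> x) = F k \<phi>"
      and "\<And>\<phi> k. test_function B \<phi> \<Longrightarrow> (LBINT x. w x * wirtinger_bar k \<phi> x) = F k \<phi>"
    for v w :: "complex^'n \<Rightarrow> complex" and A B F
    unfolding weakly_holomorphic_on_def
  proof (intro allI impI)
    fix \<phi> k assume \<phi>: "test_function (A \<inter> B) \<phi>"
    note T = test_function_wirtinger_bar[OF \<phi>, of k]
    have "(LBINT x. v x * wirtinger_bar k \<phi> x) = F k \<phi>" "(LBINT x. w x * wirtinger_bar k \<phi> x) = F k \<phi>"
      by (rule that(3)[OF test_function_mono[OF \<phi> Int_lower1]], rule that(4)[OF test_function_mono[OF \<phi> Int_lower2]])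
    then have "(LBINT x. v x * wirtinger_bar k \<phi> x - w x * wirtinger_bar k \<phi> x) = 0"
      using Bochner_Integration.integral_diff[OF integrable_mult_test_function[OF that(1) T] integrable_mult_test_function[OF that(2) T]]
      by simp
    then show "(LBINT x. (v x - w x) * wirtinger_bar k \<phi> x) = 0" by (simp add: left_diff_distrib)
  qed
  obtain m where m: "m \<in> J" using J(2) by blast
  define E where "E j H \<longleftrightarrow> H \<in> borel_measurable borel \<and> integrable lborel H \<and> integrable lborel (\<lambda>x. (norm (H x))\<^sup>2) \<and>
      weakly_holomorphic_on H \<Omega> \<and> (AE x in lborel. x \<in> \<Omega> - (C m \<union> C j) \<longrightarrow> H x = u m x - u j x)"
    for j and H :: "complex^'n \<Rightarrow> complex"
  have "\<exists>H. E j H" if j: "j \<in> J" for j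
  proof -
    have L: "compact (C m \<union> C j)" "C m \<union> C j \<noteq> {}" "C m \<union> C j \<subseteq> \<Omega>"
      using C m j by (auto simp: compact_Un)
    have hol: "weakly_holomorphic_on (\<lambda>x. u m x - u j x) (\<Omega> - (C m \<union> C j))"
      unfolding Diff_Un using u(4)[OF m] u(4)[OF j] by (rule diff_hol[OF u(2)[OF m] u(2)[OF j]])
    have meas: "(\<lambda>x. u m x - u j x) \<in> borel_measurable borel" using u(1) m j by simp
    have int: "integrable lborel (\<lambda>x. u m x - u j x)" using u(2) m j by simp
    have sq: "integrable lborel (\<lambda>x. (norm (u m x - u j x))\<^sup>2)"
      using square_integrable_add[of "u m" lborel "\<lambda>x. - u j x"] u(1,3) m j by simp
    obtain H where "H \<in> borel_measurable borel" "integrable lborel H" "integrable lborel (\<lambda>x. (norm (H x))\<^sup>2)"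
      "weakly_holomorphic_on H \<Omega>" "AE x in lborel. x \<in> \<Omega> - (C m \<union> C j) \<longrightarrow> H x = u m x - u j x"
      by (rule hartogs_extension[OF card \<Omega>(1,3) L conn[OF m j] meas int sq hol])
    then show ?thesis unfolding E_def by blast
  qed
  then have "\<forall>j\<in>J. \<exists>H. E j H" by blast
  from bchoice[OF this] obtain H where E: "\<And>j. j \<in> J \<Longrightarrow> E j (H j)" by blast
  have H: "\<And>j. j \<in> J \<Longrightarrow> H j \<in> borel_measurable borel" "\<And>j. j \<in> J \<Longrightarrow> integrable lborel (H j)"
    "\<And>j. j \<in> J \<Longrightarrow> integrable lborel (\<lambda>x. (norm (H j x))\<^sup>2)" "\<And>j. j \<in> J \<Longrightarrow> weakly_holomorphic_on (H j) \<Omega>"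
    "\<And>j. j \<in> J \<Longrightarrow> AE x in lborel. x \<in> \<Omega> - (C m \<union> C j) \<longrightarrow> H j x = u m x - u j x"
    using E unfolding E_def by blast+
  define G where "G j x = u j x + H j x" for j x
  have G_meas: "G j \<in> borel_measurable borel" if "j \<in> J" for j
    unfolding G_def using u(1)[OF that] H(1)[OF that] by simp
  have G_int: "integrable lborel (G j)" if "j \<in> J" for j
    unfolding G_def using u(2)[OF that] H(2)[OF that] by simp
  have G2: "integrable lborel (\<lambda>x. (norm (G j x))\<^sup>2)" if "j \<in> J" for j
    unfolding G_def using u(1,3)[OF that] H(1,3)[OF that] by (intro square_integrable_add) simp_all
  have G_dbar: "(LBINT x. G j x * wirtinger_bar k \<phi> x) = - distr ?V (\<lambda>z. f z $ k) \<phi>"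
    if j: "j \<in> J" and \<phi>: "test_function (?U j) \<phi>" for j k \<phi>
  proof -
    note T = test_function_wirtinger_bar[OF \<phi>]
    have "(LBINT x. H j x * wirtinger_bar k \<phi> x) = 0"
      using H(4)[OF j] test_function_mono[OF \<phi> Diff_subset] by (simp add: weakly_holomorphic_on_def)
    moreover have "(LBINT x. G j x * wirtinger_bar k \<phi> x)
        = (LBINT x. u j x * wirtinger_bar k \<phi> x) + (LBINT x. H j x * wirtinger_bar k \<phi> x)"
      unfolding G_def distrib_right
      by (rule Bochner_Integration.integral_add[OF integrable_mult_test_function[OF u(2)[OF j] T] integrable_mult_test_function[OF H(2)[OF j] T]])
    ultimately show ?thesis using u(4)[OF j \<phi>, of k] by simp
  qed
  have G_eq: "AE x in lborel. x \<in> \<Omega> - (C i \<union> C j) \<longrightarrow> G i x - G j x = 0" if i: "i \<in> J" and j: "j \<in> J" for i j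
  proof (rule weakly_holomorphic_identity[where A = "\<Omega> - (C m \<union> (C i \<union> C j))"])
    show "integrable lborel (\<lambda>x. G i x - G j x)" using G_int i j by simp
    show "weakly_holomorphic_on (\<lambda>x. G i x - G j x) (\<Omega> - (C i \<union> C j))"
      unfolding Diff_Un using G_dbar[OF i] G_dbar[OF j] by (rule diff_hol[OF G_int[OF i] G_int[OF j]])
    show "connected (\<Omega> - (C i \<union> C j))" by (rule conn[OF i j])
    have cpt: "compact (C m \<union> (C i \<union> C j))" using C(1) m i j by (intro compact_Un) auto
    show "open (\<Omega> - (C i \<union> C j))" using C(1) i j \<Omega>(1) by (simp add: open_Diff compact_imp_closed closed_Un)
    show "open (\<Omega> - (C m \<union> (C i \<union> C j)))" using cpt \<Omega>(1) by (simp add: open_Diff compact_imp_closed)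
    show "\<Omega> - (C m \<union> (C i \<union> C j)) \<noteq> {}"
    proof
      assume "\<Omega> - (C m \<union> (C i \<union> C j)) = {}"
      then have "\<Omega> = C m \<union> (C i \<union> C j)" using C(3) m i j by blast
      then have "compact \<Omega>" using cpt by simp
      then show False using \<Omega>(1,4) compact_open by blast
    qed
    show "\<Omega> - (C m \<union> (C i \<union> C j)) \<subseteq> \<Omega> - (C i \<union> C j)" by blast
    show "AE x in lborel. x \<in> \<Omega> - (C m \<union> (C i \<union> C j)) \<longrightarrow> G i x - G j x = 0"
      using H(5)[OF i] H(5)[OF j] by eventually_elim (auto simp: G_def)
  qed
  \<comment> \<open>The set on which \<open>j\<close> is the least index of a domain containing the point.\<close>
  define P where "P j = ?U j - (\<Union>i\<in>{i \<in> J. i < j}. ?U i)" for j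
  define g where "g x = (\<Sum>j\<in>J. indicator (P j) x *\<^sub>R G j x)" for x
  have P_sets: "P j \<in> sets borel" if "j \<in> J" for j
  proof -
    have "open (\<Union>i\<in>{i \<in> J. i < j}. ?U i)" using U_open by blast
    then show ?thesis unfolding P_def using U_open[OF that] by (intro sets.Diff borel_open)
  qed
  have g_val: "\<exists>i\<in>J. x \<in> ?U i \<and> g x = G i x" if "x \<in> ?V" for x
  proof -
    let ?Q = "\<lambda>i. i \<in> J \<and> x \<in> ?U i"
    have exQ: "\<exists>i. ?Q i" using that by blast
    define i where "i = (LEAST i. ?Q i)"
    have i: "?Q i" unfolding i_def using exQ by (rule LeastI_ex)
    have least: "i \<le> j" if "?Q j" for j unfolding i_def using that by (rule Least_le)
    have "x \<in> P j \<longleftrightarrow> j = i" if "j \<in> J" for j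
      using i least that unfolding P_def by (auto simp: not_less dest: le_antisym)
    then have "g x = (\<Sum>j\<in>J. if j = i then G j x else 0)"
      unfolding g_def by (intro sum.cong) (auto simp: indicator_def)
    also have "\<dots> = G i x" using i J(1) by simp
    finally show ?thesis using i by blast
  qed
  have g_eq: "AE x in lborel. x \<in> ?U j \<longrightarrow> g x = G j x" if j: "j \<in> J" for j
  proof -
    have "AE x in lborel. \<forall>i\<in>J. x \<in> \<Omega> - (C i \<union> C j) \<longrightarrow> G i x - G j x = 0"
      using G_eq j J(1) by (intro AE_finite_allI) auto
    then show ?thesis
    proof eventually_elim
      case (elim x)
      show ?case
      proof
        assume x: "x \<in> ?U j"
        then obtain i where "i \<in> J" "x \<in> ?U i" "g x = G i x" using g_val j by blast
        then show "g x = G j x" using elim x by auto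
      qed
    qed
  qed
  have g_meas: "g \<in> borel_measurable borel"
    unfolding g_def using G_meas P_sets by (intro borel_measurable_sum borel_measurable_scaleR borel_measurable_indicator)
  have g2: "integrable lborel (\<lambda>x. (norm (g x))\<^sup>2)"
  proof (rule Bochner_Integration.integrable_bound)
    show "integrable lborel (\<lambda>x. \<Sum>j\<in>J. (norm (G j x))\<^sup>2)" using G2 by simp
    show "(\<lambda>x. (norm (g x))\<^sup>2) \<in> borel_measurable lborel" using g_meas by simp
    show "AE x in lborel. norm ((norm (g x))\<^sup>2) \<le> norm (\<Sum>j\<in>J. (norm (G j x))\<^sup>2)"
    proof (intro AE_I2)
      fix x
      show "norm ((norm (g x))\<^sup>2) \<le> norm (\<Sum>j\<in>J. (norm (G j x))\<^sup>2)"
      proof (cases "x \<in> ?V")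
        case True
        then obtain i where "i \<in> J" "g x = G i x" using g_val by blast
        then have "(norm (g x))\<^sup>2 \<le> (\<Sum>j\<in>J. (norm (G j x))\<^sup>2)"
          using member_le_sum[of i J "\<lambda>j. (norm (G j x))\<^sup>2"] J(1) by simp
        then show ?thesis by simp
      next
        case False
        then have "g x = 0" unfolding g_def P_def by (intro sum.neutral) auto
        then show ?thesis by simp
      qed
    qed
  qed
  have g_L2: "g \<in> L2 ?V" by (rule L2_of_borel[OF V_open g_meas g2])
  have g_int: "integrable lborel g"
    unfolding g_def using integrable_mult_indicator[OF _ G_int] P_sets by (intro Bochner_Integration.integrable_sum) auto
  have "dbar_eq ?V g f"
    unfolding dbar_eq_def
  proof (intro allI impI)
    fix \<phi> k assume \<phi>: "test_function ?V \<phi>"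
    have "(LBINT x. g x * wirtinger_bar k \<phi> x) = - distr ?V (\<lambda>z. f z $ k) \<phi>"
    proof (rule test_function_local_induct[OF J(1) U_open \<phi>])
      have "wirtinger_bar k (\<lambda>x. 0) x = 0" for x :: "complex^'n" by (simp add: wirtinger_bar_def)
      then show "(LBINT x. g x * wirtinger_bar k (\<lambda>x. 0) x) = - distr ?V (\<lambda>z. f z $ k) (\<lambda>x. 0)"
        by (simp add: distr_def)
    next
      fix \<phi> \<psi> :: "complex^'n \<Rightarrow> complex"
      assume T: "test_function UNIV \<phi>" "test_function UNIV \<psi>"
        and eq: "(LBINT x. g x * wirtinger_bar k \<phi> x) = - distr ?V (\<lambda>z. f z $ k) \<phi>"
          "(LBINT x. g x * wirtinger_bar k \<psi> x) = - distr ?V (\<lambda>z. f z $ k) \<psi>"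
      have "(LBINT x. g x * wirtinger_bar k (\<lambda>x. \<phi> x + \<psi> x) x)
          = (LBINT x. g x * wirtinger_bar k \<phi> x) + (LBINT x. g x * wirtinger_bar k \<psi> x)"
        unfolding wirtinger_bar_add[OF T[THEN test_function_smooth]] distrib_left
        by (rule Bochner_Integration.integral_add[OF integrable_mult_test_function[OF g_int test_function_wirtinger_bar[OF T(1)]]
              integrable_mult_test_function[OF g_int test_function_wirtinger_bar[OF T(2)]]])
      moreover have "distr ?V (\<lambda>z. f z $ k) (\<lambda>x. \<phi> x + \<psi> x) = distr ?V (\<lambda>z. f z $ k) \<phi> + distr ?V (\<lambda>z. f z $ k) \<psi>"
        unfolding distr_def distrib_left
        by (rule Bochner_Integration.integral_add[OF L2_mult_test_integrable[OF V_open L2_component[OF f] T(1)]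
              L2_mult_test_integrable[OF V_open L2_component[OF f] T(2)]])
      ultimately show "(LBINT x. g x * wirtinger_bar k (\<lambda>x. \<phi> x + \<psi> x) x) = - distr ?V (\<lambda>z. f z $ k) (\<lambda>x. \<phi> x + \<psi> x)"
        using eq by simp
    next
      fix j \<phi> assume j: "j \<in> J" and \<phi>: "test_function (?U j) \<phi>"
      have "(LBINT x. g x * wirtinger_bar k \<phi> x) = (LBINT x. G j x * wirtinger_bar k \<phi> x)"
      proof (rule integral_cong_AE)
        show "AE x in lborel. g x * wirtinger_bar k \<phi> x = G j x * wirtinger_bar k \<phi> x"
          using g_eq[OF j]
        proof eventually_elim
          case (elim x)
          then show ?case using test_function_eq_0[OF test_function_wirtinger_bar[OF \<phi>], of x k] by (cases "x \<in> ?U j") auto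
        qed
      qed (use g_meas G_meas[OF j] wirtinger_bar_measurable[OF test_function_smooth[OF \<phi>]] in auto)
      then show "(LBINT x. g x * wirtinger_bar k \<phi> x) = - distr ?V (\<lambda>z. f z $ k) \<phi>"
        using G_dbar[OF j \<phi>] by simp
    qed auto
    moreover have "distr ?V g (wirtinger_bar k \<phi>) = (LBINT x. g x * wirtinger_bar k \<phi> x)"
      by (rule distr_of_borel[OF V_open g_meas wirtinger_bar_measurable[OF test_function_smooth[OF \<phi>]]
            test_function_eq_0[OF test_function_wirtinger_bar[OF \<phi>]]])
    ultimately show "distr_dbar ?V k g \<phi> = distr ?V (\<lambda>z. f z $ k) \<phi>"
      by (simp add: distr_dbar_def)
  qed
  then show ?thesis using f g_L2 unfolding dbar_exact_def by blast
qed

theorem theorem2: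
  fixes \<Omega>' K :: "(complex^'n) set" and Kj :: "nat \<Rightarrow> (complex^'n) set" and N :: nat
  assumes "CARD('n) \<ge> 2"
    and "open \<Omega>'" and "connected \<Omega>'" and "bounded \<Omega>'"
    and "compact K" and "K \<noteq> {}" and "K \<subseteq> \<Omega>'" and "connected (\<Omega>' - K)"
    and "Hausdorff_space (L2_cohomology_01 \<Omega>')"
    and "K = (\<Inter>j\<in>{1..N}. Kj j)"
    and "\<And>j. j \<in> {1..N} \<Longrightarrow> compact (Kj j) \<and> Kj j \<subseteq> \<Omega>' \<and> connected (\<Omega>' - Kj j)
           \<and> Hausdorff_space (L2_cohomology_01 (\<Omega>' - Kj j))"
    and "\<And>i j. i \<in> {1..N} \<Longrightarrow> j \<in> {1..N} \<Longrightarrow> connected (\<Omega>' - (Kj i \<union> Kj j))"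
  shows "Hausdorff_space (L2_cohomology_01 (\<Omega>' - K))"
proof -
  let ?J = "{1..N}" and ?U = "\<lambda>j. \<Omega>' - Kj j"
  have J: "?J \<noteq> {}"
  proof
    assume "?J = {}"
    then have "K = UNIV" using assms(10) by simp
    then show False using assms(5) compact_imp_bounded not_bounded_UNIV by metis
  qed
  have union: "\<Omega>' - K = (\<Union>j\<in>?J. ?U j)" unfolding assms(10) using J by blast
  have open_\<Omega>: "open (\<Omega>' - K)" using assms(2,5) by (simp add: open_Diff compact_imp_closed)
  have open_U: "open (?U j)" if "j \<in> ?J" for j
    using assms(2) assms(11)[OF that] by (simp add: open_Diff compact_imp_closed)
  have sub: "?U j \<subseteq> \<Omega>' - K" if "j \<in> ?J" for j using that unfolding assms(10) by blast
  show ?thesis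
  proof (rule exact_forms_closed_imp_Hausdorff[OF open_\<Omega>], unfold exact_forms_closed_def, intro ballI impI)
    fix f assume f: "f \<in> dbar_closed (\<Omega>' - K)"
      and approx: "\<forall>e>0. \<exists>g\<in>dbar_closed (\<Omega>' - K) \<inter> dbar_exact (\<Omega>' - K). L2_norm (\<Omega>' - K) (\<lambda>z. g z - f z) < e"
    have f_L2: "f \<in> L2 (\<Omega>' - K)" using f by (simp add: dbar_closed_def)
    have exact_U: "f \<in> dbar_exact (?U j)" if j: "j \<in> ?J" for j
    proof -
      note mono = open_\<Omega> open_U[OF j] sub[OF j]
      have "exact_forms_closed (?U j)"
        using assms(11)[OF j] by (intro Hausdorff_imp_exact_forms_closed open_U[OF j]) blast
      moreover have "f \<in> dbar_closed (?U j)" by (rule dbar_closed_subset[OF mono f])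
      moreover have "\<exists>g\<in>dbar_closed (?U j) \<inter> dbar_exact (?U j). L2_norm (?U j) (\<lambda>z. g z - f z) < e" if "e > 0" for e
      proof -
        from approx that obtain g where g: "g \<in> dbar_closed (\<Omega>' - K)" "g \<in> dbar_exact (\<Omega>' - K)"
          "L2_norm (\<Omega>' - K) (\<lambda>z. g z - f z) < e" by blast
        have "(\<lambda>z. g z - f z) \<in> L2 (\<Omega>' - K)" using g(1) f_L2 by (intro L2_diff) (auto simp: dbar_closed_def)
        from L2_subset(2)[OF mono this] g(3) have "L2_norm (?U j) (\<lambda>z. g z - f z) < e" by linarith
        then show ?thesis using dbar_closed_subset[OF mono g(1)] dbar_exact_subset[OF mono g(2)] by blast
      qed
      ultimately show ?thesis unfolding exact_forms_closed_def by blast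
    qed
    have "f \<in> dbar_exact (\<Union>j\<in>?J. ?U j)"
    proof (rule dbar_exact_on_union_of_complements[OF assms(1-4)])
      show "\<Omega>' \<noteq> {}" using assms(6,7) by blast
      show "Kj j \<noteq> {}" if "j \<in> ?J" for j using assms(6,10) that by blast
      show "f \<in> L2 (\<Union>j\<in>?J. ?U j)" using f_L2 unfolding union .
    qed (use J assms(11,12) exact_U in blast)+
    then show "f \<in> dbar_exact (\<Omega>' - K)" unfolding union .
  qed
qed

end
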